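(* There is a probability measure-valued process $(\mu_t)_{0\le t\le T}$ (non-random) such that for any polynomial $p(x)$, as $N\to\infty$, $$\langle\mu_t^{(N)},p\rangle\to\langle\mu_t,p\rangle$$ in probability in $C([0,T])$. The convergence still holds for polynomials in $t$ and $x$: for any polynomial $f(t,x)$ in $t$ and $x$, as $N\to\infty$, $\langle\mu_t^{(N)},f\rangle\to\langle\mu_t,f\rangle$ in probability in $C([0,T])$. Moreover, $\langle\mu_t,f\rangle$ is differentiable as a function of $t$ and $$\partial_t\langle\mu_t,f\rangle=\frac c2\iint\frac{f'(t,x)-f'(t,y)}{x-y}\,d\mu_t(x)\,d\mu_t(y)+\Big\langle\mu_t,\tfrac12 f''+\partial_t f\Big\rangle .$$
   Context: Fix $c\in(0,\infty)$ and $T>0$. For each $N\ge1$ set $\beta=2c/N$ and let $(\lambda_1(t),\dots,\lambda_N(t))_{t\ge 0}$ (depending on $N$) be the beta Dyson's Brownian motion started from $0$: the strong solution of $$d\lambda_i(t)=db_i(t)+\frac\beta2\sum_{j:j\ne i}\frac{1}{\lambda_i(t)-\lambda_j(t)}\,dt,\qquad \lambda_i(0)=0,\qquad i=1,\dots,N,$$ subject to the constraint $\lambda_1(t)\le\dots\le\lambda_N(t)$ for all $t>0$, where $b_1,\dots,b_N$ are independent standard Brownian motions. (For $0<\beta<1$ the system is understood in the sense of multivalued SDEs of Cépa–Lépingle, equivalently as a type A radial Dunkl process; almost surely the set of times $t$ with $\lambda_i(t)=\lambda_j(t)$ for some $i\ne j$ has Lebesgue measure zero. For $t>0$, the vector $(\lambda_i(t)/\sqrt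 t)_i$ has joint density proportional to $\prod_{i<j}|\lambda_j-\lambda_i|^\beta\prod_l e^{-\lambda_l^2/2}$ on $\{\lambda_1\le\dots\le\lambda_N\}$.) The empirical measure process is $\mu_t^{(N)}=\frac1N\sum_{i=1}^N\delta_{\lambda_i(t)}$. $\langle\mu,f\rangle=\int f\,d\mu$; for a function $f(t,x)$ of two variables, $\langle\mu_t,f\rangle=\int f(t,x)\,d\mu_t(x)$. Notation: $f'=\partial f/\partial x$, $f''=\partial^2f/\partial x^2$, $\partial_tf=\partial f/\partial t$; $\partial_t\langle\mu_t,f\rangle$ denotes the derivative with respect to $t$ of the function $t\mapsto\langle\mu_t,f\rangle$. The difference quotient $\frac{f'(t,x)-f'(t,y)}{x-y}$ is a polynomial, understood as $f''(t,x)$ when $x=y$. $C([0,T])$ is the space of continuous real functions on $[0,T]$ with the supremum norm $\|\cdot\|_\infty$. A sequence $X^{(N)}$ of $C([0,T])$-valued random elements converges in probability to a non-random $x\in C([0,T])$ if $\mathbb P(\|X^{(N)}-x\|_\infty\ge\varepsilon)\to0$ for every $\varepsilon>0$. *)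

theory Defs
  imports "HOL-Probability.Probability" "HOL-Computational_Algebra.Polynomial"
begin

definition standard_brownian_motion :: "'a measure \<Rightarrow> (real \<Rightarrow> 'a \<Rightarrow> real) \<Rightarrow> bool" where
  "standard_brownian_motion M W \<longleftrightarrow>
     (\<forall>t\<ge>0. W t \<in> borel_measurable M) \<and>
     (AE \<omega> in M. W 0 \<omega> = 0) \<and>
     (AE \<omega> in M. continuous_on {0..} (\<lambda>t. W t \<omega>)) \<and>
     (\<forall>s t. 0 \<le> s \<longrightarrow> s < t \<longrightarrow>
        distributed M lborel (\<lambda>\<omega>. W t \<omega> - W s \<omega>) (normal_density 0 (sqrt (t - s)))) \<and>
     (\<forall>(n::nat) (\<tau>::nat \<Rightarrow> real). 0 \<le> \<tau> 0 \<longrightarrow> mono \<tau> \<longrightarrow>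
        prob_space.indep_vars M (\<lambda>_. borel) (\<lambda>k \<omega>. W (\<tau> (Suc k)) \<omega> - W (\<tau> k) \<omega>) {..<n})"

(* The processes are independent as random variables with values in the space of real
   functions on {0..} with the product sigma-algebra. *)
definition independent_brownian_motions ::
    "'a measure \<Rightarrow> nat \<Rightarrow> (nat \<Rightarrow> real \<Rightarrow> 'a \<Rightarrow> real) \<Rightarrow> bool" where
  "independent_brownian_motions M N b \<longleftrightarrow>
     (\<forall>i\<in>{1..N}. standard_brownian_motion M (b i)) \<and>
     prob_space.indep_vars M (\<lambda>_. \<Pi>\<^sub>M t\<in>{0..}. borel) (\<lambda>i \<omega>. \<lambda>t\<in>{0..}. b i t \<omega>) {1..N}"

(* Filtration generated by b 1, ..., b N, augmented by the null sets of M. *)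
definition augmented_filtration ::
    "'a measure \<Rightarrow> nat \<Rightarrow> (nat \<Rightarrow> real \<Rightarrow> 'a \<Rightarrow> real) \<Rightarrow> real \<Rightarrow> 'a measure" where
  "augmented_filtration M N b t =
     sigma (space M)
       ({b i s -` A \<inter> space M | i s A. i \<in> {1..N} \<and> s \<in> {0..t} \<and> A \<in> sets borel} \<union> null_sets M)"

(* Strong solution, started from 0 and ordered, of
     d lam_i = d b_i + beta/2 * (sum over j \<noteq> i of 1 / (lam_i - lam_j)) dt.
   The noise is additive, so the equation is a pathwise integral equation and no stochastic
   integral occurs; the drift has to be Lebesgue integrable on bounded time intervals.  Since
   1 / 0 = 0 here, it is stated separately that the particles collide only on a Lebesgue null
   set of times.  For 0 < beta < 1 this is also the meaning of the multivalued equation of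
   Cepa and Lepingle for the potential -(beta/2) * (sum over i < j of ln (x_j - x_i)): its
   solution has absolutely continuous drift, and that potential is differentiable at
   every point of its domain, with the gradient as its only subgradient.  Paths are continuous
   everywhere and not just almost surely, so that they are random elements of a space of
   continuous functions. *)
definition dyson_brownian_motion ::
    "'a measure \<Rightarrow> real \<Rightarrow> nat \<Rightarrow> (nat \<Rightarrow> real \<Rightarrow> 'a \<Rightarrow> real) \<Rightarrow> (nat \<Rightarrow> real \<Rightarrow> 'a \<Rightarrow> real) \<Rightarrow> bool" where
  "dyson_brownian_motion M \<beta> N b lam \<longleftrightarrow>
     prob_space M \<and>
     independent_brownian_motions M N b \<and>
     (\<forall>i\<in>{1..N}. \<forall>t\<ge>0. lam i t \<in> borel_measurable (augmented_filtration M N b t)) \<and>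
     (\<forall>i\<in>{1..N}. \<forall>\<omega>\<in>space M. continuous_on {0..} (\<lambda>t. lam i t \<omega>)) \<and>
     (AE \<omega> in M.
        (\<forall>i\<in>{1..N}. lam i 0 \<omega> = 0) \<and>
        (\<forall>t>0. \<forall>i\<in>{1..N}. \<forall>j\<in>{1..N}. i \<le> j \<longrightarrow> lam i t \<omega> \<le> lam j t \<omega>) \<and>
        (\<forall>i\<in>{1..N}. \<forall>j\<in>{1..N}. i \<noteq> j \<longrightarrow>
           (AE s in lborel. 0 \<le> s \<longrightarrow> lam i s \<omega> \<noteq> lam j s \<omega>) \<and>
           (\<forall>t\<ge>0. set_integrable lborel {0..t} (\<lambda>s. 1 / (lam i s \<omega> - lam j s \<omega>)))) \<and>
        (\<forall>i\<in>{1..N}. \<forall>t\<ge>0.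
           lam i t \<omega> = b i t \<omega> +
             (LINT s:{0..t}|lborel. \<beta> / 2 * (\<Sum>j\<in>{1..N} - {i}. 1 / (lam i s \<omega> - lam j s \<omega>)))))"

(* (1/N) * (sum over i of the Dirac measure at x i), as the image of the uniform distribution
   on {1..N} under x *)
definition empirical_measure :: "nat \<Rightarrow> (nat \<Rightarrow> real) \<Rightarrow> real measure" where
  "empirical_measure N x = distr (uniform_count_measure {1..N}) borel x"

lemma integral_empirical_measure:
  assumes "N \<ge> 1" and [measurable]: "g \<in> borel_measurable borel"
  shows "(\<integral>y. g y \<partial>empirical_measure N x) = (\<Sum>i=1..N. (g (x i) :: real)) / real N"
  using assms(1) unfolding empirical_measure_def
  by (subst integral_distr)
     (auto simp: uniform_count_measure_def lebesgue_integral_point_measure_finite sum_divide_distrib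
           space_point_measure measurable_point_measure_eq1)

(* A polynomial f(t,x) is a polynomial in x whose coefficients are polynomials in t. *)
definition poly2 :: "real poly poly \<Rightarrow> real \<Rightarrow> real \<Rightarrow> real" where
  "poly2 f t x = poly (poly f [:x:]) t"

definition dx :: "real poly poly \<Rightarrow> real poly poly" where
  "dx f = pderiv f"

definition dt :: "real poly poly \<Rightarrow> real poly poly" where
  "dt f = map_poly pderiv f"

lemma poly2_0 [simp]: "poly2 0 t x = 0"
  by (simp add: poly2_def)

lemma poly2_pCons [simp]: "poly2 (pCons a f) t x = poly a t + x * poly2 f t x"
  by (simp add: poly2_def)

lemma poly2_add [simp]: "poly2 (f + g) t x = poly2 f t x + poly2 g t x"
  by (simp add: poly2_def)

lemma has_derivative_poly2_x:
  "((\<lambda>x. poly2 f t x) has_real_derivative poly2 (dx f) t x) (at x)"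
  by (induction f)
     (auto simp: dx_def pderiv_pCons intro!: derivative_eq_intros)

lemma has_derivative_poly2_t:
  "((\<lambda>t. poly2 f t x) has_real_derivative poly2 (dt f) t x) (at t)"
proof (induction f)
  case 0
  then show ?case by (simp add: dt_def)
next
  case (pCons a f)
  have "dt (pCons a f) = pCons (pderiv a) (dt f)"
    by (simp add: dt_def map_poly_pCons)
  then show ?case
    by (auto intro!: derivative_eq_intros pCons.IH poly_DERIV)
qed

definition diff_quotient :: "real poly poly \<Rightarrow> real \<Rightarrow> real \<Rightarrow> real \<Rightarrow> real" where
  "diff_quotient f t x y =
     (if x = y then poly2 (dx (dx f)) t x
      else (poly2 (dx f) t x - poly2 (dx f) t y) / (x - y))"

definition sup_norm :: "real \<Rightarrow> (real \<Rightarrow> real) \<Rightarrow> real" where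
  "sup_norm T g = (SUP t\<in>{0..T}. \<bar>g t\<bar>)"

(* Pointwise measurability is measurability for the Borel sigma-algebra of C([0,T]), because
   the latter is generated by the evaluation maps. *)
definition random_element_C :: "real \<Rightarrow> 'a measure \<Rightarrow> ('a \<Rightarrow> real \<Rightarrow> real) \<Rightarrow> bool" where
  "random_element_C T M X \<longleftrightarrow>
     (\<forall>\<omega>\<in>space M. continuous_on {0..T} (X \<omega>)) \<and>
     (\<forall>t\<in>{0..T}. (\<lambda>\<omega>. X \<omega> t) \<in> borel_measurable M)"

(* The sequence starts at N = 1, and its terms may live on different probability spaces. *)
definition converges_in_probability_C ::
    "real \<Rightarrow> (nat \<Rightarrow> 'a measure) \<Rightarrow> (nat \<Rightarrow> 'a \<Rightarrow> real \<Rightarrow> real) \<Rightarrow> (real \<Rightarrow> real) \<Rightarrow> bool" where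
  "converges_in_probability_C T M X x \<longleftrightarrow>
     (\<forall>N\<ge>1. random_element_C T (M N) (X N)) \<and>
     continuous_on {0..T} x \<and>
     (\<forall>\<epsilon>>0. (\<lambda>N. measure (M N) {\<omega> \<in> space (M N). sup_norm T (\<lambda>t. X N \<omega> t - x t) \<ge> \<epsilon>})
        \<longlonglongrightarrow> 0)"

end

theory Submission
  imports Defs
begin

text \<open>
Write \<open>S p t\<close> for the \<open>p\<close>-th moment of the empirical measure at time \<open>t\<close>. Ito's formula for \<open>x ^ p\<close>
gives \<open>S p t\<close> as the time integral of a drift plus a martingale. Symmetrising the repulsion in the
two particles turns \<open>1 / (x - y)\<close> into \<open>(x ^ (p-1) - y ^ (p-1)) / (x - y)\<close>, which is a polynomial.
The drift of \<open>S p\<close> is therefore a quadratic polynomial in the moments of order at most \<open>p - 2\<close>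
(\<open>generator_power_sum\<close>): the hierarchy of moments is triangular. If the martingales vanish as
\<open>N \<rightarrow> \<infinity>\<close>, all moments converge, one after the other, to the solution of the limiting hierarchy.
By Brownian scaling this solution is \<open>limit_moment c p * t ^ (p div 2)\<close>, with vanishing odd moments.

The martingale in \<open>S p\<close> has bracket \<open>p\<^sup>2 / N\<^sup>2\<close> times the integral of \<open>\<Sum>i. x i ^ (2 * p - 2)\<close>. Its
size involves moments of higher order than \<open>p\<close>, about which the hierarchy says nothing yet. The way
out is the factor \<open>1 / N\<^sup>2\<close>. As long as \<open>S (2 * q) \<le> K\<close> for some \<open>2 * q \<ge> p\<close>, one
has \<open>\<Sum>i. x i ^ (4 * q) \<le> (N * K)\<^sup>2\<close>, and \<open>2 * p - 2 < 4 * q\<close> makes the bracket smaller than any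
constant for large \<open>N\<close> (\<open>truncation_square_sum_bound\<close>). For \<open>p = 2 * q\<close> the truncation removes itself: up to the
first time at which \<open>S (2 * q)\<close> reaches \<open>K\<close> it follows a deterministic function that stays below
\<open>K - 1\<close>, so that time never comes (\<open>even_moment_converges\<close>). An odd moment is treated after the
even moment above it, which serves as its truncation.

Stochastic integrals can be bypassed. Since the noise is additive, \<open>x\<close> is a Brownian path plus a path of
finite variation, and Ito's formula reduces to a second-order Taylor expansion along a grid
(\<open>ito_taylor_grid\<close>). What is left of the noise on the grid is a sum of martingale differences,
controlled uniformly in time by Kolmogorov's maximal inequality; passing to finer
grids gives \<open>ito_remainder_tail\<close>.

The limit measures come from the particle systems themselves. Convergence in probability provides
single configurations with moments as close to the limiting ones as desired. Their empirical measures are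
tight, and a weak limit has the right moments (\<open>moment_limit_exists\<close>). Dilations of this one
law form the limit process, and its evolution equation is the limiting hierarchy, monomial by
monomial.
\<close>

section \<open>Brownian increments and the past\<close>

text \<open>
The times in \<open>U\<close> are sorted, with \<open>0\<close> in front and \<open>s\<close>, \<open>t\<close> at the end. Outside the null set where
\<open>W 0 \<noteq> 0\<close>, the cylinder event is an event in the increments along this grid up to time \<open>s\<close>, and
\<open>W t - W s\<close> is the increment after them.
\<close>
lemma (in prob_space) brownian_increment_indep_cylinder:
  assumes W: "standard_brownian_motion M W" and st: "0 \<le> s" "s < t"
    and U: "finite U" "U \<subseteq> {0..s}" and A: "\<And>u. u \<in> U \<Longrightarrow> A u \<in> sets borel" and D: "D \<in> sets borel"
  shows "prob ({\<omega>\<in>space M. \<forall>u\<in>U. W u \<omega> \<in> A u} \<inter> ((\<lambda>\<omega>. W t \<omega> - W s \<omega>) -` D \<inter> space M)) =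
    prob {\<omega>\<in>space M. \<forall>u\<in>U. W u \<omega> \<in> A u} * prob ((\<lambda>\<omega>. W t \<omega> - W s \<omega>) -` D \<inter> space M)"
proof -
  have meas: "W u \<in> borel_measurable M" if "0 \<le> u" for u
    using W that unfolding standard_brownian_motion_def by blast
  have W0: "AE \<omega> in M. W 0 \<omega> = 0"
    using W unfolding standard_brownian_motion_def by blast
  define us where "us = sorted_list_of_set (insert 0 U)"
  have set_us: "set us = insert 0 U" and sorted_us: "sorted us"
    using U unfolding us_def by (simp_all del: sorted_list_of_set_insert_remove)
  define m where "m = length us - 1"
  have "us \<noteq> []" using set_us by auto
  then have len: "length us = Suc m" by (auto simp: m_def)
  have us_ge0: "0 \<le> us ! k" and us_les: "us ! k \<le> s" if "k \<le> m" for k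
    using nth_mem[of k us] that len set_us U st by auto
  have us0: "us ! 0 = 0"
  proof -
    obtain k where "k \<le> m" "us ! k = 0"
      using set_us len by (metis in_set_conv_nth insertI1 less_Suc_eq_le)
    then have "us ! 0 \<le> 0" using sorted_us len sorted_nth_mono[of us 0 k] by auto
    then show ?thesis using us_ge0[of 0] by simp
  qed
  define \<tau> where "\<tau> k = (if k \<le> m then us ! k else if k = Suc m then s else t)" for k
  have mono: "mono \<tau>"
  proof (rule monoI)
    fix i j :: nat assume "i \<le> j"
    then show "\<tau> i \<le> \<tau> j"
      using sorted_nth_mono[OF sorted_us, of i j] us_les[of i] st len by (auto simp: \<tau>_def)
  qed
  define X where "X k \<omega> = W (\<tau> (Suc k)) \<omega> - W (\<tau> k) \<omega>" for k \<omega>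
  have \<tau>0: "\<tau> 0 = 0" by (simp add: \<tau>_def us0)
  have "indep_vars (\<lambda>_. borel) X {..<m+2}"
    using W mono \<tau>0 unfolding standard_brownian_motion_def X_def by auto
  then have ind: "indep_var (PiM {..<Suc m} (\<lambda>_. borel)) (\<lambda>\<omega>. restrict (\<lambda>i. X i \<omega>) {..<Suc m})
     (PiM {Suc m} (\<lambda>_. borel)) (\<lambda>\<omega>. restrict (\<lambda>i. X i \<omega>) {Suc m})"
    by (rule indep_var_restrict) auto
  define A' where "A' u = (if u \<in> U then A u else UNIV)" for u
  have [measurable]: "A' u \<in> sets borel" for u using A by (auto simp: A'_def)
  define C where "C = {f \<in> space (PiM {..<Suc m} (\<lambda>_. borel)). \<forall>k\<le>m. (\<Sum>j<k. f j) \<in> A' (us ! k)}"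
  have "{f \<in> space (PiM {..<Suc m} (\<lambda>_. borel)). (\<Sum>j<k. f j) \<in> A' (us ! k)} \<in> sets (PiM {..<Suc m} (\<lambda>_. borel))"
     if "k \<le> m" for k
  proof -
    have [measurable]: "(\<lambda>f. \<Sum>j<k. f j :: real) \<in> borel_measurable (PiM {..<Suc m} (\<lambda>_. borel))"
      using that by (intro borel_measurable_sum measurable_component_singleton) auto
    show ?thesis by measurable
  qed
  then have C: "C \<in> sets (PiM {..<Suc m} (\<lambda>_. borel))"
    using sets.sets_Collect_finite_All'[of "{..m}" "PiM {..<Suc m} (\<lambda>_. borel)" "\<lambda>k f. (\<Sum>j<k. f j) \<in> A' (us ! k)"]
    by (auto simp: C_def)
  define D' where "D' = {f \<in> space (PiM {Suc m} (\<lambda>_. borel)). f (Suc m) \<in> D}"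
  have D': "D' \<in> sets (PiM {Suc m} (\<lambda>_. borel))"
    using D unfolding D'_def by measurable
  have sumX: "(\<Sum>j<k. X j \<omega>) = W (us ! k) \<omega> - W 0 \<omega>" if "k \<le> m" for k \<omega>
    using that unfolding X_def by (subst sum_lessThan_telescope) (simp add: \<tau>_def us0)
  have XS: "X (Suc m) \<omega> = W t \<omega> - W s \<omega>" for \<omega>
    by (simp add: X_def \<tau>_def)
  have PD: "(\<lambda>\<omega>. restrict (\<lambda>i. X i \<omega>) {Suc m}) -` D' \<inter> space M = (\<lambda>\<omega>. W t \<omega> - W s \<omega>) -` D \<inter> space M"
    by (auto simp: D'_def space_PiM XS)
  have [measurable]: "X k \<in> borel_measurable M" for k
    using us_ge0 st unfolding X_def \<tau>_def by (intro borel_measurable_diff) (auto intro!: meas)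
  have C_iff: "restrict (\<lambda>i. X i \<omega>) {..<Suc m} \<in> C \<longleftrightarrow> (\<forall>u\<in>U. W u \<omega> \<in> A u)" if "W 0 \<omega> = 0" for \<omega>
  proof -
    have "restrict (\<lambda>i. X i \<omega>) {..<Suc m} \<in> C \<longleftrightarrow> (\<forall>k\<le>m. (\<Sum>j<k. X j \<omega>) \<in> A' (us ! k))"
    proof -
      have "(\<Sum>j<k. restrict (\<lambda>i. X i \<omega>) {..<Suc m} j) = (\<Sum>j<k. X j \<omega>)" if "k \<le> m" for k
        using that by (intro sum.cong) auto
      then show ?thesis by (auto simp: C_def space_PiM)
    qed
    also have "\<dots> \<longleftrightarrow> (\<forall>k\<le>m. W (us ! k) \<omega> \<in> A' (us ! k))"
      using sumX that by auto
    also have "\<dots> \<longleftrightarrow> (\<forall>u\<in>set us. W u \<omega> \<in> A' u)"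
      by (fastforce simp: in_set_conv_nth len less_Suc_eq_le)
    also have "\<dots> \<longleftrightarrow> (\<forall>u\<in>U. W u \<omega> \<in> A u)"
      by (auto simp: set_us A'_def)
    finally show ?thesis .
  qed
  have cyl: "{\<omega>\<in>space M. \<forall>u\<in>U. W u \<omega> \<in> A u} \<in> events"
  proof (rule sets.sets_Collect_finite_All)
    show "{\<omega> \<in> space M. W u \<omega> \<in> A u} \<in> events" if "u \<in> U" for u
      using measurable_sets[OF meas[of u] A[OF that]] U that by (auto simp: vimage_def Int_def conj_commute)
  qed (use U in auto) 
  have Devent: "(\<lambda>\<omega>. W t \<omega> - W s \<omega>) -` D \<inter> space M \<in> events"
    using meas[of t] meas[of s] st D by (auto intro!: measurable_sets[of _ M borel])
  have R: "(\<lambda>\<omega>. restrict (\<lambda>i. X i \<omega>) {..<Suc m}) \<in> measurable M (PiM {..<Suc m} (\<lambda>_. borel))"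
    by (intro measurable_restrict) simp
  have RC: "(\<lambda>\<omega>. restrict (\<lambda>i. X i \<omega>) {..<Suc m}) -` C \<inter> space M \<in> events"
    by (rule measurable_sets[OF R C])
  have e1: "prob ((\<lambda>\<omega>. restrict (\<lambda>i. X i \<omega>) {..<Suc m}) -` C \<inter> space M) = prob {\<omega>\<in>space M. \<forall>u\<in>U. W u \<omega> \<in> A u}"
    using W0 C_iff by (intro finite_measure_eq_AE RC cyl) auto
  have "prob ({\<omega>\<in>space M. \<forall>u\<in>U. W u \<omega> \<in> A u} \<inter> ((\<lambda>\<omega>. W t \<omega> - W s \<omega>) -` D \<inter> space M)) =
    prob (((\<lambda>\<omega>. restrict (\<lambda>i. X i \<omega>) {..<Suc m}) -` C \<inter> space M) \<inter> ((\<lambda>\<omega>. W t \<omega> - W s \<omega>) -` D \<inter> space M))"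
    using W0 C_iff by (intro finite_measure_eq_AE sets.Int RC cyl Devent) auto
  also have "\<dots> = prob ((\<lambda>\<omega>. (restrict (\<lambda>i. X i \<omega>) {..<Suc m}, restrict (\<lambda>i. X i \<omega>) {Suc m})) -` (C \<times> D') \<inter> space M)"
    unfolding PD[symmetric] by (intro arg_cong[where f=prob]) auto
  also have "\<dots> = prob {\<omega>\<in>space M. \<forall>u\<in>U. W u \<omega> \<in> A u} * prob ((\<lambda>\<omega>. W t \<omega> - W s \<omega>) -` D \<inter> space M)"
    using indep_varD[OF ind C D'] unfolding PD e1 .
  finally show ?thesis .
qed

text \<open>
The cylinder events generate the past and are stable under intersection.
\<close>
lemma (in prob_space) brownian_increment_indep_past:
  assumes W: "standard_brownian_motion M W" and st: "0 \<le> s" "s < t"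
  shows "indep_set (sigma_sets (space M) {W u -` A \<inter> space M | u A. u \<in> {0..s} \<and> A \<in> sets borel})
     (sigma_sets (space M) {(\<lambda>\<omega>. W t \<omega> - W s \<omega>) -` A \<inter> space M | A. A \<in> sets borel})"
proof -
  have meas: "W u \<in> borel_measurable M" if "0 \<le> u" for u
    using W that unfolding standard_brownian_motion_def by blast
  define C where "C = {{\<omega>\<in>space M. \<forall>u\<in>U. W u \<omega> \<in> A u} | U A. finite U \<and> U \<subseteq> {0..s} \<and> (\<forall>u\<in>U. A u \<in> sets borel)}"
  let ?G = "{W u -` A \<inter> space M | u A. u \<in> {0..s} \<and> A \<in> sets borel}"
  let ?D = "{(\<lambda>\<omega>. W t \<omega> - W s \<omega>) -` A \<inter> space M | A. A \<in> sets borel}"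
  have "indep_set C ?D"
  proof (rule indep_setI)
    show "C \<subseteq> events"
    proof
      fix E assume "E \<in> C"
      then obtain U A where E: "E = {\<omega>\<in>space M. \<forall>u\<in>U. W u \<omega> \<in> A u}" "finite U" "U \<subseteq> {0..s}" "\<forall>u\<in>U. A u \<in> sets borel"
        by (auto simp: C_def)
      show "E \<in> events" unfolding E
      proof (rule sets.sets_Collect_finite_All)
        show "{\<omega> \<in> space M. W u \<omega> \<in> A u} \<in> events" if "u \<in> U" for u
          using measurable_sets[OF meas[of u], of "A u"] E that by (auto simp: vimage_def Int_def conj_commute)
      qed (use E in auto)
    qed
    show "?D \<subseteq> events"
      using meas[of t] meas[of s] st by (auto intro!: measurable_sets[of _ M borel])
    fix a b assume "a \<in> C" "b \<in> ?D"
    then show "prob (a \<inter> b) = prob a * prob b"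
      using brownian_increment_indep_cylinder[OF W st] by (auto simp: C_def)
  qed
  moreover have "Int_stable C"
  proof (rule Int_stableI)
    fix a b assume "a \<in> C" "b \<in> C"
    then obtain U A V B where *: "a = {\<omega>\<in>space M. \<forall>u\<in>U. W u \<omega> \<in> A u}" "finite U" "U \<subseteq> {0..s}" "\<forall>u\<in>U. A u \<in> sets borel"
      "b = {\<omega>\<in>space M. \<forall>u\<in>V. W u \<omega> \<in> B u}" "finite V" "V \<subseteq> {0..s}" "\<forall>u\<in>V. B u \<in> sets borel"
      by (auto simp: C_def)
    let ?H = "\<lambda>u. (if u \<in> U then A u else UNIV) \<inter> (if u \<in> V then B u else UNIV)"
    have "a \<inter> b = {\<omega>\<in>space M. \<forall>u\<in>U \<union> V. W u \<omega> \<in> ?H u}"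
      unfolding * by auto
    moreover have "\<forall>u\<in>U \<union> V. ?H u \<in> sets borel" using * by auto
    ultimately show "a \<inter> b \<in> C"
      unfolding C_def using * by (intro CollectI exI[of _ "U \<union> V"] exI[of _ ?H]) simp
  qed
  moreover have "Int_stable ?D"
  proof (rule Int_stableI)
    fix a b assume "a \<in> ?D" "b \<in> ?D"
    then obtain A B where "a = (\<lambda>\<omega>. W t \<omega> - W s \<omega>) -` A \<inter> space M" "b = (\<lambda>\<omega>. W t \<omega> - W s \<omega>) -` B \<inter> space M"
      "A \<in> sets borel" "B \<in> sets borel" by auto
    then show "a \<inter> b \<in> ?D" by (intro CollectI exI[of _ "A \<inter> B"]) auto
  qed
  ultimately have I: "indep_set (sigma_sets (space M) C) (sigma_sets (space M) ?D)"
    by (rule indep_set_sigma_sets)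
  have "?G \<subseteq> C"
  proof
    fix E assume "E \<in> ?G"
    then obtain u A where "E = W u -` A \<inter> space M" "u \<in> {0..s}" "A \<in> sets borel" by auto
    then show "E \<in> C"
      unfolding C_def by (intro CollectI exI[of _ "{u}"] exI[of _ "\<lambda>_. A"]) auto
  qed
  then have "sigma_sets (space M) ?G \<subseteq> sigma_sets (space M) C"
    by (rule sigma_sets_mono')
  then show ?thesis
    using I unfolding indep_set_def
    by (elim indep_sets_mono_sets) (auto split: bool.split)
qed

text \<open>
For a single index the past and the increment are independent, and different indices have
independent paths. So the \<open>2 * N\<close> sigma-algebras of pasts and increments are jointly independent,
and they can be regrouped into all pasts and all increments.
\<close>
lemma (in prob_space) brownian_increments_indep_joint_past:
  assumes b: "independent_brownian_motions M N b" and N: "N \<ge> 1" and st: "0 \<le> s" "s < t"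
  shows "indep_set (sigma_sets (space M) {b i u -` A \<inter> space M | i u A. i \<in> {1..N} \<and> u \<in> {0..s} \<and> A \<in> sets borel})
     (sigma_sets (space M) {(\<lambda>\<omega>. b i t \<omega> - b i s \<omega>) -` A \<inter> space M | i A. i \<in> {1..N} \<and> A \<in> sets borel})"
proof -
  have bm: "standard_brownian_motion M (b i)" if "i \<in> {1..N}" for i
    using b that unfolding independent_brownian_motions_def by blast
  let ?X = "\<lambda>i \<omega>. \<lambda>t\<in>{0..}. b i t \<omega>"
  let ?P = "\<Pi>\<^sub>M t\<in>{0::real..}. (borel :: real measure)"
  define Path where "Path i = sigma_sets (space M) {?X i -` A \<inter> space M | A. A \<in> sets ?P}" for i
  define Past where "Past i = {b i u -` A \<inter> space M | u A. u \<in> {0..s} \<and> A \<in> sets borel}" for i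
  define Inc where "Inc i = {(\<lambda>\<omega>. b i t \<omega> - b i s \<omega>) -` A \<inter> space M | A. A \<in> sets borel}" for i
  have indX: "indep_sets Path {1..N}"
    using b unfolding independent_brownian_motions_def indep_vars_def Path_def by blast
  have Path_alg: "sigma_algebra (space M) (Path i)" for i
    unfolding Path_def by (rule sigma_algebra_sigma_sets) auto
  have PathI: "?X i -` A \<inter> space M \<in> Path i" if "A \<in> sets ?P" for A i
    unfolding Path_def using that by (intro sigma_sets.Basic) auto
  have past_path: "Past i \<subseteq> Path i" for i
  proof
    fix E assume "E \<in> Past i"
    then obtain u A where E: "E = b i u -` A \<inter> space M" "u \<in> {0..s}" and A: "A \<in> sets borel" by (auto simp: Past_def)
    have "{f \<in> space ?P. f u \<in> A} \<in> sets ?P"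
      using measurable_sets[OF measurable_component_singleton[of u "{0..}" "\<lambda>_. borel"] A] E(2)
      by (auto simp: vimage_def Int_def conj_commute)
    from PathI[OF this, of i] show "E \<in> Path i"
      using E by (auto simp: space_PiM vimage_def Int_def conj_commute)
  qed
  have inc_path: "Inc i \<subseteq> Path i" for i
  proof
    fix E assume "E \<in> Inc i"
    then obtain A where E: "E = (\<lambda>\<omega>. b i t \<omega> - b i s \<omega>) -` A \<inter> space M" and A: "A \<in> sets borel" by (auto simp: Inc_def)
    have "(\<lambda>f. f t - f s) \<in> borel_measurable ?P"
      using st by (intro borel_measurable_diff measurable_component_singleton) auto
    from measurable_sets[OF this A]
    have "{f \<in> space ?P. f t - f s \<in> A} \<in> sets ?P"
      by (auto simp: vimage_def Int_def conj_commute)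
    from PathI[OF this, of i] show "E \<in> Path i"
      using E st by (auto simp: space_PiM vimage_def Int_def conj_commute)
  qed
  define E where "E = (\<lambda>(i, \<beta>). sigma_sets (space M) (if \<beta> then Past i else Inc i))"
  have E_path: "E (i, \<beta>) \<subseteq> Path i" for i \<beta>
    unfolding E_def using past_path[of i] inc_path[of i] sigma_algebra.sigma_sets_subset[OF Path_alg[of i]]
    by (cases \<beta>) simp_all
  have Path_events: "Path i \<subseteq> events" if "i \<in> {1..N}" for i
    using indX that unfolding indep_sets_def by blast
  have E_ind: "indep_sets E ({1..N} \<times> UNIV)"
  proof (subst indep_sets_finite)
    show "{1..N} \<times> (UNIV :: bool set) \<noteq> {}" "finite ({1..N} \<times> (UNIV :: bool set))" using N by auto
    show "E j \<subseteq> events" if "j \<in> {1..N} \<times> UNIV" for j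
      using that E_path Path_events by (cases j) blast
    show "space M \<in> E j" for j
      unfolding E_def case_prod_beta by (rule sigma_sets_top)
    show "\<forall>A\<in>Pi ({1..N} \<times> UNIV) E. prob (\<Inter> (A ` ({1..N} \<times> UNIV))) = (\<Prod>j\<in>{1..N} \<times> UNIV. prob (A j))"
    proof
      fix A assume A: "A \<in> Pi ({1..N} \<times> UNIV) E"
      have "\<Inter> (A ` ({1..N} \<times> UNIV)) = (\<Inter>i\<in>{1..N}. A (i, True) \<inter> A (i, False))"
        by (auto simp: UNIV_bool)
      then have "prob (\<Inter> (A ` ({1..N} \<times> UNIV))) = prob (\<Inter>i\<in>{1..N}. A (i, True) \<inter> A (i, False))"
        by simp
      also have "\<dots> = (\<Prod>i\<in>{1..N}. prob (A (i, True) \<inter> A (i, False)))"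
      proof (rule indep_setsD[OF indX])
        show "\<forall>j\<in>{1..N}. A (j, True) \<inter> A (j, False) \<in> Path j"
        proof
          fix j assume j: "j \<in> {1..N}"
          then have "A (j, \<beta>) \<in> Path j" for \<beta>
            using A E_path[of j \<beta>] by (auto simp: Pi_iff)
          then show "A (j, True) \<inter> A (j, False) \<in> Path j"
            using sigma_algebra.axioms(1)[OF Path_alg[of j]] by (metis algebra.axioms(1) ring_of_sets.axioms(1) semiring_of_sets.Int)
        qed
      qed (use N in auto)
      also have "\<dots> = (\<Prod>i\<in>{1..N}. \<Prod>\<beta>\<in>UNIV. prob (A (i, \<beta>)))"
      proof (rule prod.cong[OF refl])
        fix i assume i: "i \<in> {1..N}"
        have "indep_set (sigma_sets (space M) (Past i)) (sigma_sets (space M) (Inc i))"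
          unfolding Past_def Inc_def by (rule brownian_increment_indep_past[OF bm[OF i] st])
        moreover have "A (i, True) \<in> sigma_sets (space M) (Past i)" "A (i, False) \<in> sigma_sets (space M) (Inc i)"
          using A i by (auto simp: Pi_iff E_def split: if_splits)
        ultimately show "prob (A (i, True) \<inter> A (i, False)) = (\<Prod>\<beta>\<in>UNIV. prob (A (i, \<beta>)))"
          by (simp add: indep_setD UNIV_bool mult.commute)
      qed
      also have "\<dots> = (\<Prod>j\<in>{1..N} \<times> UNIV. prob (A j))"
        by (simp add: prod.cartesian_product case_prod_beta)
      finally show "prob (\<Inter> (A ` ({1..N} \<times> UNIV))) = (\<Prod>j\<in>{1..N} \<times> UNIV. prob (A j))" .
    qed
  qed
  have *: "indep_sets (\<lambda>j. sigma_sets (space M) (\<Union>i\<in>{1..N} \<times> {j}. E i)) UNIV"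
  proof (rule indep_sets_collect_sigma)
    show "indep_sets E (\<Union>j. {1..N} \<times> {j})"
      using E_ind by (auto elim: indep_sets_mono_index[rotated])
    show "Int_stable (E i)" for i
    proof -
      have "sigma_algebra (space M) (E i)"
        unfolding E_def case_prod_beta
        by (rule sigma_algebra_sigma_sets) (auto simp: Past_def Inc_def)
      then show ?thesis by (intro algebra.Int_stable sigma_algebra.axioms(1))
    qed
    show "disjoint_family (\<lambda>j. {1..N} \<times> {j})" by (auto simp: disjoint_family_on_def)
  qed
  show ?thesis unfolding indep_set_def
  proof (rule indep_sets_mono_sets[OF *])
    fix j :: bool
    have "{b i u -` A \<inter> space M | i u A. i \<in> {1..N} \<and> u \<in> {0..s} \<and> A \<in> sets borel} \<subseteq> (\<Union>i\<in>{1..N} \<times> {True}. E i)"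
    proof safe
      fix i u A assume "i \<in> {1..N}" "u \<in> {0..s}" "A \<in> sets (borel :: real measure)"
      then have "b i u -` A \<inter> space M \<in> E (i, True)"
        unfolding E_def Past_def by (auto intro!: sigma_sets.Basic)
      then show "b i u -` A \<inter> space M \<in> (\<Union>i\<in>{1..N} \<times> {True}. E i)"
        using \<open>i \<in> {1..N}\<close> by blast
    qed
    moreover have "{(\<lambda>\<omega>. b i t \<omega> - b i s \<omega>) -` A \<inter> space M | i A. i \<in> {1..N} \<and> A \<in> sets borel} \<subseteq> (\<Union>i\<in>{1..N} \<times> {False}. E i)"
    proof safe
      fix i A assume "i \<in> {1..N}" "A \<in> sets (borel :: real measure)"
      then have "(\<lambda>\<omega>. b i t \<omega> - b i s \<omega>) -` A \<inter> space M \<in> E (i, False)"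
        unfolding E_def Inc_def by (auto intro!: sigma_sets.Basic)
      then show "(\<lambda>\<omega>. b i t \<omega> - b i s \<omega>) -` A \<inter> space M \<in> (\<Union>i\<in>{1..N} \<times> {False}. E i)"
        using \<open>i \<in> {1..N}\<close> by blast
    qed
    ultimately show "case_bool (sigma_sets (space M) {b i u -` A \<inter> space M | i u A. i \<in> {1..N} \<and> u \<in> {0..s} \<and> A \<in> sets borel})
      (sigma_sets (space M) {(\<lambda>\<omega>. b i t \<omega> - b i s \<omega>) -` A \<inter> space M | i A. i \<in> {1..N} \<and> A \<in> sets borel}) j
      \<subseteq> sigma_sets (space M) (\<Union>i\<in>{1..N} \<times> {j}. E i)"
      by (cases j) (auto intro!: sigma_sets_mono' del: subsetI)
  qed
qed

definition increment_algebra ::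
    "'a measure \<Rightarrow> nat \<Rightarrow> (nat \<Rightarrow> real \<Rightarrow> 'a \<Rightarrow> real) \<Rightarrow> real \<Rightarrow> real \<Rightarrow> 'a measure" where
  "increment_algebra M N b s t =
     sigma (space M) {(\<lambda>\<omega>. b i t \<omega> - b i s \<omega>) -` A \<inter> space M | i A. i \<in> {1..N} \<and> A \<in> sets borel}"

lemma space_augmented_filtration [simp]: "space (augmented_filtration M N b t) = space M"
  by (simp add: augmented_filtration_def space_measure_of_conv)

lemma space_increment_algebra [simp]: "space (increment_algebra M N b s t) = space M"
  by (simp add: increment_algebra_def space_measure_of_conv)

lemma sets_augmented_filtration:
  "sets (augmented_filtration M N b t) = sigma_sets (space M)
     ({b i s -` A \<inter> space M | i s A. i \<in> {1..N} \<and> s \<in> {0..t} \<and> A \<in> sets borel} \<union> null_sets M)"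
  unfolding augmented_filtration_def
  by (rule sets_measure_of) (auto dest: null_setsD2 sets.sets_into_space)

lemma sets_increment_algebra:
  "sets (increment_algebra M N b s t) = sigma_sets (space M)
     {(\<lambda>\<omega>. b i t \<omega> - b i s \<omega>) -` A \<inter> space M | i A. i \<in> {1..N} \<and> A \<in> sets borel}"
  unfolding increment_algebra_def by (rule sets_measure_of) auto

lemma independent_brownian_motions_measurable:
  assumes "independent_brownian_motions M N b" "i \<in> {1..N}" "0 \<le> t"
  shows "b i t \<in> borel_measurable M"
  using assms unfolding independent_brownian_motions_def standard_brownian_motion_def by blast

lemma subalgebra_augmented_filtration:
  assumes "independent_brownian_motions M N b"
  shows "subalgebra M (augmented_filtration M N b t)"
proof -
  have "b i s -` A \<inter> space M \<in> sets M" if "i \<in> {1..N}" "s \<in> {0..t}" "A \<in> sets borel" for i s A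
    using that by (intro measurable_sets[of _ M borel] independent_brownian_motions_measurable[OF assms]) auto
  then show ?thesis
    unfolding subalgebra_def sets_augmented_filtration
    by (intro conjI sets.sigma_sets_subset) auto
qed

lemma subalgebra_augmented_filtration_mono:
  assumes "s \<le> t"
  shows "subalgebra (augmented_filtration M N b t) (augmented_filtration M N b s)"
proof -
  have "{b i u -` A \<inter> space M | i u A. i \<in> {1..N} \<and> u \<in> {0..s} \<and> A \<in> sets borel}
      \<subseteq> {b i u -` A \<inter> space M | i u A. i \<in> {1..N} \<and> u \<in> {0..t} \<and> A \<in> sets borel}"
    using assms by (intro Collect_mono) (metis (no_types, lifting) atLeastAtMost_iff order_trans)
  then show ?thesis
    unfolding subalgebra_def sets_augmented_filtration
    by (intro conjI sigma_sets_mono' Un_mono) auto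
qed

lemma brownian_measurable_augmented_filtration:
  assumes "i \<in> {1..N}" "0 \<le> s" "s \<le> t"
  shows "b i s \<in> borel_measurable (augmented_filtration M N b t)"
proof (rule measurableI)
  fix A :: "real set" assume "A \<in> sets borel"
  then show "b i s -` A \<inter> space (augmented_filtration M N b t) \<in> sets (augmented_filtration M N b t)"
    unfolding sets_augmented_filtration using assms by (auto intro!: sigma_sets.Basic)
qed simp

lemma increment_measurable_increment_algebra:
  assumes "i \<in> {1..N}"
  shows "(\<lambda>\<omega>. b i t \<omega> - b i s \<omega>) \<in> borel_measurable (increment_algebra M N b s t)"
proof (rule measurableI)
  fix A :: "real set" assume "A \<in> sets borel"
  then show "(\<lambda>\<omega>. b i t \<omega> - b i s \<omega>) -` A \<inter> space (increment_algebra M N b s t) \<in> sets (increment_algebra M N b s t)"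
    unfolding sets_increment_algebra using assms by (auto intro!: sigma_sets.Basic)
qed simp

lemma subalgebra_increment_algebra:
  assumes "independent_brownian_motions M N b" "0 \<le> s" "0 \<le> t"
  shows "subalgebra M (increment_algebra M N b s t)"
proof -
  have "(\<lambda>\<omega>. b i t \<omega> - b i s \<omega>) -` A \<inter> space M \<in> sets M" if "i \<in> {1..N}" "A \<in> sets borel" for i A
    using that assms(2,3)
    by (intro measurable_sets[of _ M borel] borel_measurable_diff independent_brownian_motions_measurable[OF assms(1)]) auto
  then show ?thesis
    unfolding subalgebra_def sets_increment_algebra
    by (intro conjI sets.sigma_sets_subset) auto
qed

text \<open>
Null sets do no harm: the events that differ by a null set from an event in the past of the Brownian
motions form a sigma-algebra, which contains the augmented one.
\<close>
lemma (in prob_space) increments_indep_augmented_filtration: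
  assumes b: "independent_brownian_motions M N b" and N: "N \<ge> 1" and st: "0 \<le> s" "s < t"
  shows "indep_set (sets (augmented_filtration M N b s)) (sets (increment_algebra M N b s t))"
proof (rule indep_setI)
  let ?G = "{b i u -` A \<inter> space M | i u A. i \<in> {1..N} \<and> u \<in> {0..s} \<and> A \<in> sets borel}"
  show sub: "sets (augmented_filtration M N b s) \<subseteq> events"
    using subalgebra_augmented_filtration[OF b] by (auto simp: subalgebra_def)
  show sub2: "sets (increment_algebra M N b s t) \<subseteq> events"
    using subalgebra_increment_algebra[OF b] st by (auto simp: subalgebra_def)
  have G_sub: "sigma_sets (space M) ?G \<subseteq> events"
  proof (intro sets.sigma_sets_subset subsetI)
    fix E assume "E \<in> ?G"
    then obtain i u A where E: "E = b i u -` A \<inter> space M" "i \<in> {1..N}" "u \<in> {0..s}" "A \<in> sets borel" by auto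
    then have "b i u \<in> borel_measurable M" by (intro independent_brownian_motions_measurable[OF b]) auto
    then show "E \<in> events" using E by (auto intro: measurable_sets)
  qed
  fix A B assume A: "A \<in> sets (augmented_filtration M N b s)" and B: "B \<in> sets (increment_algebra M N b s t)"
  have "\<exists>A'\<in>sigma_sets (space M) ?G. AE \<omega> in M. \<omega> \<in> A \<longleftrightarrow> \<omega> \<in> A'"
    using A unfolding sets_augmented_filtration
  proof (induction rule: sigma_sets.induct)
    case (Basic a)
    then show ?case
    proof
      assume "a \<in> ?G" then show ?thesis by (intro bexI[of _ a]) (auto intro: sigma_sets.Basic)
    next
      assume "a \<in> null_sets M"
      then have "AE \<omega> in M. \<omega> \<in> a \<longleftrightarrow> \<omega> \<in> {}" by (auto dest: AE_not_in)
      then show ?thesis using sigma_sets.Empty by blast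
    qed
  next
    case Empty
    then show ?case by (intro bexI[of _ "{}"]) (auto intro: sigma_sets.Empty)
  next
    case (Compl a)
    then obtain A' where A': "A' \<in> sigma_sets (space M) ?G" "AE \<omega> in M. \<omega> \<in> a \<longleftrightarrow> \<omega> \<in> A'" by auto
    from A'(2) have "AE \<omega> in M. \<omega> \<in> space M - a \<longleftrightarrow> \<omega> \<in> space M - A'" by eventually_elim auto
    then show ?case using sigma_sets.Compl[OF A'(1)] by blast
  next
    case (Union a)
    then have "\<forall>i. \<exists>A'. A' \<in> sigma_sets (space M) ?G \<and> (AE \<omega> in M. \<omega> \<in> a i \<longleftrightarrow> \<omega> \<in> A')" by blast
    then obtain A' where A': "\<And>i. A' i \<in> sigma_sets (space M) ?G" "\<And>i::nat. AE \<omega> in M. \<omega> \<in> a i \<longleftrightarrow> \<omega> \<in> A' i"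
      unfolding choice_iff by blast
    from A'(2) have "AE \<omega> in M. \<forall>i. \<omega> \<in> a i \<longleftrightarrow> \<omega> \<in> A' i" by (simp add: AE_all_countable)
    then have "AE \<omega> in M. \<omega> \<in> (\<Union>i. a i) \<longleftrightarrow> \<omega> \<in> (\<Union>i. A' i)" by eventually_elim auto
    then show ?case using sigma_sets.Union[of A', OF A'(1)] by blast
  qed
  then obtain A' where A': "A' \<in> sigma_sets (space M) ?G" "AE \<omega> in M. \<omega> \<in> A \<longleftrightarrow> \<omega> \<in> A'" by auto
  have ev: "A \<in> events" "A' \<in> events" "B \<in> events" using A A' B sub sub2 G_sub by auto
  have "prob (A \<inter> B) = prob (A' \<inter> B)"
    using A'(2) ev by (intro finite_measure_eq_AE) auto
  also have "\<dots> = prob A' * prob B"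
    using indep_setD[OF brownian_increments_indep_joint_past[OF b N st] A'(1)] B
    by (auto simp: sets_increment_algebra)
  also have "prob A' = prob A"
    using A'(2) ev by (intro finite_measure_eq_AE) auto
  finally show "prob (A \<inter> B) = prob A * prob B" .
qed

text \<open>
This factorisation stands in for conditional expectations: in what follows, the martingale
property is only ever tested against functions of the past.
\<close>
lemma (in prob_space) expectation_past_times_increment:
  fixes h Y :: "'a \<Rightarrow> real"
  assumes b: "independent_brownian_motions M N b" and N: "N \<ge> 1" and st: "0 \<le> s" "s < t"
    and h: "h \<in> borel_measurable (augmented_filtration M N b s)" "integrable M h"
    and Y: "Y \<in> borel_measurable (increment_algebra M N b s t)" "integrable M Y"
  shows "expectation (\<lambda>\<omega>. h \<omega> * Y \<omega>) = expectation h * expectation Y" "integrable M (\<lambda>\<omega>. h \<omega> * Y \<omega>)"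
proof -
  have "indep_set (sigma_sets (space M) {h -` A \<inter> space M | A. A \<in> sets borel})
          (sigma_sets (space M) {Y -` A \<inter> space M | A. A \<in> sets borel})"
    using increments_indep_augmented_filtration[OF b N st] unfolding indep_set_def
  proof (rule indep_sets_mono_sets)
    have "sigma_sets (space M) {h -` A \<inter> space M | A. A \<in> sets borel} \<subseteq> sets (augmented_filtration M N b s)"
      using measurable_sets[OF h(1)] by (intro sets.sigma_sets_subset[of _ "augmented_filtration M N b s", simplified]) auto
    moreover have "sigma_sets (space M) {Y -` A \<inter> space M | A. A \<in> sets borel} \<subseteq> sets (increment_algebra M N b s t)"
      using measurable_sets[OF Y(1)] by (intro sets.sigma_sets_subset[of _ "increment_algebra M N b s t", simplified]) auto
    ultimately show "case_bool (sigma_sets (space M) {h -` A \<inter> space M | A. A \<in> sets borel})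
          (sigma_sets (space M) {Y -` A \<inter> space M | A. A \<in> sets borel}) i
        \<subseteq> case_bool (sets (augmented_filtration M N b s)) (sets (increment_algebra M N b s t)) i" for i
      by (cases i) auto
  qed
  then have "indep_var borel h borel Y"
    using h Y unfolding indep_var_eq by auto
  then show "expectation (\<lambda>\<omega>. h \<omega> * Y \<omega>) = expectation h * expectation Y" "integrable M (\<lambda>\<omega>. h \<omega> * Y \<omega>)"
    using h Y by (auto intro: indep_var_lebesgue_integral indep_var_integrable)
qed


section \<open>A maximal inequality\<close>

text \<open>
The sum \<open>W\<close> below is frozen once its modulus exceeds \<open>\<epsilon>\<close>. Then \<open>W n\<close> exceeds \<open>\<epsilon>\<close> as soon as
some partial sum does, and Chebyshev's inequality for \<open>W n\<close> suffices. Before the freezing \<open>W\<close> is bounded,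
so the mixed terms in the second moment vanish even though \<open>orth\<close> speaks of bounded functions only.
\<close>
lemma (in prob_space) kolmogorov_maximal_inequality:
  fixes U :: "nat \<Rightarrow> 'a \<Rightarrow> real"
  assumes sub: "\<And>k. subalgebra M (F k)" and filt: "\<And>k. subalgebra (F (Suc k)) (F k)"
    and meas: "\<And>k. U k \<in> borel_measurable (F (Suc k))" and sq: "\<And>k. integrable M (\<lambda>\<omega>. (U k \<omega>)\<^sup>2)"
    and orth: "\<And>k h C. h \<in> borel_measurable (F k) \<Longrightarrow> (\<And>\<omega>. \<bar>h \<omega>\<bar> \<le> C) \<Longrightarrow> expectation (\<lambda>\<omega>. h \<omega> * U k \<omega>) = 0"
    and "\<epsilon> > 0"
  shows "prob {\<omega>\<in>space M. \<exists>k\<le>n. \<bar>\<Sum>j<k. U j \<omega>\<bar> > \<epsilon>} \<le> (\<Sum>k<n. expectation (\<lambda>\<omega>. (U k \<omega>)\<^sup>2)) / \<epsilon>\<^sup>2"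
proof -
  define W where "W k \<omega> = rec_nat 0 (\<lambda>k w. w + (if \<bar>w\<bar> \<le> \<epsilon> then U k \<omega> else 0)) k" for k \<omega>
  have W0: "W 0 \<omega> = 0" and WS: "W (Suc k) \<omega> = W k \<omega> + (if \<bar>W k \<omega>\<bar> \<le> \<epsilon> then U k \<omega> else 0)" for k \<omega>
    by (simp_all add: W_def)
  have MU[measurable]: "U k \<in> borel_measurable M" for k
    by (rule measurable_from_subalg[OF sub meas])
  have WF: "W k \<in> borel_measurable (F k)" for k
  proof (induction k)
    case 0
    then show ?case by (simp add: W0)
  next
    case (Suc k)
    have [measurable]: "W k \<in> borel_measurable (F (Suc k))" "U k \<in> borel_measurable (F (Suc k))"
      using measurable_from_subalg[OF filt Suc] meas by auto
    show ?case unfolding WS by measurable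
  qed
  have [measurable]: "W k \<in> borel_measurable M" for k
    by (rule measurable_from_subalg[OF sub WF])
  have W2: "integrable M (\<lambda>\<omega>. (W k \<omega>)\<^sup>2) \<and> expectation (\<lambda>\<omega>. (W k \<omega>)\<^sup>2) \<le> (\<Sum>j<k. expectation (\<lambda>\<omega>. (U j \<omega>)\<^sup>2))" for k
  proof (induction k)
    case 0
    then show ?case by (simp add: W0)
  next
    case (Suc k)
    define h where "h \<omega> = 2 * (if \<bar>W k \<omega>\<bar> \<le> \<epsilon> then W k \<omega> else 0)" for \<omega>
    have hF: "h \<in> borel_measurable (F k)"
      using WF[of k] unfolding h_def by measurable
    have [measurable]: "h \<in> borel_measurable M" by (rule measurable_from_subalg[OF sub hF])
    have hb: "\<bar>h \<omega>\<bar> \<le> 2 * \<epsilon>" for \<omega> using \<open>\<epsilon> > 0\<close> by (auto simp: h_def)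
    have iU: "integrable M (U k)"
      using sq by (rule square_integrable_imp_integrable[rotated]) simp
    have ihU: "integrable M (\<lambda>\<omega>. h \<omega> * U k \<omega>)"
    proof (rule Bochner_Integration.integrable_bound[OF integrable_mult_right[OF integrable_abs[OF iU], of "2 * \<epsilon>"]])
      show "AE \<omega> in M. norm (h \<omega> * U k \<omega>) \<le> norm (2 * \<epsilon> * \<bar>U k \<omega>\<bar>)"
        using hb \<open>\<epsilon> > 0\<close> by (auto simp: abs_mult intro!: mult_right_mono)
    qed simp
    define J where "J \<omega> = (if \<bar>W k \<omega>\<bar> \<le> \<epsilon> then (U k \<omega>)\<^sup>2 else 0)" for \<omega>
    have [measurable]: "J \<in> borel_measurable M" unfolding J_def by measurable
    have iJ: "integrable M J"
      by (rule Bochner_Integration.integrable_bound[OF sq[of k]]) (auto simp: J_def)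
    have eq: "(W (Suc k) \<omega>)\<^sup>2 = (W k \<omega>)\<^sup>2 + h \<omega> * U k \<omega> + J \<omega>" for \<omega>
      by (simp add: WS h_def J_def power2_sum)
    have "expectation (\<lambda>\<omega>. (W (Suc k) \<omega>)\<^sup>2) = expectation (\<lambda>\<omega>. (W k \<omega>)\<^sup>2) + expectation (\<lambda>\<omega>. h \<omega> * U k \<omega>) + expectation J"
      unfolding eq using Suc ihU iJ by simp
    also have "expectation (\<lambda>\<omega>. h \<omega> * U k \<omega>) = 0"
      by (rule orth[OF hF hb])
    also have "expectation J \<le> expectation (\<lambda>\<omega>. (U k \<omega>)\<^sup>2)"
      by (rule integral_mono[OF iJ sq]) (simp add: J_def)
    finally have "expectation (\<lambda>\<omega>. (W (Suc k) \<omega>)\<^sup>2) \<le> (\<Sum>j<Suc k. expectation (\<lambda>\<omega>. (U j \<omega>)\<^sup>2))"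
      using Suc by simp
    moreover have "integrable M (\<lambda>\<omega>. (W (Suc k) \<omega>)\<^sup>2)"
      unfolding eq using Suc ihU iJ by simp
    ultimately show ?case by simp
  qed
  have path: "\<bar>W k \<omega>\<bar> > \<epsilon> \<or> (W k \<omega> = (\<Sum>j<k. U j \<omega>) \<and> (\<forall>l\<le>k. \<bar>\<Sum>j<l. U j \<omega>\<bar> \<le> \<epsilon>))" for k \<omega>
  proof (induction k)
    case 0
    then show ?case using \<open>\<epsilon> > 0\<close> by (simp add: W0)
  next
    case (Suc k)
    then show ?case by (auto simp: WS le_Suc_eq)
  qed
  have "{\<omega>\<in>space M. \<exists>k\<le>n. \<bar>\<Sum>j<k. U j \<omega>\<bar> > \<epsilon>} \<subseteq> {\<omega>\<in>space M. (W n \<omega>)\<^sup>2 \<ge> \<epsilon>\<^sup>2}"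
  proof safe
    fix \<omega> k assume "k \<le> n" "\<epsilon> < \<bar>\<Sum>j<k. U j \<omega>\<bar>"
    then have "\<bar>W n \<omega>\<bar> > \<epsilon>" using path[of n \<omega>] by force
    then show "\<epsilon>\<^sup>2 \<le> (W n \<omega>)\<^sup>2" using \<open>\<epsilon> > 0\<close> by (simp add: abs_le_square_iff[symmetric])
  qed
  then have "prob {\<omega>\<in>space M. \<exists>k\<le>n. \<bar>\<Sum>j<k. U j \<omega>\<bar> > \<epsilon>} \<le> prob {\<omega>\<in>space M. (W n \<omega>)\<^sup>2 \<ge> \<epsilon>\<^sup>2}"
    by (rule finite_measure_mono) simp
  also have "\<dots> \<le> expectation (\<lambda>\<omega>. (W n \<omega>)\<^sup>2) / \<epsilon>\<^sup>2"
    by (rule integral_Markov_inequality_measure[where A="{}"]) (use W2 \<open>\<epsilon> > 0\<close> in auto)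
  also have "\<dots> \<le> (\<Sum>k<n. expectation (\<lambda>\<omega>. (U k \<omega>)\<^sup>2)) / \<epsilon>\<^sup>2"
    using W2[of n] by (intro divide_right_mono) auto
  finally show ?thesis .
qed

section \<open>Ito's formula along grids, path by path\<close>

lemma set_integral_interval_combine:
  fixes g :: "real \<Rightarrow> real"
  assumes "u \<le> v" "v \<le> w" "set_integrable lborel {u..w} g"
  shows "(LINT r:{u..w}|lborel. g r) = (LINT r:{u..v}|lborel. g r) + (LINT r:{v..w}|lborel. g r)"
proof -
  have "{u..w} = {u..v} \<union> {v<..w}" using assms by auto
  then have "(LINT r:{u..w}|lborel. g r) = (LINT r:{u..v}|lborel. g r) + (LINT r:{v<..w}|lborel. g r)"
    using assms by (simp, intro set_integral_Un) (auto intro: set_integrable_subset)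
  also have "(LINT r:{v<..w}|lborel. g r) = (LINT r:{v..w}|lborel. g r)"
  proof -
    have "AE r in lborel. r \<noteq> v" by (rule AE_lborel_singleton)
    moreover have "set_borel_measurable lborel {v<..w} g" "set_borel_measurable lborel {v..w} g"
      using set_integrable_subset[OF assms(3), of "{v<..w}", simplified] set_integrable_subset[OF assms(3), of "{v..w}", simplified]
        assms(1,2) \<open>{u..w} = {u..v} \<union> {v<..w}\<close>
      unfolding set_borel_measurable_def set_integrable_def
      by (fastforce dest!: borel_measurable_integrable)+
    ultimately show ?thesis
      by (intro set_integral_cong_set) (auto elim: AE_mp)
  qed
  finally show ?thesis .
qed

lemma set_integrable_continuous_mult:
  fixes g h :: "real \<Rightarrow> real"
  assumes "set_integrable lborel {u..v} h" and g: "continuous_on {u..v} g"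
  shows "set_integrable lborel {u..v} (\<lambda>r. g r * h r)"
proof -
  obtain C where C: "\<And>r. r \<in> {u..v} \<Longrightarrow> \<bar>g r\<bar> \<le> C"
    using compact_imp_bounded[OF compact_continuous_image[OF g compact_Icc]] unfolding bounded_iff real_norm_def by blast
  have i: "integrable lborel (\<lambda>r. C * norm (indicator {u..v} r *\<^sub>R h r))"
    using assms(1) unfolding set_integrable_def by (intro integrable_mult_right integrable_norm)
  have m: "(\<lambda>r. (indicator {u..v} r *\<^sub>R g r) * (indicator {u..v} r *\<^sub>R h r)) \<in> borel_measurable lborel"
    using borel_measurable_integrable[OF assms(1)[unfolded set_integrable_def]]
      borel_measurable_continuous_on_indicator[OF _ g]
    by (intro borel_measurable_times) simp_all
  have e: "(indicator {u..v} r *\<^sub>R g r) * (indicator {u..v} r *\<^sub>R h r) = indicator {u..v} r *\<^sub>R (g r * h r)" for r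
    by (simp add: indicator_def)
  show ?thesis unfolding set_integrable_def
  proof (rule Bochner_Integration.integrable_bound[OF i])
    show "(\<lambda>r. indicator {u..v} r *\<^sub>R (g r * h r)) \<in> borel_measurable lborel" using m unfolding e .
    show "AE r in lborel. norm (indicator {u..v} r *\<^sub>R (g r * h r)) \<le> norm (C * norm (indicator {u..v} r *\<^sub>R h r))"
    proof (rule AE_I2)
      fix r
      show "norm (indicator {u..v} r *\<^sub>R (g r * h r)) \<le> norm (C * norm (indicator {u..v} r *\<^sub>R h r))"
        using C[of r] by (auto simp: indicator_def abs_mult intro!: mult_right_mono)
    qed
  qed
qed

lemma set_integral_abs_bound:
  fixes g h :: "real \<Rightarrow> real"
  assumes "set_integrable lborel A g" "set_integrable lborel A h" "\<And>r. r \<in> A \<Longrightarrow> \<bar>g r\<bar> \<le> h r"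
  shows "\<bar>LINT r:A|lborel. g r\<bar> \<le> (LINT r:A|lborel. h r)"
proof -
  have "\<bar>LINT r:A|lborel. g r\<bar> \<le> (LINT r:A|lborel. \<bar>g r\<bar>)"
    using set_integral_norm_bound[OF assms(1)] by simp
  also have "\<dots> \<le> (LINT r:A|lborel. h r)"
    using assms by (intro set_integral_mono set_integrable_abs) auto
  finally show ?thesis .
qed

lemma second_order_taylor:
  fixes f f' f'' :: "real \<Rightarrow> real"
  assumes f: "\<And>x. (f has_real_derivative f' x) (at x)" and f': "\<And>x. (f' has_real_derivative f'' x) (at x)"
  shows "\<exists>\<xi>. min a b \<le> \<xi> \<and> \<xi> \<le> max a b \<and> f b = f a + f' a * (b - a) + f'' \<xi> / 2 * (b - a)\<^sup>2"
proof (cases "a = b")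
  case False
  have "\<exists>\<xi>. (if b < a then b < \<xi> \<and> \<xi> < a else a < \<xi> \<and> \<xi> < b) \<and>
     f b = (\<Sum>m<2. ([f, f', f''] ! m) a / fact m * (b - a) ^ m) + ([f, f', f''] ! 2) \<xi> / fact 2 * (b - a) ^ 2"
  proof (rule Taylor[where a="min a b" and b="max a b"])
    show "\<forall>m t. m < 2 \<and> min a b \<le> t \<and> t \<le> max a b \<longrightarrow>
       (([f, f', f''] ! m) has_real_derivative ([f, f', f''] ! Suc m) t) (at t)"
      using f f' by (auto simp: numeral_2_eq_2 less_Suc_eq)
  qed (use False in auto)
  then obtain \<xi> where "if b < a then b < \<xi> \<and> \<xi> < a else a < \<xi> \<and> \<xi> < b"
    "f b = f a + f' a * (b - a) + f'' \<xi> / 2 * (b - a)\<^sup>2"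
    by (auto simp: numeral_2_eq_2)
  then show ?thesis by (intro exI[of _ \<xi>]) (auto split: if_splits)
qed auto

text \<open>
The second-order coefficient of the Taylor expansion is taken at some \<open>x r\<close> with \<open>r\<close> in the
interval, by the intermediate value theorem, so that the modulus of continuity \<open>\<omega>\<close> of \<open>f'' \<circ> x\<close> along
the path controls the error. The drift has finite variation and leaves no
second-order term. Compensating the square of the increment by \<open>v - u\<close> gives both terms
of the last bracket mean zero when \<open>\<beta>\<close> is a Brownian motion.
\<close>
lemma ito_taylor_step:
  fixes f f' f'' x \<beta> a :: "real \<Rightarrow> real"
  assumes f: "\<And>x. (f has_real_derivative f' x) (at x)" and f': "\<And>x. (f' has_real_derivative f'' x) (at x)"
    and f'': "continuous_on UNIV f''"
    and uv: "u \<le> v" and x: "continuous_on {u..v} x" and a: "set_integrable lborel {u..v} a"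
    and eq: "x v - x u = (\<beta> v - \<beta> u) + (LINT r:{u..v}|lborel. a r)"
    and osc: "\<And>r. r \<in> {u..v} \<Longrightarrow> \<bar>f' (x r) - f' (x u)\<bar> \<le> \<omega>" "\<And>r. r \<in> {u..v} \<Longrightarrow> \<bar>f'' (x r) - f'' (x u)\<bar> \<le> \<omega>"
      "\<bar>\<beta> v - \<beta> u\<bar> \<le> \<omega>" "\<bar>LINT r:{u..v}|lborel. a r\<bar> \<le> \<omega>"
    and G: "\<bar>f'' (x u)\<bar> \<le> G"
  shows "\<bar>f (x v) - f (x u) - (LINT r:{u..v}|lborel. f' (x r) * a r + f'' (x r) / 2)
      - (f' (x u) * (\<beta> v - \<beta> u) + f'' (x u) / 2 * ((\<beta> v - \<beta> u)\<^sup>2 - (v - u)))\<bar>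
    \<le> \<omega> * ((1 + 3 / 2 * G + \<omega>) * (LINT r:{u..v}|lborel. \<bar>a r\<bar>) + (v - u) + (\<beta> v - \<beta> u)\<^sup>2)"
proof -
  define B where "B = \<beta> v - \<beta> u"
  define A where "A = (LINT r:{u..v}|lborel. a r)"
  define I where "I = (LINT r:{u..v}|lborel. \<bar>a r\<bar>)"
  have "\<omega> \<ge> 0" using osc(3) by linarith
  have AI: "\<bar>A\<bar> \<le> I"
    unfolding A_def I_def by (intro set_integral_abs_bound set_integrable_abs a) auto
  have cont: "continuous_on {u..v} (\<lambda>r. f' (x r))" "continuous_on {u..v} (\<lambda>r. f'' (x r))"
    using continuous_on_compose2[OF _ x, of UNIV] f'' DERIV_isCont[OF f'] by (auto simp: continuous_on_eq_continuous_at)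
  have i1: "set_integrable lborel {u..v} (\<lambda>r. f' (x r) * a r)"
    by (rule set_integrable_continuous_mult[OF a cont(1)])
  have i2: "set_integrable lborel {u..v} (\<lambda>r. f'' (x r))"
    by (rule borel_integrable_atLeastAtMost'[OF cont(2)])
  have c: "set_integrable lborel {u..v} (\<lambda>r. k :: real)" for k
    by (rule borel_integrable_atLeastAtMost') auto
  have ci: "(LINT r:{u..v}|lborel. k) = k * (v - u)" for k :: real
    using uv by (simp add: set_lebesgue_integral_def)
  have e1: "\<bar>LINT r:{u..v}|lborel. (f' (x r) - f' (x u)) * a r\<bar> \<le> \<omega> * I"
  proof -
    have "\<bar>LINT r:{u..v}|lborel. (f' (x r) - f' (x u)) * a r\<bar> \<le> (LINT r:{u..v}|lborel. \<omega> * \<bar>a r\<bar>)"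
      using cont osc(1) by (intro set_integral_abs_bound set_integrable_continuous_mult[OF a] set_integrable_mult_right set_integrable_abs a)
        (auto simp: abs_mult intro!: continuous_intros mult_right_mono)
    then show ?thesis by (simp add: I_def)
  qed
  have e1': "(LINT r:{u..v}|lborel. (f' (x r) - f' (x u)) * a r) = (LINT r:{u..v}|lborel. f' (x r) * a r) - f' (x u) * A"
    using i1 a by (simp add: left_diff_distrib set_integral_diff A_def)
  have e3: "\<bar>LINT r:{u..v}|lborel. f'' (x r) - f'' (x u)\<bar> \<le> \<omega> * (v - u)"
    using set_integral_abs_bound[OF set_integral_diff(1)[OF i2 c[of "f'' (x u)"]] c[of \<omega>]] osc(2) by (simp add: ci)
  have e3': "(LINT r:{u..v}|lborel. f'' (x r) - f'' (x u)) = (LINT r:{u..v}|lborel. f'' (x r)) - f'' (x u) * (v - u)"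
    using i2 c by (simp add: set_integral_diff ci)
  obtain \<xi> where \<xi>: "min (x u) (x v) \<le> \<xi>" "\<xi> \<le> max (x u) (x v)"
    and ty: "f (x v) = f (x u) + f' (x u) * (x v - x u) + f'' \<xi> / 2 * (x v - x u)\<^sup>2"
    using second_order_taylor[of f f' f'' "x u" "x v", OF f f'] by blast
  have "\<exists>r\<in>{u..v}. x r = \<xi>"
  proof (cases "x u \<le> x v")
    case True
    then show ?thesis using IVT'[of x u \<xi> v] \<xi> uv x by auto
  next
    case False
    then show ?thesis using IVT2'[of x v \<xi> u] \<xi> uv x by auto
  qed
  then have osc\<xi>: "\<bar>f'' \<xi> - f'' (x u)\<bar> \<le> \<omega>" using osc(2) by blast
  have xuv: "x v - x u = B + A" using eq by (simp add: A_def B_def)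
  define E where "E = f (x v) - f (x u) - (LINT r:{u..v}|lborel. f' (x r) * a r + f'' (x r) / 2)
      - (f' (x u) * B + f'' (x u) / 2 * (B\<^sup>2 - (v - u)))"
  have split: "(LINT r:{u..v}|lborel. f' (x r) * a r + f'' (x r) / 2) =
      (LINT r:{u..v}|lborel. f' (x r) * a r) + (LINT r:{u..v}|lborel. f'' (x r)) / 2"
    using i1 i2 by (subst set_integral_add) auto
  have "E = - (LINT r:{u..v}|lborel. (f' (x r) - f' (x u)) * a r) - (LINT r:{u..v}|lborel. f'' (x r) - f'' (x u)) / 2
     + f'' (x u) / 2 * (2 * B * A + A\<^sup>2) + (f'' \<xi> - f'' (x u)) / 2 * (B + A)\<^sup>2"
    unfolding E_def split e1' e3' ty xuv by (simp add: field_simps power2_eq_square)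
  then have "\<bar>E\<bar> \<le> \<omega> * I + \<omega> * (v - u) / 2 + \<bar>f'' (x u) / 2 * (2 * B * A + A\<^sup>2)\<bar> + \<bar>(f'' \<xi> - f'' (x u)) / 2 * (B + A)\<^sup>2\<bar>"
    using e1 e3 by linarith
  also have "\<bar>f'' (x u) / 2 * (2 * B * A + A\<^sup>2)\<bar> \<le> G / 2 * (3 * \<omega> * I)"
  proof -
    have "\<bar>2 * B * A + A\<^sup>2\<bar> = \<bar>2 * B + A\<bar> * \<bar>A\<bar>" by (simp add: abs_mult[symmetric] power2_eq_square algebra_simps)
    also have "\<dots> \<le> (3 * \<omega>) * I"
      using osc(3,4) AI \<open>\<omega> \<ge> 0\<close> by (intro mult_mono) (auto simp: A_def[symmetric] B_def[symmetric])
    finally show ?thesis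
      using G unfolding abs_mult by (intro mult_mono) auto
  qed
  also have "\<bar>(f'' \<xi> - f'' (x u)) / 2 * (B + A)\<^sup>2\<bar> \<le> \<omega> / 2 * (2 * (B\<^sup>2 + \<omega> * I))"
  proof -
    have "(B + A)\<^sup>2 \<le> 2 * (B\<^sup>2 + A\<^sup>2)" using zero_le_power2[of "B - A"] by (simp add: power2_eq_square algebra_simps)
    also have "A\<^sup>2 \<le> \<omega> * I"
      using osc(4) AI \<open>\<omega> \<ge> 0\<close> unfolding power2_eq_square abs_mult_self_eq[symmetric, of A]
      by (intro mult_mono) (auto simp: A_def[symmetric])
    finally have "(B + A)\<^sup>2 \<le> 2 * (B\<^sup>2 + \<omega> * I)" by simp
    then show ?thesis using osc\<xi> unfolding abs_mult by (intro mult_mono) auto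
  qed
  also have "\<omega> * I + \<omega> * (v - u) / 2 + G / 2 * (3 * \<omega> * I) + \<omega> / 2 * (2 * (B\<^sup>2 + \<omega> * I))
     \<le> \<omega> * ((1 + 3 / 2 * G + \<omega>) * I + (v - u) + B\<^sup>2)"
  proof -
    have "\<omega> * (v - u) / 2 \<le> \<omega> * (v - u)" using mult_nonneg_nonneg[of \<omega> "v - u"] \<open>\<omega> \<ge> 0\<close> uv by simp
    moreover have "\<omega> * ((1 + 3 / 2 * G + \<omega>) * I + (v - u) + B\<^sup>2) =
        \<omega> * I + \<omega> * (v - u) + G / 2 * (3 * \<omega> * I) + \<omega> / 2 * (2 * (B\<^sup>2 + \<omega> * I))"
      by (simp add: field_simps)
    ultimately show ?thesis by linarith
  qed
  finally show ?thesis by (simp add: E_def B_def I_def)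
qed

text \<open>
The errors of the single steps add up to \<open>\<omega>\<close> times a quantity that is bounded in terms of the
variation of the drift, of \<open>T\<close> and of the sum of squares \<open>A\<close>, and \<open>\<omega>\<close> tends to \<open>0\<close> with the mesh.
The sum of squares appears as a hypothesis inside the statement because continuity of \<open>\<beta>\<close> does
not bound it along all grids.
\<close>
lemma ito_taylor_grid:
  fixes f f' f'' x \<beta> a :: "real \<Rightarrow> real" and T A e :: real
  assumes f: "\<And>x. (f has_real_derivative f' x) (at x)" and f': "\<And>x. (f' has_real_derivative f'' x) (at x)"
    and f'': "continuous_on UNIV f''"
    and T: "T > 0" and x: "continuous_on {0..T} x" and \<beta>: "continuous_on {0..T} \<beta>"
    and a: "set_integrable lborel {0..T} a"
    and eq: "\<And>t. t \<in> {0..T} \<Longrightarrow> x t = \<beta> t + (LINT r:{0..t}|lborel. a r)"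
    and e: "e > 0"
  shows "\<forall>\<^sub>F n in sequentially. (\<Sum>j<n. (\<beta> (T * Suc j / n) - \<beta> (T * j / n))\<^sup>2) \<le> A \<longrightarrow>
    (\<forall>k\<le>n. \<bar>f (x (T * k / n)) - f (x 0) - (LINT r:{0..T * k / n}|lborel. f' (x r) * a r + f'' (x r) / 2)
      - (\<Sum>j<k. f' (x (T * j / n)) * (\<beta> (T * Suc j / n) - \<beta> (T * j / n)) +
            f'' (x (T * j / n)) / 2 * ((\<beta> (T * Suc j / n) - \<beta> (T * j / n))\<^sup>2 - T / n))\<bar> \<le> e)"
proof -
  define I where "I = (LINT r:{0..T}|lborel. \<bar>a r\<bar>)"
  have ai: "set_integrable lborel {u..v} a" if "0 \<le> u" "v \<le> T" for u v
    using that by (intro set_integrable_subset[OF a]) auto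
  have "I \<ge> 0" unfolding I_def set_lebesgue_integral_def by (intro integral_nonneg_AE) auto
  have cont: "continuous_on {0..T} (\<lambda>r. f' (x r))" "continuous_on {0..T} (\<lambda>r. f'' (x r))"
    using continuous_on_compose2[OF _ x, of UNIV] f'' DERIV_isCont[OF f'] by (auto simp: continuous_on_eq_continuous_at)
  have gi: "set_integrable lborel {u..v} (\<lambda>r. f' (x r) * a r + f'' (x r) / 2)" if "0 \<le> u" "v \<le> T" for u v
  proof -
    have "set_integrable lborel {0..T} (\<lambda>r. f' (x r) * a r + f'' (x r) / 2)"
      using set_integrable_continuous_mult[OF a cont(1)] borel_integrable_atLeastAtMost'[OF cont(2)]
      by (intro set_integral_add) auto
    then show ?thesis using that by (rule_tac set_integrable_subset) auto
  qed
  obtain G where G: "\<And>r. r \<in> {0..T} \<Longrightarrow> \<bar>f'' (x r)\<bar> \<le> G"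
    using compact_imp_bounded[OF compact_continuous_image[OF cont(2) compact_Icc]] unfolding bounded_iff real_norm_def by blast
  then have "G \<ge> 0" using T by (meson abs_ge_zero atLeastAtMost_iff order_trans less_imp_le order_refl)
  define S where "S = (2 + 3 / 2 * G) * I + T + \<bar>A\<bar>"
  have "S > 0" using \<open>I \<ge> 0\<close> \<open>G \<ge> 0\<close> T unfolding S_def by (intro add_pos_nonneg add_nonneg_pos mult_nonneg_nonneg) auto
  define \<omega> where "\<omega> = min 1 (e / S)"
  have \<omega>: "\<omega> > 0" "\<omega> \<le> 1" "\<omega> * S \<le> e"
    using \<open>S > 0\<close> e by (auto simp: \<omega>_def min_def field_simps)
  have uc: "\<exists>d>0. \<forall>u\<in>{0..T}. \<forall>r\<in>{0..T}. \<bar>r - u\<bar> < d \<longrightarrow> \<bar>g r - g u\<bar> \<le> \<omega>" if "continuous_on {0..T} g" for g :: "real \<Rightarrow> real"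
    using compact_uniformly_continuous[OF that compact_Icc] \<omega>(1)
    unfolding uniformly_continuous_on_def dist_real_def by (meson less_imp_le)
  obtain d1 where d1: "d1 > 0" "\<And>u r. u \<in> {0..T} \<Longrightarrow> r \<in> {0..T} \<Longrightarrow> \<bar>r - u\<bar> < d1 \<Longrightarrow> \<bar>f' (x r) - f' (x u)\<bar> \<le> \<omega>"
    using uc[OF cont(1)] by blast
  obtain d2 where d2: "d2 > 0" "\<And>u r. u \<in> {0..T} \<Longrightarrow> r \<in> {0..T} \<Longrightarrow> \<bar>r - u\<bar> < d2 \<Longrightarrow> \<bar>f'' (x r) - f'' (x u)\<bar> \<le> \<omega>"
    using uc[OF cont(2)] by blast
  obtain d3 where d3: "d3 > 0" "\<And>u r. u \<in> {0..T} \<Longrightarrow> r \<in> {0..T} \<Longrightarrow> \<bar>r - u\<bar> < d3 \<Longrightarrow> \<bar>\<beta> r - \<beta> u\<bar> \<le> \<omega>"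
    using uc[OF \<beta>] by blast
  obtain d4 where d4: "d4 > 0" "\<And>u r. u \<in> {0..T} \<Longrightarrow> r \<in> {0..T} \<Longrightarrow> \<bar>r - u\<bar> < d4 \<Longrightarrow> \<bar>(x r - \<beta> r) - (x u - \<beta> u)\<bar> \<le> \<omega>"
    using uc[OF continuous_on_diff[OF x \<beta>]] by blast
  define d where "d = Min {d1, d2, d3, d4}"
  have d: "d > 0" "d \<le> d1" "d \<le> d2" "d \<le> d3" "d \<le> d4" using d1 d2 d3 d4 by (auto simp: d_def)
  have "\<forall>\<^sub>F n in sequentially. T / real n < d"
    using order_tendstoD(2)[OF lim_const_over_n d(1)] by simp
  moreover have "\<forall>\<^sub>F n in sequentially. n > (0::nat)" by (rule eventually_gt_at_top)
  ultimately show ?thesis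
  proof eventually_elim
    case (elim n)
    define t where "t k = T * real k / real n" for k :: nat
    have t0: "t 0 = 0" by (simp add: t_def)
    have tS: "t (Suc k) - t k = T / n" for k by (simp add: t_def ring_distribs add_divide_distrib)
    have t_le: "t j \<le> t k" if "j \<le> k" for j k using that T elim by (auto simp: t_def intro!: divide_right_mono)
    have tn: "t n = T" using elim by (simp add: t_def)
    have tT: "t k \<in> {0..T}" if "k \<le> n" for k using t_le[of 0 k] t_le[OF that] by (simp add: t0 tn)
    define D where "D j = \<beta> (t (Suc j)) - \<beta> (t j)" for j
    define L where "L u v = (LINT r:{u..v}|lborel. f' (x r) * a r + f'' (x r) / 2)" for u v
    define J where "J j = f' (x (t j)) * D j + f'' (x (t j)) / 2 * ((D j)\<^sup>2 - T / n)" for j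
    have step: "\<bar>f (x (t (Suc j))) - f (x (t j)) - L (t j) (t (Suc j)) - J j\<bar>
       \<le> \<omega> * ((2 + 3 / 2 * G) * (LINT r:{t j..t (Suc j)}|lborel. \<bar>a r\<bar>) + T / n + (D j)\<^sup>2)" if "j < n" for j
    proof -
      have le: "t j \<le> t (Suc j)" by (rule t_le) simp
      have in0: "t j \<in> {0..T}" "t (Suc j) \<in> {0..T}" using tT that by auto
      have near: "r \<in> {0..T}" "\<bar>r - t j\<bar> < d" if "r \<in> {t j..t (Suc j)}" for r
        using that in0 tS[of j] elim by auto
      have nearS: "\<bar>t (Suc j) - t j\<bar> < d" using near[of "t (Suc j)"] le by auto
      have eq': "(x (t (Suc j)) - \<beta> (t (Suc j))) - (x (t j) - \<beta> (t j)) = (LINT r:{t j..t (Suc j)}|lborel. a r)"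
        using eq[OF in0(1)] eq[OF in0(2)] set_integral_interval_combine[of 0 "t j" "t (Suc j)" a] le in0 ai[of 0 "t (Suc j)"] by auto
      have "\<bar>f (x (t (Suc j))) - f (x (t j)) - (LINT r:{t j..t (Suc j)}|lborel. f' (x r) * a r + f'' (x r) / 2)
      - (f' (x (t j)) * (\<beta> (t (Suc j)) - \<beta> (t j)) + f'' (x (t j)) / 2 * ((\<beta> (t (Suc j)) - \<beta> (t j))\<^sup>2 - (t (Suc j) - t j)))\<bar>
      \<le> \<omega> * ((1 + 3 / 2 * G + \<omega>) * (LINT r:{t j..t (Suc j)}|lborel. \<bar>a r\<bar>) + (t (Suc j) - t j) + (\<beta> (t (Suc j)) - \<beta> (t j))\<^sup>2)"
      proof (rule ito_taylor_step[OF f f' f'' le])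
        show "continuous_on {t j..t (Suc j)} x" using in0 by (intro continuous_on_subset[OF x]) auto
        show "set_integrable lborel {t j..t (Suc j)} a" using in0 by (intro ai) auto
        show "x (t (Suc j)) - x (t j) = \<beta> (t (Suc j)) - \<beta> (t j) + (LINT r:{t j..t (Suc j)}|lborel. a r)"
          using eq' by simp
        show "\<bar>f' (x r) - f' (x (t j))\<bar> \<le> \<omega>" if "r \<in> {t j..t (Suc j)}" for r
          using d1(2)[OF in0(1) near(1)[OF that]] near(2)[OF that] d(2) by auto
        show "\<bar>f'' (x r) - f'' (x (t j))\<bar> \<le> \<omega>" if "r \<in> {t j..t (Suc j)}" for r
          using d2(2)[OF in0(1) near(1)[OF that]] near(2)[OF that] d(3) by auto
        show "\<bar>\<beta> (t (Suc j)) - \<beta> (t j)\<bar> \<le> \<omega>" using d3(2)[OF in0] nearS d by auto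
        show "\<bar>LINT r:{t j..t (Suc j)}|lborel. a r\<bar> \<le> \<omega>" using d4(2)[OF in0] nearS d eq' by auto
        show "\<bar>f'' (x (t j))\<bar> \<le> G" by (rule G[OF in0(1)])
      qed
      also have "\<dots> \<le> \<omega> * ((2 + 3 / 2 * G) * (LINT r:{t j..t (Suc j)}|lborel. \<bar>a r\<bar>) + (t (Suc j) - t j) + (\<beta> (t (Suc j)) - \<beta> (t j))\<^sup>2)"
      proof -
        have "(LINT r:{t j..t (Suc j)}|lborel. \<bar>a r\<bar>) \<ge> 0"
          unfolding set_lebesgue_integral_def by (intro integral_nonneg_AE) auto
        then show ?thesis using \<omega> by (intro mult_left_mono add_right_mono mult_right_mono) auto
      qed
      finally show ?thesis by (simp add: L_def J_def D_def tS)
    qed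
    have sumL: "(\<Sum>j<k. (LINT r:{t j..t (Suc j)}|lborel. g r)) = (LINT r:{0..t k}|lborel. g r)"
      if "k \<le> n" "\<And>u v. 0 \<le> u \<Longrightarrow> v \<le> T \<Longrightarrow> set_integrable lborel {u..v} g" for k and g :: "real \<Rightarrow> real"
      using that(1)
    proof (induction k)
      case 0
      have "(LINT r:{0..0}|lborel. g r) = 0"
        using set_integral_interval_combine[of 0 0 0 g] that(2)[of 0 0] T by simp
      then show ?case by (simp add: t0)
    next
      case (Suc k)
      then show ?case
        using set_integral_interval_combine[of 0 "t k" "t (Suc k)" g] t_le[of k "Suc k"] tT[of k] tT[of "Suc k"] that(2)[of 0 "t (Suc k)"] by auto
    qed
    have I_sum: "(\<Sum>j<n. (LINT r:{t j..t (Suc j)}|lborel. \<bar>a r\<bar>)) = I"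
      using sumL[of n "\<lambda>r. \<bar>a r\<bar>"] ai by (auto simp: tn I_def intro: set_integrable_abs)
    show ?case
    proof (intro impI allI)
      fix k assume A: "(\<Sum>j<n. (\<beta> (T * Suc j / n) - \<beta> (T * j / n))\<^sup>2) \<le> A" and k: "k \<le> n"
      have A': "(\<Sum>j<n. (D j)\<^sup>2) \<le> \<bar>A\<bar>" using A by (simp add: D_def t_def)
      have "f (x (t k)) - f (x 0) - L 0 (t k) - (\<Sum>j<k. J j)
         = (\<Sum>j<k. f (x (t (Suc j))) - f (x (t j)) - L (t j) (t (Suc j)) - J j)"
        using sumL[OF k gi] sum_lessThan_telescope[of "\<lambda>j. f (x (t j))" k] by (simp add: sum_subtractf L_def t0)
      also have "\<bar>\<dots>\<bar> \<le> (\<Sum>j<k. \<omega> * ((2 + 3 / 2 * G) * (LINT r:{t j..t (Suc j)}|lborel. \<bar>a r\<bar>) + T / n + (D j)\<^sup>2))"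
        using step k by (intro order_trans[OF sum_abs] sum_mono) auto
      also have "\<dots> \<le> (\<Sum>j<n. \<omega> * ((2 + 3 / 2 * G) * (LINT r:{t j..t (Suc j)}|lborel. \<bar>a r\<bar>) + T / n + (D j)\<^sup>2))"
      proof (rule sum_mono2)
        fix j
        have "(LINT r:{t j..t (Suc j)}|lborel. \<bar>a r\<bar>) \<ge> 0"
          unfolding set_lebesgue_integral_def by (intro integral_nonneg_AE) auto
        then show "0 \<le> \<omega> * ((2 + 3 / 2 * G) * (LINT r:{t j..t (Suc j)}|lborel. \<bar>a r\<bar>) + T / n + (D j)\<^sup>2)"
          using \<omega> \<open>G \<ge> 0\<close> T by (intro mult_nonneg_nonneg add_nonneg_nonneg) auto
      qed (use k in auto)
      also have "\<dots> = \<omega> * ((2 + 3 / 2 * G) * I + T + (\<Sum>j<n. (D j)\<^sup>2))"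
        unfolding sum_distrib_left[symmetric] sum.distrib I_sum using elim by simp
      also have "\<dots> \<le> \<omega> * S" using A' \<omega> unfolding S_def by (intro mult_left_mono) auto
      also have "\<dots> \<le> e" by (rule \<omega>(3))
      finally show "\<bar>f (x (T * k / n)) - f (x 0) - (LINT r:{0..T * k / n}|lborel. f' (x r) * a r + f'' (x r) / 2)
      - (\<Sum>j<k. f' (x (T * j / n)) * (\<beta> (T * Suc j / n) - \<beta> (T * j / n)) +
            f'' (x (T * j / n)) / 2 * ((\<beta> (T * Suc j / n) - \<beta> (T * j / n))\<^sup>2 - T / n))\<bar> \<le> e"
        by (simp add: L_def J_def D_def t_def)
    qed
  qed
qed

section \<open>Smallness of the noise\<close>

lemma (in prob_space) brownian_increment_moments:
  assumes W: "standard_brownian_motion M W" and st: "0 \<le> s" "s < t"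
  shows "integrable M (\<lambda>\<omega>. (W t \<omega> - W s \<omega>) ^ k)"
    and "expectation (\<lambda>\<omega>. W t \<omega> - W s \<omega>) = 0"
    and "expectation (\<lambda>\<omega>. (W t \<omega> - W s \<omega>)\<^sup>2) = t - s"
    and "expectation (\<lambda>\<omega>. (W t \<omega> - W s \<omega>) ^ 4) = 3 * (t - s)\<^sup>2"
proof -
  have D: "distributed M lborel (\<lambda>\<omega>. W t \<omega> - W s \<omega>) (normal_density 0 (sqrt (t - s)))"
    using W st unfolding standard_brownian_motion_def by blast
  have pos: "0 < sqrt (t - s)" using st by simp
  show "integrable M (\<lambda>\<omega>. (W t \<omega> - W s \<omega>) ^ k)"
    using integrable_normal_moment[OF pos, of 0 k] distributed_integrable[OF D, of "\<lambda>x. x ^ k"] by simp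
  have E: "expectation (\<lambda>\<omega>. (W t \<omega> - W s \<omega>) ^ k) = (LINT x|lborel. normal_density 0 (sqrt (t - s)) x * x ^ k)" for k
    using distributed_integral[OF D, of "\<lambda>x. x ^ k"] by simp
  show "expectation (\<lambda>\<omega>. W t \<omega> - W s \<omega>) = 0"
    using E[of 1] integral_normal_moment_odd[OF pos, of 0 0] by simp
  show "expectation (\<lambda>\<omega>. (W t \<omega> - W s \<omega>)\<^sup>2) = t - s"
    using E[of 2] integral_normal_moment_even[OF pos, of 0 1] st by simp
  show "expectation (\<lambda>\<omega>. (W t \<omega> - W s \<omega>) ^ 4) = 3 * (t - s)\<^sup>2"
    using E[of 4] integral_normal_moment_even[OF pos, of 0 2] st by (simp add: fact_numeral power_divide)
qed

lemma (in prob_space) brownian_increments_uncorrelated: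
  assumes b: "independent_brownian_motions M N b" and st: "0 \<le> s" "s < t"
    and ij: "i \<in> {1..N}" "j \<in> {1..N}" "i \<noteq> j"
  shows "expectation (\<lambda>\<omega>. (b i t \<omega> - b i s \<omega>) * (b j t \<omega> - b j s \<omega>)) = 0"
proof -
  have bm: "standard_brownian_motion M (b i)" "standard_brownian_motion M (b j)"
    using b ij unfolding independent_brownian_motions_def by blast+
  have "indep_vars (\<lambda>_. \<Pi>\<^sub>M t\<in>{0..}. borel) (\<lambda>i \<omega>. \<lambda>t\<in>{0..}. b i t \<omega>) {1..N}"
    using b unfolding independent_brownian_motions_def by blast
  then have "indep_vars (\<lambda>_. borel) (\<lambda>k \<omega>. (\<lambda>f. f t - f s) (\<lambda>t\<in>{0..}. b k t \<omega>)) {1..N}"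
    by (rule indep_vars_compose2)
       (use st in \<open>auto intro!: borel_measurable_diff measurable_component_singleton\<close>)
  then have "indep_vars (\<lambda>_. borel) (\<lambda>k \<omega>. b k t \<omega> - b k s \<omega>) {1..N}"
    using st by simp
  then have ind: "indep_vars (\<lambda>_. borel) (\<lambda>k \<omega>. b k t \<omega> - b k s \<omega>) {i, j}"
    by (rule indep_vars_subset) (use ij in auto)
  have "expectation (\<lambda>\<omega>. \<Prod>k\<in>{i,j}. (b k t \<omega> - b k s \<omega>)) = (\<Prod>k\<in>{i,j}. expectation (\<lambda>\<omega>. b k t \<omega> - b k s \<omega>))"
    using brownian_increment_moments(1)[OF bm(1) st, of 1] brownian_increment_moments(1)[OF bm(2) st, of 1]
    by (intro indep_vars_lebesgue_integral[OF _ ind]) auto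
  then show ?thesis
    using ij brownian_increment_moments(2)[OF bm(1) st] by simp
qed

lemma continuous_on_set_integral:
  fixes g :: "real \<Rightarrow> real"
  assumes "set_integrable lborel {0..T} g"
  shows "continuous_on {0..T} (\<lambda>t. LINT r:{0..t}|lborel. g r)"
proof -
  have "g integrable_on {0..T}" using assms by (rule set_borel_integral_eq_integral)
  then have "continuous_on {0..T} (\<lambda>t. integral {0..t} g)" by (rule indefinite_integral_continuous_1)
  moreover have "(LINT r:{0..t}|lborel. g r) = integral {0..t} g" if "t \<in> {0..T}" for t
    using that by (intro set_borel_integral_eq_integral set_integrable_subset[OF assms]) auto
  ultimately show ?thesis by (subst continuous_on_cong[OF refl]) auto
qed

text \<open>
If \<open>x i\<close> is \<open>b i\<close> plus the integral of \<open>a i\<close>, this is the stochastic integral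
\<open>(1 / N) * (\<Sum>i. \<integral> f' (x i) db i)\<close>, written by Ito's formula in terms that make sense path by path.
\<close>
definition ito_remainder ::
    "(real \<Rightarrow> real) \<Rightarrow> (real \<Rightarrow> real) \<Rightarrow> (real \<Rightarrow> real) \<Rightarrow> nat \<Rightarrow>
     (nat \<Rightarrow> real \<Rightarrow> real) \<Rightarrow> (nat \<Rightarrow> real \<Rightarrow> real) \<Rightarrow> real \<Rightarrow> real" where
  "ito_remainder f f' f'' N x a t =
     (\<Sum>i=1..N. f (x i t) - f (x i 0) - (LINT r:{0..t}|lborel. f' (x i r) * a i r + f'' (x i r) / 2)) / N"

text \<open>
The switch on \<open>P\<close> looks at the past only and keeps the coefficients bounded, so the summands are
martingale differences. Increments of different particles are orthogonal; this is where the
gain from averaging over \<open>N\<close> independent motions, expressed by \<open>V\<close>, enters. The compensated squares contribute only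
order \<open>(T / n)\<^sup>2\<close> per step, for which the Cauchy-Schwarz inequality over the particles is good
enough.
\<close>
lemma (in prob_space) truncated_ito_increments:
  fixes x b :: "nat \<Rightarrow> real \<Rightarrow> 'a \<Rightarrow> real" and P :: "(nat \<Rightarrow> real) \<Rightarrow> bool"
  assumes b: "independent_brownian_motions M N b" and N: "N \<ge> 1" and T: "T > 0" and n: "n > 0"
    and adapted: "\<And>i t. i \<in> {1..N} \<Longrightarrow> 0 \<le> t \<Longrightarrow> x i t \<in> borel_measurable (augmented_filtration M N b t)"
    and f'[measurable]: "f' \<in> borel_measurable borel" and f''[measurable]: "f'' \<in> borel_measurable borel"
    and P_meas: "\<And>t. 0 \<le> t \<Longrightarrow> {\<omega>\<in>space M. P (\<lambda>i. x i t \<omega>)} \<in> sets (augmented_filtration M N b t)"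
    and P_bound: "\<And>y i. P y \<Longrightarrow> i \<in> {1..N} \<Longrightarrow> \<bar>f' (y i)\<bar> \<le> G" "\<And>y i. P y \<Longrightarrow> i \<in> {1..N} \<Longrightarrow> \<bar>f'' (y i)\<bar> \<le> G"
    and V: "\<And>y. P y \<Longrightarrow> (\<Sum>i=1..N. (f' (y i))\<^sup>2) \<le> V * (real N)\<^sup>2" "V \<ge> 0" and G: "G \<ge> 0" and \<delta>: "\<delta> > 0"
  defines "t \<equiv> \<lambda>k. T * real k / real n"
  defines "D \<equiv> \<lambda>i j \<omega>. b i (t (Suc j)) \<omega> - b i (t j) \<omega>"
  shows "prob {\<omega>\<in>space M. \<exists>k\<le>n. (\<bar>\<Sum>j<k. (if \<forall>l\<le>j. P (\<lambda>i. x i (t l) \<omega>) then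
      (\<Sum>i=1..N. f' (x i (t j) \<omega>) * D i j \<omega> + f'' (x i (t j) \<omega>) / 2 * ((D i j \<omega>)\<^sup>2 - T / n)) / N else 0)\<bar> > \<delta>)}
    \<le> (2 * V * T + G\<^sup>2 * T\<^sup>2 / n) / \<delta>\<^sup>2"
proof -
  have bm: "standard_brownian_motion M (b i)" if "i \<in> {1..N}" for i
    using b that unfolding independent_brownian_motions_def by blast
  define \<tau> where "\<tau> = T / n"
  have \<tau>: "\<tau> > 0" using T n by (simp add: \<tau>_def)
  have t_diff: "t (Suc k) - t k = \<tau>" for k by (simp add: t_def \<tau>_def ring_distribs add_divide_distrib)
  have t0: "t k \<ge> 0" for k using T by (simp add: t_def)
  have t_mono: "t j \<le> t k" if "j \<le> k" for j k using that T n by (auto simp: t_def intro!: divide_right_mono)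
  have t_less: "t k < t (Suc k)" for k using t_diff[of k] \<tau> by linarith
  define F where "F k = augmented_filtration M N b (t k)" for k
  have sub: "subalgebra M (F k)" for k unfolding F_def by (rule subalgebra_augmented_filtration[OF b])
  have filt: "subalgebra (F k) (F j)" if "j \<le> k" for j k
    unfolding F_def by (intro subalgebra_augmented_filtration_mono t_mono that)
  have space_F: "space (F k) = space M" for k by (simp add: F_def)
  define \<xi> where "\<xi> j \<omega> = (if \<forall>l\<le>j. P (\<lambda>i. x i (t l) \<omega>) then 1 else 0 :: real)" for j \<omega>
  have xF: "x i (t j) \<in> borel_measurable (F k)" if "i \<in> {1..N}" "j \<le> k" for i j k
    using measurable_from_subalg[OF filt[OF that(2)], unfolded F_def, OF adapted[OF that(1) t0[of j]]] unfolding F_def .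
  have \<xi>F: "\<xi> j \<in> borel_measurable (F j)" for j
  proof -
    have "{\<omega> \<in> space (F j). P (\<lambda>i. x i (t l) \<omega>)} \<in> sets (F j)" if "l \<le> j" for l
      using P_meas[OF t0[of l]] filt[OF that] by (auto simp: F_def subalgebra_def)
    then have "{\<omega> \<in> space (F j). \<forall>l\<in>{..j}. P (\<lambda>i. x i (t l) \<omega>)} \<in> sets (F j)"
      by (intro sets.sets_Collect_finite_All) auto
    then have "(\<lambda>\<omega>. if \<omega> \<in> {\<omega> \<in> space (F j). \<forall>l\<in>{..j}. P (\<lambda>i. x i (t l) \<omega>)} then 1 else 0 :: real) \<in> borel_measurable (F j)"
      by (intro measurable_If_set) auto
    moreover have "\<xi> j \<omega> = (if \<omega> \<in> {\<omega> \<in> space (F j). \<forall>l\<in>{..j}. P (\<lambda>i. x i (t l) \<omega>)} then 1 else 0)"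
      if "\<omega> \<in> space (F j)" for \<omega>
      unfolding \<xi>_def using that by auto
    ultimately show ?thesis by (subst measurable_cong) assumption+
  qed
  define H where "H i j \<omega> = \<xi> j \<omega> * f' (x i (t j) \<omega>) / N" for i j \<omega>
  define K where "K i j \<omega> = \<xi> j \<omega> * f'' (x i (t j) \<omega>) / (2 * N)" for i j \<omega>
  define q where "q i j \<omega> = (D i j \<omega>)\<^sup>2 - \<tau>" for i j \<omega>
  define U where "U j \<omega> = (\<Sum>i=1..N. H i j \<omega> * D i j \<omega>) + (\<Sum>i=1..N. K i j \<omega> * q i j \<omega>)" for j \<omega>
  have HF: "H i j \<in> borel_measurable (F j)" and KF: "K i j \<in> borel_measurable (F j)" if "i \<in> {1..N}" for i j
    using xF[OF that order_refl] \<xi>F unfolding H_def K_def by measurable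
  have DA: "D i j \<in> borel_measurable (increment_algebra M N b (t j) (t (Suc j)))" if "i \<in> {1..N}" for i j
    unfolding D_def by (rule increment_measurable_increment_algebra[OF that])
  have qA: "q i j \<in> borel_measurable (increment_algebra M N b (t j) (t (Suc j)))" if "i \<in> {1..N}" for i j
    using DA[OF that] unfolding q_def by measurable
  have DF: "D i j \<in> borel_measurable (F (Suc j))" if "i \<in> {1..N}" for i j
    unfolding D_def F_def using that t0 t_mono[of j "Suc j"]
    by (intro borel_measurable_diff brownian_measurable_augmented_filtration) auto
  have H_bd: "\<bar>H i j \<omega>\<bar> \<le> G / N" and K_bd: "\<bar>K i j \<omega>\<bar> \<le> G / (2 * N)" if "i \<in> {1..N}" for i j \<omega>
  proof -
    show "\<bar>H i j \<omega>\<bar> \<le> G / N"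
      using G P_bound(1)[of "\<lambda>i. x i (t j) \<omega>" i] that by (auto simp: H_def \<xi>_def abs_mult intro!: divide_right_mono)
    show "\<bar>K i j \<omega>\<bar> \<le> G / (2 * N)"
      using G P_bound(2)[of "\<lambda>i. x i (t j) \<omega>" i] that by (auto simp: K_def \<xi>_def abs_mult intro!: divide_right_mono)
  qed
  have UF: "U j \<in> borel_measurable (F (Suc j))" for j
  proof -
    have [measurable]: "H i j \<in> borel_measurable (F (Suc j))" "K i j \<in> borel_measurable (F (Suc j))"
      "D i j \<in> borel_measurable (F (Suc j))" if "i \<in> {1..N}" for i
      using measurable_from_subalg[OF filt[of j "Suc j"]] HF[OF that] KF[OF that] DF[OF that] by auto
    show ?thesis unfolding U_def q_def by measurable
  qed
  have iD: "integrable M (\<lambda>\<omega>. (D i j \<omega>) ^ k)" if "i \<in> {1..N}" for i j k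
    unfolding D_def by (rule brownian_increment_moments(1)[OF bm[OF that] t0 t_less])
  have ED: "expectation (D i j) = 0" "expectation (\<lambda>\<omega>. (D i j \<omega>)\<^sup>2) = \<tau>" "expectation (\<lambda>\<omega>. (D i j \<omega>) ^ 4) = 3 * \<tau>\<^sup>2" if "i \<in> {1..N}" for i j
    unfolding D_def using brownian_increment_moments(2-4)[OF bm[OF that] t0 t_less] by (simp_all add: t_diff)
  have iD1: "integrable M (D i j)" if "i \<in> {1..N}" for i j using iD[OF that, of j 1] by simp
  have iq: "integrable M (q i j)" and Eq: "expectation (q i j) = 0" if "i \<in> {1..N}" for i j
    unfolding q_def using iD[OF that, of j 2] ED(2)[OF that, of j] by (simp_all add: prob_space)
  have q2: "(q i j \<omega>)\<^sup>2 = (D i j \<omega>) ^ 4 - 2 * \<tau> * (D i j \<omega>)\<^sup>2 + \<tau>\<^sup>2" for i j \<omega>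
    by (simp add: q_def power2_diff power_mult[of _ 2 2, simplified])
  have iq2: "integrable M (\<lambda>\<omega>. (q i j \<omega>)\<^sup>2)" and Eq2: "expectation (\<lambda>\<omega>. (q i j \<omega>)\<^sup>2) = 2 * \<tau>\<^sup>2" if "i \<in> {1..N}" for i j
    unfolding q2 using iD[OF that, of j 4] iD[OF that, of j 2] ED(2,3)[OF that, of j]
    by (simp_all add: prob_space power2_eq_square)
  have iDD: "integrable M (\<lambda>\<omega>. D i j \<omega> * D k j \<omega>)" if "i \<in> {1..N}" "k \<in> {1..N}" for i j k
  proof (rule Bochner_Integration.integrable_bound)
    show "integrable M (\<lambda>\<omega>. (D i j \<omega>)\<^sup>2 + (D k j \<omega>)\<^sup>2)" using iD[OF that(1), of j 2] iD[OF that(2), of j 2] by simp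
    show "(\<lambda>\<omega>. D i j \<omega> * D k j \<omega>) \<in> borel_measurable M"
      using iD1[OF that(1)] iD1[OF that(2)] by (intro borel_measurable_times borel_measurable_integrable)
    show "AE \<omega> in M. norm (D i j \<omega> * D k j \<omega>) \<le> norm ((D i j \<omega>)\<^sup>2 + (D k j \<omega>)\<^sup>2)"
    proof (rule AE_I2)
      fix \<omega>
      have "2 * \<bar>D i j \<omega>\<bar> * \<bar>D k j \<omega>\<bar> \<le> (D i j \<omega>)\<^sup>2 + (D k j \<omega>)\<^sup>2"
        using sum_squares_bound[of "\<bar>D i j \<omega>\<bar>" "\<bar>D k j \<omega>\<bar>"] by simp
      moreover have "0 \<le> \<bar>D i j \<omega>\<bar> * \<bar>D k j \<omega>\<bar>" by simp
      ultimately show "norm (D i j \<omega> * D k j \<omega>) \<le> norm ((D i j \<omega>)\<^sup>2 + (D k j \<omega>)\<^sup>2)"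
        unfolding real_norm_def abs_mult by linarith
    qed
  qed
  have ibd: "integrable M h" if "h \<in> borel_measurable (F j)" "\<And>\<omega>. \<bar>h \<omega>\<bar> \<le> C" for h :: "'a \<Rightarrow> real" and j and C :: real
    by (rule integrable_const_bound[of _ C]) (use that measurable_from_subalg[OF sub that(1)] in auto)
  note past = expectation_past_times_increment[OF b N t0 t_less, folded F_def]
  have orth: "expectation (\<lambda>\<omega>. h \<omega> * U j \<omega>) = 0"
    if h: "h \<in> borel_measurable (F j)" "\<And>\<omega>. \<bar>h \<omega>\<bar> \<le> C" for h :: "'a \<Rightarrow> real" and j and C :: real
  proof -
    have C: "C \<ge> 0" using h(2)[of undefined] by linarith
    have 1: "integrable M (\<lambda>\<omega>. (h \<omega> * H i j \<omega>) * D i j \<omega>)" "expectation (\<lambda>\<omega>. (h \<omega> * H i j \<omega>) * D i j \<omega>) = 0"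
      if i: "i \<in> {1..N}" for i
    proof -
      have hm: "(\<lambda>\<omega>. h \<omega> * H i j \<omega>) \<in> borel_measurable (F j)" using h HF[OF i] by measurable
      have "integrable M (\<lambda>\<omega>. h \<omega> * H i j \<omega>)"
      proof (rule ibd[OF hm, of "C * (G / N)"])
        show "\<bar>h \<omega> * H i j \<omega>\<bar> \<le> C * (G / N)" for \<omega>
          unfolding abs_mult using h(2) H_bd[OF i] C by (intro mult_mono) auto
      qed
      from past[OF hm this DA[OF i] iD1[OF i]] ED(1)[OF i]
      show "integrable M (\<lambda>\<omega>. (h \<omega> * H i j \<omega>) * D i j \<omega>)" "expectation (\<lambda>\<omega>. (h \<omega> * H i j \<omega>) * D i j \<omega>) = 0"
        by auto
    qed
    have 2: "integrable M (\<lambda>\<omega>. (h \<omega> * K i j \<omega>) * q i j \<omega>)" "expectation (\<lambda>\<omega>. (h \<omega> * K i j \<omega>) * q i j \<omega>) = 0"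
      if i: "i \<in> {1..N}" for i
    proof -
      have hm: "(\<lambda>\<omega>. h \<omega> * K i j \<omega>) \<in> borel_measurable (F j)" using h KF[OF i] by measurable
      have "integrable M (\<lambda>\<omega>. h \<omega> * K i j \<omega>)"
      proof (rule ibd[OF hm, of "C * (G / (2 * N))"])
        show "\<bar>h \<omega> * K i j \<omega>\<bar> \<le> C * (G / (2 * N))" for \<omega>
          unfolding abs_mult using h(2) K_bd[OF i] C by (intro mult_mono) auto
      qed
      from past[OF hm this qA[OF i] iq[OF i]] Eq[OF i]
      show "integrable M (\<lambda>\<omega>. (h \<omega> * K i j \<omega>) * q i j \<omega>)" "expectation (\<lambda>\<omega>. (h \<omega> * K i j \<omega>) * q i j \<omega>) = 0"
        by auto
    qed
    have "h \<omega> * U j \<omega> = (\<Sum>i=1..N. (h \<omega> * H i j \<omega>) * D i j \<omega>) + (\<Sum>i=1..N. (h \<omega> * K i j \<omega>) * q i j \<omega>)" for \<omega>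
      by (simp add: U_def distrib_left sum_distrib_left mult.assoc)
    moreover have "expectation (\<lambda>\<omega>. (\<Sum>i=1..N. (h \<omega> * H i j \<omega>) * D i j \<omega>) + (\<Sum>i=1..N. (h \<omega> * K i j \<omega>) * q i j \<omega>))
       = (\<Sum>i=1..N. expectation (\<lambda>\<omega>. (h \<omega> * H i j \<omega>) * D i j \<omega>)) + (\<Sum>i=1..N. expectation (\<lambda>\<omega>. (h \<omega> * K i j \<omega>) * q i j \<omega>))"
      using 1(1) 2(1)
      by (subst Bochner_Integration.integral_add) (auto intro!: Bochner_Integration.integrable_sum Bochner_Integration.integral_sum arg_cong2[where f="(+)"])
    ultimately show ?thesis using 1(2) 2(2) by (simp add: sum.neutral)
  qed
  have HD2: "integrable M (\<lambda>\<omega>. (\<Sum>i=1..N. H i j \<omega> * D i j \<omega>)\<^sup>2)"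
    "expectation (\<lambda>\<omega>. (\<Sum>i=1..N. H i j \<omega> * D i j \<omega>)\<^sup>2) \<le> V * \<tau>" for j
  proof -
    have sq: "(\<Sum>i=1..N. H i j \<omega> * D i j \<omega>)\<^sup>2 = (\<Sum>i=1..N. \<Sum>k=1..N. (H i j \<omega> * H k j \<omega>) * (D i j \<omega> * D k j \<omega>))" for \<omega>
      by (simp add: power2_eq_square sum_product ac_simps)
    have iHH: "integrable M (\<lambda>\<omega>. H i j \<omega> * H k j \<omega>)" if "i \<in> {1..N}" "k \<in> {1..N}" for i k
    proof (rule ibd[of _ j "G / N * (G / N)"])
      show "(\<lambda>\<omega>. H i j \<omega> * H k j \<omega>) \<in> borel_measurable (F j)" using HF[OF that(1)] HF[OF that(2)] by measurable
      show "\<bar>H i j \<omega> * H k j \<omega>\<bar> \<le> G / N * (G / N)" for \<omega>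
        unfolding abs_mult using H_bd[OF that(1)] H_bd[OF that(2)] G by (intro mult_mono) auto
    qed
    have term_: "integrable M (\<lambda>\<omega>. (H i j \<omega> * H k j \<omega>) * (D i j \<omega> * D k j \<omega>))"
      "expectation (\<lambda>\<omega>. (H i j \<omega> * H k j \<omega>) * (D i j \<omega> * D k j \<omega>)) = (if i = k then expectation (\<lambda>\<omega>. (H i j \<omega>)\<^sup>2) * \<tau> else 0)"
      if ik: "i \<in> {1..N}" "k \<in> {1..N}" for i k
    proof -
      have hm: "(\<lambda>\<omega>. H i j \<omega> * H k j \<omega>) \<in> borel_measurable (F j)" using HF[OF ik(1)] HF[OF ik(2)] by measurable
      have dm: "(\<lambda>\<omega>. D i j \<omega> * D k j \<omega>) \<in> borel_measurable (increment_algebra M N b (t j) (t (Suc j)))"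
        using DA[OF ik(1)] DA[OF ik(2)] by measurable
      note p = past[OF hm iHH[OF ik] dm iDD[OF ik]]
      show "integrable M (\<lambda>\<omega>. (H i j \<omega> * H k j \<omega>) * (D i j \<omega> * D k j \<omega>))" by (rule p(2))
      show "expectation (\<lambda>\<omega>. (H i j \<omega> * H k j \<omega>) * (D i j \<omega> * D k j \<omega>)) = (if i = k then expectation (\<lambda>\<omega>. (H i j \<omega>)\<^sup>2) * \<tau> else 0)"
      proof (cases "i = k")
        case True
        then show ?thesis using p(1) ED(2)[OF ik(1), of j] by (simp add: power2_eq_square)
      next
        case False
        then show ?thesis
          using p(1) brownian_increments_uncorrelated[OF b t0[of j] t_less[of j] ik] by (simp add: D_def)
      qed
    qed
    show "integrable M (\<lambda>\<omega>. (\<Sum>i=1..N. H i j \<omega> * D i j \<omega>)\<^sup>2)"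
      unfolding sq using term_(1) by (intro Bochner_Integration.integrable_sum) auto
    have "expectation (\<lambda>\<omega>. (\<Sum>i=1..N. H i j \<omega> * D i j \<omega>)\<^sup>2)
        = (\<Sum>i=1..N. \<Sum>k=1..N. (if i = k then expectation (\<lambda>\<omega>. (H i j \<omega>)\<^sup>2) * \<tau> else 0))"
      unfolding sq using term_ by (subst Bochner_Integration.integral_sum) (auto intro!: sum.cong)
    also have "\<dots> = (\<Sum>i=1..N. expectation (\<lambda>\<omega>. (H i j \<omega>)\<^sup>2)) * \<tau>"
      by (simp add: sum_distrib_right)
    also have "(\<Sum>i=1..N. expectation (\<lambda>\<omega>. (H i j \<omega>)\<^sup>2)) = expectation (\<lambda>\<omega>. \<Sum>i=1..N. (H i j \<omega>)\<^sup>2)"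
      using iHH unfolding power2_eq_square by (intro Bochner_Integration.integral_sum[symmetric]) auto
    also have "\<dots> \<le> expectation (\<lambda>_. V)"
    proof (rule integral_mono)
      show "integrable M (\<lambda>\<omega>. \<Sum>i=1..N. (H i j \<omega>)\<^sup>2)"
        using iHH unfolding power2_eq_square by (intro Bochner_Integration.integrable_sum) auto
      fix \<omega>
      show "(\<Sum>i=1..N. (H i j \<omega>)\<^sup>2) \<le> V"
      proof (cases "\<xi> j \<omega> = 0")
        case True
        then show ?thesis using V(2) by (simp add: H_def)
      next
        case False
        then have "P (\<lambda>i. x i (t j) \<omega>)" "\<xi> j \<omega> = 1" by (auto simp: \<xi>_def split: if_splits)
        then have "(\<Sum>i=1..N. (H i j \<omega>)\<^sup>2) = (\<Sum>i=1..N. (f' (x i (t j) \<omega>))\<^sup>2) / (real N)\<^sup>2"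
          by (simp add: H_def power_divide sum_divide_distrib)
        also have "\<dots> \<le> V" using V(1)[OF \<open>P _\<close>] N by (simp add: divide_le_eq)
        finally show ?thesis .
      qed
    qed simp
    finally show "expectation (\<lambda>\<omega>. (\<Sum>i=1..N. H i j \<omega> * D i j \<omega>)\<^sup>2) \<le> V * \<tau>"
      using \<tau> by (simp add: prob_space)
  qed
  define Q where "Q j \<omega> = real N * (\<Sum>i=1..N. (G / (2 * N))\<^sup>2 * (q i j \<omega>)\<^sup>2)" for j \<omega>
  have iQ: "integrable M (Q j)" and EQ: "expectation (Q j) = G\<^sup>2 * \<tau>\<^sup>2 / 2" for j
  proof -
    show "integrable M (Q j)" unfolding Q_def
      by (intro integrable_mult_right Bochner_Integration.integrable_sum iq2)
    have "expectation (Q j) = real N * (\<Sum>i=1..N. (G / (2 * N))\<^sup>2 * (2 * \<tau>\<^sup>2))"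
    proof -
      have "expectation (\<lambda>\<omega>. \<Sum>i=1..N. (G / (2 * N))\<^sup>2 * (q i j \<omega>)\<^sup>2) = (\<Sum>i=1..N. expectation (\<lambda>\<omega>. (G / (2 * N))\<^sup>2 * (q i j \<omega>)\<^sup>2))"
        by (intro Bochner_Integration.integral_sum integrable_mult_right iq2)
      also have "\<dots> = (\<Sum>i=1..N. (G / (2 * N))\<^sup>2 * (2 * \<tau>\<^sup>2))"
        by (intro sum.cong) (simp_all add: Eq2)
      finally show ?thesis unfolding Q_def by simp
    qed
    also have "\<dots> = G\<^sup>2 * \<tau>\<^sup>2 / 2" using N by (simp add: power2_eq_square field_simps)
    finally show "expectation (Q j) = G\<^sup>2 * \<tau>\<^sup>2 / 2" .
  qed
  have KQ: "(\<Sum>i=1..N. K i j \<omega> * q i j \<omega>)\<^sup>2 \<le> Q j \<omega>" for j \<omega>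
  proof -
    have "(\<Sum>i=1..N. K i j \<omega> * q i j \<omega>)\<^sup>2 = (\<Sum>i=1..N. 1 * (K i j \<omega> * q i j \<omega>))\<^sup>2" by simp
    also have "\<dots> \<le> (\<Sum>i=1..N. 1\<^sup>2) * (\<Sum>i=1..N. (K i j \<omega> * q i j \<omega>)\<^sup>2)" by (rule Cauchy_Schwarz_ineq_sum)
    also have "\<dots> \<le> Q j \<omega>"
    proof -
      have "(K i j \<omega> * q i j \<omega>)\<^sup>2 \<le> (G / (2 * N))\<^sup>2 * (q i j \<omega>)\<^sup>2" if "i \<in> {1..N}" for i
      proof -
        have "(K i j \<omega>)\<^sup>2 \<le> (G / (2 * N))\<^sup>2" using K_bd[OF that, of j \<omega>] G by (subst abs_le_square_iff[symmetric]) simp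
        then show ?thesis unfolding power_mult_distrib by (rule mult_right_mono) simp
      qed
      then have "(\<Sum>i=1..N. (K i j \<omega> * q i j \<omega>)\<^sup>2) \<le> (\<Sum>i=1..N. (G / (2 * N))\<^sup>2 * (q i j \<omega>)\<^sup>2)"
        by (rule sum_mono)
      then show ?thesis unfolding Q_def by (simp add: mult_left_mono)
    qed
    finally show ?thesis .
  qed
  have MU: "U j \<in> borel_measurable M" for j by (rule measurable_from_subalg[OF sub UF])
  have U_le: "(U j \<omega>)\<^sup>2 \<le> 2 * (\<Sum>i=1..N. H i j \<omega> * D i j \<omega>)\<^sup>2 + 2 * Q j \<omega>" for j \<omega>
  proof -
    have "(u + v)\<^sup>2 \<le> 2 * u\<^sup>2 + 2 * v\<^sup>2" for u v :: real
      using zero_le_power2[of "u - v"] by (simp add: power2_eq_square algebra_simps)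
    from this[of "\<Sum>i=1..N. H i j \<omega> * D i j \<omega>" "\<Sum>i=1..N. K i j \<omega> * q i j \<omega>"] KQ[of j \<omega>]
    show ?thesis unfolding U_def by linarith
  qed
  have iU2: "integrable M (\<lambda>\<omega>. (U j \<omega>)\<^sup>2)" for j
  proof (rule Bochner_Integration.integrable_bound)
    show "integrable M (\<lambda>\<omega>. 2 * (\<Sum>i=1..N. H i j \<omega> * D i j \<omega>)\<^sup>2 + 2 * Q j \<omega>)" using HD2(1) iQ by simp
    show "AE \<omega> in M. norm ((U j \<omega>)\<^sup>2) \<le> norm (2 * (\<Sum>i=1..N. H i j \<omega> * D i j \<omega>)\<^sup>2 + 2 * Q j \<omega>)"
      using U_le by (intro AE_I2) (auto intro: order_trans[OF _ abs_ge_self])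
  qed (use MU in measurable)
  have EU2: "expectation (\<lambda>\<omega>. (U j \<omega>)\<^sup>2) \<le> 2 * V * \<tau> + G\<^sup>2 * \<tau>\<^sup>2" for j
  proof -
    have "expectation (\<lambda>\<omega>. (U j \<omega>)\<^sup>2) \<le> expectation (\<lambda>\<omega>. 2 * (\<Sum>i=1..N. H i j \<omega> * D i j \<omega>)\<^sup>2 + 2 * Q j \<omega>)"
      using HD2(1) iQ iU2 U_le by (intro integral_mono) auto
    also have "\<dots> = 2 * expectation (\<lambda>\<omega>. (\<Sum>i=1..N. H i j \<omega> * D i j \<omega>)\<^sup>2) + 2 * expectation (Q j)"
      using HD2(1) iQ by simp
    finally show ?thesis using HD2(2)[of j] EQ[of j] by simp
  qed
  have U_eq: "U j \<omega> = (if \<forall>l\<le>j. P (\<lambda>i. x i (t l) \<omega>) then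
      (\<Sum>i=1..N. f' (x i (t j) \<omega>) * D i j \<omega> + f'' (x i (t j) \<omega>) / 2 * ((D i j \<omega>)\<^sup>2 - T / n)) / N else 0)" for j \<omega>
  proof (cases "\<forall>l\<le>j. P (\<lambda>i. x i (t l) \<omega>)")
    case True
    then have "\<xi> j \<omega> = 1" by (simp add: \<xi>_def)
    with True show ?thesis
      by (simp add: U_def H_def K_def q_def sum.distrib sum_divide_distrib add_divide_distrib \<tau>_def)
  next
    case False
    then have "\<xi> j \<omega> = 0" by (simp add: \<xi>_def)
    with False show ?thesis by (simp only: U_def H_def K_def if_False) simp
  qed
  have "prob {\<omega>\<in>space M. \<exists>k\<le>n. \<bar>\<Sum>j<k. U j \<omega>\<bar> > \<delta>} \<le> (\<Sum>k<n. expectation (\<lambda>\<omega>. (U k \<omega>)\<^sup>2)) / \<delta>\<^sup>2"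
    by (rule kolmogorov_maximal_inequality[where F=F, OF sub filt UF iU2 orth \<delta>]) auto
  also have "\<dots> \<le> (\<Sum>k<n. 2 * V * \<tau> + G\<^sup>2 * \<tau>\<^sup>2) / \<delta>\<^sup>2"
    using EU2 by (intro divide_right_mono sum_mono) auto
  also have "(\<Sum>k<n. 2 * V * \<tau> + G\<^sup>2 * \<tau>\<^sup>2) = 2 * V * T + G\<^sup>2 * T\<^sup>2 / n"
    using n by (simp add: \<tau>_def field_simps power2_eq_square)
  finally show ?thesis unfolding U_eq .
qed

lemma (in prob_space) quadratic_variation_tail:
  assumes b: "independent_brownian_motions M N b" and T: "T > 0" and n: "n > 0" and A: "A > 0"
  shows "prob {\<omega>\<in>space M. (\<Sum>i=1..N. \<Sum>j<n. (b i (T * real (Suc j) / real n) \<omega> - b i (T * real j / real n) \<omega>)\<^sup>2) \<ge> A} \<le> N * T / A"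
proof -
  define D where "D i j \<omega> = (b i (T * real (Suc j) / real n) \<omega> - b i (T * real j / real n) \<omega>)\<^sup>2" for i j \<omega>
  have bm: "standard_brownian_motion M (b i)" if "i \<in> {1..N}" for i
    using b that unfolding independent_brownian_motions_def by blast
  have *: "0 \<le> T * real j / real n" "T * real j / real n < T * real (Suc j) / real n"
    "T * real (Suc j) / real n - T * real j / real n = T / n" for j
    using T n by (auto simp: field_simps)
  have iD: "integrable M (D i j)" and ED: "expectation (D i j) = T / n" if "i \<in> {1..N}" for i j
    unfolding D_def using brownian_increment_moments(1)[OF bm[OF that] *(1,2), of j 2]
      brownian_increment_moments(3)[OF bm[OF that] *(1,2), of j] *(3) by simp_all
  have i: "integrable M (\<lambda>\<omega>. \<Sum>i=1..N. \<Sum>j<n. D i j \<omega>)"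
    by (intro Bochner_Integration.integrable_sum iD)
  have "prob {\<omega>\<in>space M. (\<Sum>i=1..N. \<Sum>j<n. D i j \<omega>) \<ge> A} \<le> expectation (\<lambda>\<omega>. \<Sum>i=1..N. \<Sum>j<n. D i j \<omega>) / A"
    by (rule integral_Markov_inequality_measure[where A="{}"]) (use i A in \<open>auto simp: D_def intro!: sum_nonneg\<close>)
  also have "expectation (\<lambda>\<omega>. \<Sum>i=1..N. \<Sum>j<n. D i j \<omega>) = (\<Sum>i=1..N. \<Sum>j<n. expectation (D i j))"
  proof -
    have "expectation (\<lambda>\<omega>. \<Sum>i=1..N. \<Sum>j<n. D i j \<omega>) = (\<Sum>i=1..N. expectation (\<lambda>\<omega>. \<Sum>j<n. D i j \<omega>))"
      by (intro Bochner_Integration.integral_sum Bochner_Integration.integrable_sum iD)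
    also have "\<dots> = (\<Sum>i=1..N. \<Sum>j<n. expectation (D i j))"
      by (intro sum.cong refl Bochner_Integration.integral_sum iD)
    finally show ?thesis .
  qed
  also have "\<dots> = N * T" using n by (simp add: ED)
  finally show ?thesis by (simp add: D_def)
qed

text \<open>
The exceptional set is the limit inferior of the \<open>E n\<close>, and its probability is bounded without any
summability, in contrast to the limit superior. The price is that a good outcome avoids \<open>E n\<close> only infinitely often.
\<close>
lemma (in prob_space) prob_eventually_le:
  assumes E: "\<And>n::nat. n \<ge> n0 \<Longrightarrow> E n \<in> events" and bd: "\<And>n. n \<ge> n0 \<Longrightarrow> prob (E n) \<le> p"
  shows "\<exists>B\<in>events. prob B \<le> p \<and> (\<forall>\<omega>\<in>space M - B. \<exists>\<^sub>F n in sequentially. \<omega> \<notin> E n)"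
proof -
  define C where "C r = (\<Inter>n\<in>{r + n0..}. E n)" for r
  have C: "C r \<in> events" for r unfolding C_def using E by (intro sets.countable_INT') auto
  have "incseq C" unfolding C_def incseq_def by (fastforce)
  then have "(\<lambda>r. prob (C r)) \<longlonglongrightarrow> prob (\<Union>r. C r)"
    using C by (intro finite_Lim_measure_incseq) auto
  moreover have "prob (C r) \<le> p" for r
  proof -
    have "prob (C r) \<le> prob (E (r + n0))"
      unfolding C_def by (intro finite_measure_mono E) auto
    also have "\<dots> \<le> p" by (rule bd) simp
    finally show ?thesis .
  qed
  ultimately have "prob (\<Union>r. C r) \<le> p" by (intro LIMSEQ_le_const2) auto
  moreover have "(\<Union>r. C r) \<in> events" using C by auto
  moreover have "\<exists>\<^sub>F n in sequentially. \<omega> \<notin> E n" if "\<omega> \<notin> (\<Union>r. C r)" for \<omega>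
    unfolding frequently_sequentially
  proof
    fix r
    from that have "\<omega> \<notin> C r" by blast
    then obtain n where "n \<ge> r + n0" "\<omega> \<notin> E n" by (auto simp: C_def)
    then show "\<exists>n\<ge>r. \<omega> \<notin> E n" by (intro exI[of _ n]) auto
  qed
  ultimately show ?thesis by blast
qed

text \<open>
Outside the exceptional set there are arbitrarily fine grids on which the truncated martingale stays
below \<open>\<epsilon> / 2\<close> and the sum of squares stays bounded. On such a grid the Taylor error, and the
oscillation of the remainder within one mesh, are at most \<open>\<epsilon> / 4\<close> each. Everything due to the
discretisation goes into \<open>\<eta>\<close>, which is free; the number of particles matters only through \<open>V\<close>.
\<close>
lemma (in prob_space) ito_remainder_tail:
  fixes x a b :: "nat \<Rightarrow> real \<Rightarrow> 'a \<Rightarrow> real" and P :: "(nat \<Rightarrow> real) \<Rightarrow> bool" and f f' f'' :: "real \<Rightarrow> real"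
  assumes b: "independent_brownian_motions M N b" and N: "N \<ge> 1" and T: "T > 0"
    and adapted: "\<And>i t. i \<in> {1..N} \<Longrightarrow> 0 \<le> t \<Longrightarrow> x i t \<in> borel_measurable (augmented_filtration M N b t)"
    and sol: "AE \<omega> in M. \<forall>i\<in>{1..N}. continuous_on {0..T} (\<lambda>t. x i t \<omega>) \<and>
        set_integrable lborel {0..T} (\<lambda>s. a i s \<omega>) \<and>
        (\<forall>t\<in>{0..T}. x i t \<omega> = b i t \<omega> + (LINT s:{0..t}|lborel. a i s \<omega>))"
    and f: "\<And>x. (f has_real_derivative f' x) (at x)" and f': "\<And>x. (f' has_real_derivative f'' x) (at x)"
    and f'': "continuous_on UNIV f''"
    and P_meas: "\<And>t. 0 \<le> t \<Longrightarrow> {\<omega>\<in>space M. P (\<lambda>i. x i t \<omega>)} \<in> sets (augmented_filtration M N b t)"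
    and P_bound: "\<And>y i. P y \<Longrightarrow> i \<in> {1..N} \<Longrightarrow> \<bar>f' (y i)\<bar> \<le> G" "\<And>y i. P y \<Longrightarrow> i \<in> {1..N} \<Longrightarrow> \<bar>f'' (y i)\<bar> \<le> G"
    and V: "\<And>y. P y \<Longrightarrow> (\<Sum>i=1..N. (f' (y i))\<^sup>2) \<le> V * (real N)\<^sup>2" "V \<ge> 0" and G: "G \<ge> 0"
    and \<epsilon>: "\<epsilon> > 0" and \<eta>: "\<eta> > 0"
  shows "\<exists>B\<in>events. prob B \<le> 8 * V * T / \<epsilon>\<^sup>2 + \<eta> \<and>
    (\<forall>\<omega>\<in>space M - B. \<forall>t\<in>{0..T}. (\<forall>s\<in>{0..t}. P (\<lambda>i. x i s \<omega>)) \<longrightarrow>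
       \<bar>ito_remainder f f' f'' N (\<lambda>i t. x i t \<omega>) (\<lambda>i t. a i t \<omega>) t\<bar> \<le> \<epsilon>)"
proof -
  have bm: "standard_brownian_motion M (b i)" if "i \<in> {1..N}" for i
    using b that unfolding independent_brownian_motions_def by blast
  have f'_cont: "continuous_on UNIV f'" using DERIV_isCont[OF f'] by (simp add: continuous_on_eq_continuous_at)
  have f_cont: "continuous_on UNIV f" using DERIV_isCont[OF f] by (simp add: continuous_on_eq_continuous_at)
  have f'_meas: "f' \<in> borel_measurable borel" and f''_meas: "f'' \<in> borel_measurable borel"
    using f'_cont f'' by (auto intro: borel_measurable_continuous_onI)
  \<comment> \<open>the sum of squares has mean \<open>N * T\<close>, so it exceeds this \<open>A\<close> with probability at most \<open>\<eta> / 2\<close>\<close>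
  define A where "A = 2 * N * T / \<eta>"
  have A: "A > 0" using N T \<eta> by (simp add: A_def)
  define D where "D n i j \<omega> = b i (T * real (Suc j) / real n) \<omega> - b i (T * real j / real n) \<omega>" for n i j \<omega>
  define J where "J n j \<omega> = (\<Sum>i=1..N. f' (x i (T * real j / real n) \<omega>) * D n i j \<omega> + f'' (x i (T * real j / real n) \<omega>) / 2 * ((D n i j \<omega>)\<^sup>2 - T / n)) / N" for n j \<omega>
  define U where "U n j \<omega> = (if \<forall>l\<le>j. P (\<lambda>i. x i (T * real l / real n) \<omega>) then J n j \<omega> else 0)" for n j \<omega>
  define E where "E n = {\<omega>\<in>space M. \<exists>k\<le>n. (\<bar>\<Sum>j<k. U n j \<omega>\<bar> > \<epsilon> / 2)}" for n
  define Q where "Q n = {\<omega>\<in>space M. (\<Sum>i=1..N. \<Sum>j<n. (D n i j \<omega>)\<^sup>2) \<ge> A}" for n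
  have x_M: "x i t \<in> borel_measurable M" if "i \<in> {1..N}" "0 \<le> t" for i t
    by (rule measurable_from_subalg[OF subalgebra_augmented_filtration[OF b] adapted[OF that]])
  have b_M: "b i t \<in> borel_measurable M" if "i \<in> {1..N}" "0 \<le> t" for i t
    by (rule independent_brownian_motions_measurable[OF b that])
  have D_M: "D n i j \<in> borel_measurable M" if "i \<in> {1..N}" for n i j
    unfolding D_def using that T by (intro borel_measurable_diff b_M) auto
  have U_M: "U n j \<in> borel_measurable M" for n j
  proof -
    have pos: "0 \<le> T * real l / real n" for l using T by simp
    have [measurable]: "J n j \<in> borel_measurable M"
      unfolding J_def using x_M[OF _ pos] D_M f'_meas f''_meas
      by (intro borel_measurable_divide borel_measurable_sum borel_measurable_add borel_measurable_times
          borel_measurable_diff borel_measurable_power measurable_compose[OF _ f'_meas] measurable_compose[OF _ f''_meas]) auto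
    have "{\<omega> \<in> space M. P (\<lambda>i. x i (T * real l / real n) \<omega>)} \<in> events" for l
      using P_meas[OF pos] subalgebra_augmented_filtration[OF b] by (auto simp: subalgebra_def)
    then have "{\<omega> \<in> space M. \<forall>l\<in>{..j}. P (\<lambda>i. x i (T * real l / real n) \<omega>)} \<in> events"
      by (intro sets.sets_Collect_finite_All) auto
    then have "(\<lambda>\<omega>. if \<omega> \<in> {\<omega> \<in> space M. \<forall>l\<in>{..j}. P (\<lambda>i. x i (T * real l / real n) \<omega>)} then J n j \<omega> else 0) \<in> borel_measurable M"
      by (intro measurable_If_set) auto
    moreover have "U n j \<omega> = (if \<omega> \<in> {\<omega> \<in> space M. \<forall>l\<in>{..j}. P (\<lambda>i. x i (T * real l / real n) \<omega>)} then J n j \<omega> else 0)"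
      if "\<omega> \<in> space M" for \<omega>
      unfolding U_def using that by auto
    ultimately show ?thesis by (subst measurable_cong) assumption+
  qed
  have E_ev: "E n \<in> events" for n
  proof -
    have "{\<omega>\<in>space M. \<bar>\<Sum>j<k. U n j \<omega>\<bar> > \<epsilon> / 2} \<in> events" for k
      using U_M by measurable
    then have "{\<omega>\<in>space M. \<exists>k\<in>{..n}. \<bar>\<Sum>j<k. U n j \<omega>\<bar> > \<epsilon> / 2} \<in> events"
      by (intro sets.sets_Collect_finite_Ex) auto
    moreover have "E n = {\<omega>\<in>space M. \<exists>k\<in>{..n}. \<bar>\<Sum>j<k. U n j \<omega>\<bar> > \<epsilon> / 2}"
      unfolding E_def by auto
    ultimately show ?thesis by (simp only:)
  qed
  have Q_ev: "Q n \<in> events" for n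
  proof -
    have [measurable]: "(\<lambda>\<omega>. \<Sum>i=1..N. \<Sum>j<n. (D n i j \<omega>)\<^sup>2) \<in> borel_measurable M"
      using D_M by (intro borel_measurable_sum borel_measurable_power) auto
    show ?thesis unfolding Q_def by measurable
  qed
  have E_prob: "prob (E n) \<le> 8 * V * T / \<epsilon>\<^sup>2 + 4 * G\<^sup>2 * T\<^sup>2 / \<epsilon>\<^sup>2 / n" if "n > 0" for n
  proof -
    have "prob (E n) \<le> (2 * V * T + G\<^sup>2 * T\<^sup>2 / n) / (\<epsilon> / 2)\<^sup>2"
      unfolding E_def U_def J_def D_def
    proof (rule truncated_ito_increments[where P=P and x=x and f'=f' and f''=f'' and V=V and G=G, OF b N T that])
      show "0 < \<epsilon> / 2" using \<epsilon> by simp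
    qed (fact adapted f'_meas f''_meas P_meas P_bound V G)+
    also have "\<dots> = 8 * V * T / \<epsilon>\<^sup>2 + 4 * G\<^sup>2 * T\<^sup>2 / \<epsilon>\<^sup>2 / n"
      by (simp add: power_divide add_divide_distrib mult_ac)
    finally show ?thesis .
  qed
  have Q_prob: "prob (Q n) \<le> \<eta> / 2" if "n > 0" for n
  proof -
    have "prob (Q n) \<le> N * T / A"
      unfolding Q_def D_def by (rule quadratic_variation_tail[OF b T that A])
    also have "\<dots> = \<eta> / 2" using N T \<eta> by (simp add: A_def)
    finally show ?thesis .
  qed
  have "\<forall>\<^sub>F n in sequentially. 4 * G\<^sup>2 * T\<^sup>2 / \<epsilon>\<^sup>2 / real n < \<eta> / 2"
    using order_tendstoD(2)[OF lim_const_over_n, of "\<eta> / 2" "4 * G\<^sup>2 * T\<^sup>2 / \<epsilon>\<^sup>2"] \<eta> by simp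
  then obtain n1 where n1: "\<And>n. n \<ge> n1 \<Longrightarrow> 4 * G\<^sup>2 * T\<^sup>2 / \<epsilon>\<^sup>2 / real n < \<eta> / 2"
    by (auto simp: eventually_sequentially)
  have "\<exists>B\<in>events. prob B \<le> 8 * V * T / \<epsilon>\<^sup>2 + \<eta> \<and> (\<forall>\<omega>\<in>space M - B. \<exists>\<^sub>F n in sequentially. \<omega> \<notin> E n \<union> Q n)"
  proof (rule prob_eventually_le[where ?n0.0="max 1 n1"])
    show "E n \<union> Q n \<in> events" for n using E_ev Q_ev by auto
    fix n assume n: "max 1 n1 \<le> n"
    have "prob (E n \<union> Q n) \<le> prob (E n) + prob (Q n)"
      using E_ev Q_ev by (rule measure_Un_le)
    then show "prob (E n \<union> Q n) \<le> 8 * V * T / \<epsilon>\<^sup>2 + \<eta>"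
      using E_prob[of n] Q_prob[of n] n1[of n] n by linarith
  qed
  then obtain B where B: "B \<in> events" "prob B \<le> 8 * V * T / \<epsilon>\<^sup>2 + \<eta>"
    and freq: "\<And>\<omega>. \<omega> \<in> space M \<Longrightarrow> \<omega> \<notin> B \<Longrightarrow> \<exists>\<^sub>F n in sequentially. \<omega> \<notin> E n \<union> Q n" by auto
  have b_cont: "AE \<omega> in M. \<forall>i\<in>{1..N}. continuous_on {0..} (\<lambda>t. b i t \<omega>)"
    using bm unfolding standard_brownian_motion_def by (intro AE_finite_allI) auto
  from sol b_cont have "AE \<omega> in M. (\<forall>i\<in>{1..N}. continuous_on {0..T} (\<lambda>t. x i t \<omega>) \<and>
        set_integrable lborel {0..T} (\<lambda>s. a i s \<omega>) \<and>
        (\<forall>t\<in>{0..T}. x i t \<omega> = b i t \<omega> + (LINT s:{0..t}|lborel. a i s \<omega>))) \<and> (\<forall>i\<in>{1..N}. continuous_on {0..} (\<lambda>t. b i t \<omega>))"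
    by eventually_elim auto
  then obtain B' where B': "B' \<in> null_sets M" and good: "\<And>\<omega> i. \<omega> \<in> space M \<Longrightarrow> \<omega> \<notin> B' \<Longrightarrow> i \<in> {1..N} \<Longrightarrow>
      continuous_on {0..T} (\<lambda>t. x i t \<omega>) \<and> set_integrable lborel {0..T} (\<lambda>s. a i s \<omega>) \<and>
        (\<forall>t\<in>{0..T}. x i t \<omega> = b i t \<omega> + (LINT s:{0..t}|lborel. a i s \<omega>)) \<and> continuous_on {0..} (\<lambda>t. b i t \<omega>)"
    by (elim AE_E3) auto
  show ?thesis
  proof (intro bexI[of _ "B \<union> B'"] conjI ballI impI)
    show "B \<union> B' \<in> events" using B B' by auto
    have "prob (B \<union> B') = prob B" using B(1) B' by (rule measure_Un_null_set)
    then show "prob (B \<union> B') \<le> 8 * V * T / \<epsilon>\<^sup>2 + \<eta>" using B by simp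
    fix \<omega> t assume \<omega>: "\<omega> \<in> space M - (B \<union> B')" and t: "t \<in> {0..T}" and trunc: "\<forall>s\<in>{0..t}. P (\<lambda>i. x i s \<omega>)"
    define Z where "Z = ito_remainder f f' f'' N (\<lambda>i t. x i t \<omega>) (\<lambda>i t. a i t \<omega>)"
    have xc: "continuous_on {0..T} (\<lambda>t. x i t \<omega>)" and ai: "set_integrable lborel {0..T} (\<lambda>s. a i s \<omega>)"
      and eq: "\<And>t. t \<in> {0..T} \<Longrightarrow> x i t \<omega> = b i t \<omega> + (LINT s:{0..t}|lborel. a i s \<omega>)"
      and bc: "continuous_on {0..T} (\<lambda>t. b i t \<omega>)" if "i \<in> {1..N}" for i
      using good[of \<omega> i] \<omega> that by (auto intro: continuous_on_subset)
    have gi: "set_integrable lborel {0..T} (\<lambda>r. f' (x i r \<omega>) * a i r \<omega> + f'' (x i r \<omega>) / 2)" if "i \<in> {1..N}" for i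
      using set_integrable_continuous_mult[OF ai[OF that] continuous_on_compose2[OF f'_cont xc[OF that]]]
        borel_integrable_atLeastAtMost'[OF continuous_on_compose2[OF f'' xc[OF that]]]
      by (intro set_integral_add) auto
    have Z_cont: "continuous_on {0..T} Z"
      unfolding Z_def ito_remainder_def using N
      by (intro continuous_intros continuous_on_set_integral gi continuous_on_compose2[OF f_cont xc]) auto
    then obtain d where d: "d > 0" "\<And>s r. s \<in> {0..T} \<Longrightarrow> r \<in> {0..T} \<Longrightarrow> \<bar>r - s\<bar> < d \<Longrightarrow> \<bar>Z r - Z s\<bar> < \<epsilon> / 4"
      using compact_uniformly_continuous[OF Z_cont compact_Icc] \<epsilon>
      unfolding uniformly_continuous_on_def dist_real_def by (metis divide_pos_pos zero_less_numeral)
    have ev1: "\<forall>\<^sub>F n in sequentially. T / real n < d"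
      using order_tendstoD(2)[OF lim_const_over_n d(1)] by simp
    define R where "R n k i = f (x i (T * k / n) \<omega>) - f (x i 0 \<omega>) - (LINT r:{0..T * k / n}|lborel. f' (x i r \<omega>) * a i r \<omega> + f'' (x i r \<omega>) / 2)
      - (\<Sum>j<k. f' (x i (T * j / n) \<omega>) * D n i j \<omega> + f'' (x i (T * j / n) \<omega>) / 2 * ((D n i j \<omega>)\<^sup>2 - T / n))" for n k i
    have ev2: "\<forall>\<^sub>F n in sequentially. \<forall>i\<in>{1..N}. (\<Sum>j<n. (D n i j \<omega>)\<^sup>2) \<le> A \<longrightarrow> (\<forall>k\<le>n. \<bar>R n k i\<bar> \<le> \<epsilon> / 4)"
    proof (rule eventually_ball_finite)
      show "\<forall>i\<in>{1..N}. \<forall>\<^sub>F n in sequentially. (\<Sum>j<n. (D n i j \<omega>)\<^sup>2) \<le> A \<longrightarrow> (\<forall>k\<le>n. \<bar>R n k i\<bar> \<le> \<epsilon> / 4)"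
        unfolding D_def R_def using ito_taylor_grid[OF f f' f'' T xc bc ai eq, of _ "\<epsilon> / 4" A] \<epsilon> by auto
    qed simp
    have "\<exists>\<^sub>F n in sequentially. \<omega> \<notin> E n \<union> Q n" using freq \<omega> by auto
    then have "\<exists>\<^sub>F n in sequentially. \<omega> \<notin> E n \<union> Q n \<and> (T / real n < d \<and> n > 0 \<and> (\<forall>i\<in>{1..N}. (\<Sum>j<n. (D n i j \<omega>)\<^sup>2) \<le> A \<longrightarrow> (\<forall>k\<le>n. \<bar>R n k i\<bar> \<le> \<epsilon> / 4)))"
    proof (rule frequently_rev_mp)
      have "\<forall>\<^sub>F n in sequentially. n > (0::nat)" by (rule eventually_gt_at_top)
      with ev1 ev2 show "\<forall>\<^sub>F n in sequentially. \<omega> \<notin> E n \<union> Q n \<longrightarrow> \<omega> \<notin> E n \<union> Q n \<and> (T / real n < d \<and> n > 0 \<and> (\<forall>i\<in>{1..N}. (\<Sum>j<n. (D n i j \<omega>)\<^sup>2) \<le> A \<longrightarrow> (\<forall>k\<le>n. \<bar>R n k i\<bar> \<le> \<epsilon> / 4)))"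
        by eventually_elim simp
    qed
    then obtain n where n: "\<omega> \<notin> E n" "\<omega> \<notin> Q n" "T / real n < d" "n > 0" and
      taylor: "\<And>i k. i \<in> {1..N} \<Longrightarrow> (\<Sum>j<n. (D n i j \<omega>)\<^sup>2) \<le> A \<Longrightarrow> k \<le> n \<Longrightarrow>
        \<bar>R n k i\<bar> \<le> \<epsilon> / 4"
      by (auto dest!: frequently_ex)
    \<comment> \<open>the last grid point before \<open>t\<close>; only up to there is the truncation known not to act\<close>
    define k where "k = nat \<lfloor>t * n / T\<rfloor>"
    have k_le: "real k \<le> t * n / T" "t * n / T < real k + 1"
      using t T by (auto simp: k_def)
    have tk: "T * k / n \<le> t" "t - T * k / n < T / n"
    proof -
      have "T * k \<le> t * n" "t * n < T * k + T" using k_le T by (auto simp: field_simps)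
      then have "T * k / n \<le> t" "t < (T * k + T) / n"
        using n(4) by (simp_all add: pos_divide_le_eq pos_less_divide_eq)
      then show "T * k / n \<le> t" "t - T * k / n < T / n" by (simp_all add: add_divide_distrib)
    qed
    have "t * n / T \<le> n" using t T n by (simp add: pos_divide_le_eq mult.commute mult_left_mono)
    with k_le(1) have "real k \<le> n" by linarith
    then have kn: "k \<le> n" by simp
    have tk_in: "T * k / n \<in> {0..T}" using tk(1) t T by auto
    have "\<bar>Z t - Z (T * k / n)\<bar> < \<epsilon> / 4"
      using tk n by (intro d(2)[OF tk_in t]) auto
    moreover have "\<bar>Z (T * k / n) - (\<Sum>j<k. J n j \<omega>)\<bar> \<le> \<epsilon> / 4"
    proof -
      have "\<bar>R n k i\<bar> \<le> \<epsilon> / 4" if i: "i \<in> {1..N}" for i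
      proof -
        have "(\<Sum>j<n. (D n i j \<omega>)\<^sup>2) \<le> (\<Sum>i=1..N. \<Sum>j<n. (D n i j \<omega>)\<^sup>2)"
          using i by (intro member_le_sum) (auto intro!: sum_nonneg)
        also have "\<dots> \<le> A" using n(2) \<omega> by (auto simp: Q_def)
        finally show ?thesis using taylor[OF i _ kn] by simp
      qed
      then have "\<bar>\<Sum>i=1..N. R n k i\<bar> \<le> (\<Sum>i=1..N. \<epsilon> / 4)"
        by (intro order_trans[OF sum_abs] sum_mono)
      then have "\<bar>\<Sum>i=1..N. R n k i\<bar> / N \<le> \<epsilon> / 4"
        using N by (simp add: field_simps)
      moreover have "Z (T * k / n) - (\<Sum>j<k. J n j \<omega>) = (\<Sum>i=1..N. R n k i) / N"
      proof -
        have "(\<Sum>j<k. J n j \<omega>) = (\<Sum>i=1..N. \<Sum>j<k. f' (x i (T * j / n) \<omega>) * D n i j \<omega> + f'' (x i (T * j / n) \<omega>) / 2 * ((D n i j \<omega>)\<^sup>2 - T / n)) / N"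
          unfolding J_def sum_divide_distrib[symmetric] by (subst sum.swap) simp
        then show ?thesis
          unfolding Z_def ito_remainder_def R_def by (simp add: sum_subtractf diff_divide_distrib)
      qed
      ultimately show ?thesis by simp
    qed
    moreover have "\<bar>\<Sum>j<k. J n j \<omega>\<bar> \<le> \<epsilon> / 2"
    proof -
      have "U n j \<omega> = J n j \<omega>" if "j < k" for j
      proof -
        have "P (\<lambda>i. x i (T * real l / real n) \<omega>)" if "l \<le> j" for l
        proof -
          have "T * real l / real n \<le> T * real k / real n"
            using that \<open>j < k\<close> T n by (intro divide_right_mono mult_left_mono) auto
          then show ?thesis using trunc tk(1) T by auto
        qed
        then show ?thesis by (simp add: U_def)
      qed
      then have "(\<Sum>j<k. J n j \<omega>) = (\<Sum>j<k. U n j \<omega>)" by simp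
      moreover have "\<bar>\<Sum>j<k. U n j \<omega>\<bar> \<le> \<epsilon> / 2"
        using n(1) \<omega> kn by (auto simp: E_def not_less)
      ultimately show ?thesis by simp
    qed
    ultimately have "\<bar>Z t\<bar> \<le> \<epsilon>" by linarith
    then show "\<bar>ito_remainder f f' f'' N (\<lambda>i t. x i t \<omega>) (\<lambda>i t. a i t \<omega>) t\<bar> \<le> \<epsilon>" by (simp add: Z_def)
  qed
qed

section \<open>The moment hierarchy and its limit\<close>

definition emp_moment :: "nat \<Rightarrow> (nat \<Rightarrow> real) \<Rightarrow> nat \<Rightarrow> real" where
  "emp_moment N y p = (\<Sum>i=1..N. y i ^ p) / N"

text \<open>
The drift of the \<open>p\<close>-th moment as a function of all moments \<open>m\<close>. Finitely many particles have
\<open>\<kappa> = 1 - c / N\<close>, because a particle does not repel itself, and the limit has \<open>\<kappa> = 1\<close>. For \<open>p \<le> 1\<close> the sum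
is empty and the other term has a factor \<open>0\<close>, whatever the truncated subtractions give.
\<close>
definition moment_drift :: "real \<Rightarrow> real \<Rightarrow> nat \<Rightarrow> (nat \<Rightarrow> real) \<Rightarrow> real" where
  "moment_drift c \<kappa> p m =
     c * p / 2 * (\<Sum>k<p - 1. m k * m (p - 2 - k)) + \<kappa> * (p * real (p - 1) / 2) * m (p - 2)"

text \<open>
Adding the sum to itself with \<open>i\<close> and \<open>j\<close> exchanged produces \<open>(x ^ n - y ^ n) / (x - y)\<close>, a geometric
sum in \<open>x\<close> and \<open>y\<close> that also makes sense for \<open>i = j\<close>. The last term removes this diagonal again.
\<close>
lemma sum_repulsion_symmetrised:
  fixes y :: "nat \<Rightarrow> real"
  assumes inj: "inj_on y I" and I: "finite I"
  shows "2 * (\<Sum>i\<in>I. y i ^ n * (\<Sum>j\<in>I - {i}. 1 / (y i - y j))) =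
     (\<Sum>k<n. (\<Sum>i\<in>I. y i ^ k) * (\<Sum>i\<in>I. y i ^ (n - Suc k))) - n * (\<Sum>i\<in>I. y i ^ (n - 1))"
proof -
  define X where "X = (\<Sum>i\<in>I. \<Sum>j\<in>I. if j = i then 0 else y i ^ n / (y i - y j))"
  have X: "(\<Sum>i\<in>I. y i ^ n * (\<Sum>j\<in>I - {i}. 1 / (y i - y j))) = X"
    unfolding X_def
  proof (rule sum.cong[OF refl])
    fix i assume i: "i \<in> I"
    have "y i ^ n * (\<Sum>j\<in>I - {i}. 1 / (y i - y j)) = (\<Sum>j\<in>I - {i}. y i ^ n / (y i - y j))"
      by (simp add: sum_distrib_left)
    also have "\<dots> = (\<Sum>j\<in>I. if j = i then 0 else y i ^ n / (y i - y j))"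
      using I i by (intro sum.mono_neutral_cong_left) auto
    finally show "y i ^ n * (\<Sum>j\<in>I - {i}. 1 / (y i - y j)) = (\<Sum>j\<in>I. if j = i then 0 else y i ^ n / (y i - y j))" .
  qed
  have "X = (\<Sum>i\<in>I. \<Sum>j\<in>I. if j = i then 0 else y j ^ n / (y j - y i))"
    unfolding X_def by (subst sum.swap) (intro sum.cong refl, auto)
  then have "2 * X = (\<Sum>i\<in>I. \<Sum>j\<in>I. (if j = i then 0 else y i ^ n / (y i - y j)) + (if j = i then 0 else y j ^ n / (y j - y i)))"
    by (simp add: sum.distrib X_def)
  also have "\<dots> = (\<Sum>i\<in>I. \<Sum>j\<in>I. (\<Sum>k<n. y j ^ (n - Suc k) * y i ^ k) - (if j = i then n * y i ^ (n - 1) else 0))"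
  proof (intro sum.cong refl)
    fix i j assume ij: "i \<in> I" "j \<in> I"
    show "(if j = i then 0 else y i ^ n / (y i - y j)) + (if j = i then 0 else y j ^ n / (y j - y i)) =
       (\<Sum>k<n. y j ^ (n - Suc k) * y i ^ k) - (if j = i then n * y i ^ (n - 1) else 0)"
    proof (cases "j = i")
      case True
      have "(\<Sum>k<n. y i ^ (n - Suc k) * y i ^ k) = (\<Sum>k<n. y i ^ (n - 1))"
        by (intro sum.cong refl) (simp add: power_add[symmetric])
      then show ?thesis using True by simp
    next
      case False
      then have ne: "y i - y j \<noteq> 0" using inj ij by (auto simp: inj_on_def)
      have "y i ^ n / (y i - y j) + y j ^ n / (y j - y i) = (y i ^ n - y j ^ n) / (y i - y j)"
        using ne minus_divide_right[of "y j ^ n" "y i - y j"] by (simp add: diff_divide_distrib)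
      also have "\<dots> = (\<Sum>k<n. y j ^ (n - Suc k) * y i ^ k)"
        using ne by (simp add: power_diff_sumr2)
      finally show ?thesis using False by simp
    qed
  qed
  also have "\<dots> = (\<Sum>i\<in>I. \<Sum>j\<in>I. \<Sum>k<n. y j ^ (n - Suc k) * y i ^ k) - (\<Sum>i\<in>I. n * y i ^ (n - 1))"
    using I by (simp add: sum_subtractf sum.delta)
  also have "(\<Sum>i\<in>I. \<Sum>j\<in>I. \<Sum>k<n. y j ^ (n - Suc k) * y i ^ k) = (\<Sum>k<n. (\<Sum>i\<in>I. y i ^ k) * (\<Sum>i\<in>I. y i ^ (n - Suc k)))"
  proof -
    have "(\<Sum>i\<in>I. \<Sum>j\<in>I. \<Sum>k<n. y j ^ (n - Suc k) * y i ^ k) = (\<Sum>i\<in>I. \<Sum>k<n. \<Sum>j\<in>I. y j ^ (n - Suc k) * y i ^ k)"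
      by (intro sum.cong refl sum.swap)
    also have "\<dots> = (\<Sum>k<n. \<Sum>i\<in>I. \<Sum>j\<in>I. y j ^ (n - Suc k) * y i ^ k)"
      by (rule sum.swap)
    also have "\<dots> = (\<Sum>k<n. (\<Sum>i\<in>I. y i ^ k) * (\<Sum>i\<in>I. y i ^ (n - Suc k)))"
      by (simp add: sum_product mult.commute)
    finally show ?thesis .
  qed
  finally show ?thesis unfolding X by (simp flip: sum_distrib_left)
qed

lemma generator_power_sum:
  fixes y :: "nat \<Rightarrow> real"
  assumes N: "N \<ge> 1" and inj: "inj_on y {1..N}"
  shows "(\<Sum>i=1..N. p * y i ^ (p - 1) * (c / N * (\<Sum>j\<in>{1..N} - {i}. 1 / (y i - y j))) + p * real (p - 1) * y i ^ (p - 2) / 2) / N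
    = moment_drift c (1 - c / N) p (emp_moment N y)"
proof -
  define s where "s k = (\<Sum>i=1..N. y i ^ k)" for k
  have sym: "2 * (\<Sum>i=1..N. y i ^ (p - 1) * (\<Sum>j\<in>{1..N} - {i}. 1 / (y i - y j))) =
     (\<Sum>k<p - 1. s k * s (p - 2 - k)) - real (p - 1) * s (p - 2)"
    using sum_repulsion_symmetrised[OF inj, of "p - 1"] by (simp add: s_def numeral_2_eq_2)
  have "(\<Sum>i=1..N. p * y i ^ (p - 1) * (c / N * (\<Sum>j\<in>{1..N} - {i}. 1 / (y i - y j))) + p * real (p - 1) * y i ^ (p - 2) / 2)
     = p * c / (2 * N) * (2 * (\<Sum>i=1..N. y i ^ (p - 1) * (\<Sum>j\<in>{1..N} - {i}. 1 / (y i - y j)))) + p * real (p - 1) / 2 * s (p - 2)"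
    by (simp add: sum.distrib s_def sum_distrib_left sum_divide_distrib mult_ac)
  also have "\<dots> / N = moment_drift c (1 - c / N) p (emp_moment N y)"
    unfolding sym moment_drift_def emp_moment_def s_def[symmetric] using N
    by (simp add: sum_divide_distrib[symmetric] field_simps power2_eq_square)
  finally show ?thesis .
qed

text \<open>
The moments of the orthogonality measure of the associated Hermite polynomials, which have the
recurrence coefficients \<open>c + 1, c + 2, \<dots>\<close>.
\<close>
function limit_moment :: "real \<Rightarrow> nat \<Rightarrow> real" where
  "limit_moment c 0 = 1"
| "limit_moment c (Suc 0) = 0"
| "limit_moment c (Suc (Suc p)) =
     c * (\<Sum>k\<le>p. limit_moment c k * limit_moment c (p - k)) + real (Suc p) * limit_moment c p"
  by pat_completeness auto
termination by (relation "Wellfounded.measure snd") auto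

lemma limit_moment_odd: "odd p \<Longrightarrow> limit_moment c p = 0"
proof (induction p rule: less_induct)
  case (less p)
  show ?case
  proof (cases "p = 1")
    case False
    then obtain q where q: "p = Suc (Suc q)" using less.prems by (metis One_nat_def even_zero not0_implies_Suc)
    then have "odd q" using less.prems by simp
    have "limit_moment c k * limit_moment c (q - k) = 0" if "k \<le> q" for k
    proof -
      have "odd k \<or> odd (q - k)" using \<open>odd q\<close> that by (metis even_add le_add_diff_inverse)
      moreover have "k < p" "q - k < p" using q that by linarith+
      ultimately show ?thesis using less.IH[of k] less.IH[of "q - k"] by auto
    qed
    then have "(\<Sum>k\<le>q. limit_moment c k * limit_moment c (q - k)) = 0" by (intro sum.neutral) auto
    then show ?thesis using less.IH[of q] q \<open>odd q\<close> by simp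
  qed simp
qed

definition limit_moment_at :: "real \<Rightarrow> real \<Rightarrow> nat \<Rightarrow> real" where
  "limit_moment_at c t p = limit_moment c p * t ^ (p div 2)"

text \<open>
In even order \<open>p = 2 * q + 2\<close> all terms of the drift carry the same power \<open>t ^ q\<close>, and without it the
hierarchy is the recursion for \<open>limit_moment\<close>. In odd order every term has a factor of odd order.
\<close>
lemma limit_moment_at_has_derivative:
  "((\<lambda>t. limit_moment_at c t p) has_real_derivative moment_drift c 1 p (limit_moment_at c t)) (at t within A)"
proof (cases "odd p")
  case True
  have "limit_moment_at c t k * limit_moment_at c t (p - 2 - k) = 0" if "k < p - 1" for k
  proof -
    have "p = k + (p - 2 - k) + 2" using that by linarith
    then have "odd k \<or> odd (p - 2 - k)" using True by (metis even_add even_numeral)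
    then have "limit_moment c k = 0 \<or> limit_moment c (p - 2 - k) = 0" using limit_moment_odd by blast
    then show ?thesis unfolding limit_moment_at_def by (elim disjE) simp_all
  qed
  then have "(\<Sum>k<p - 1. limit_moment_at c t k * limit_moment_at c t (p - 2 - k)) = 0" by (intro sum.neutral) auto
  moreover have "p = 1 \<or> odd (p - 2)" using True by (cases "p \<ge> 2") (auto elim!: oddE)
  ultimately have "moment_drift c 1 p (limit_moment_at c t) = 0"
    by (auto simp: moment_drift_def limit_moment_at_def limit_moment_odd)
  moreover have "(\<lambda>t. limit_moment_at c t p) = (\<lambda>t. 0)" using True by (simp add: limit_moment_at_def limit_moment_odd)
  ultimately show ?thesis by simp
next
  case False
  show ?thesis
  proof (cases "p = 0")
    case True
    then show ?thesis by (simp add: limit_moment_at_def moment_drift_def)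
  next
    case False
    obtain l where l: "p = 2 * l" using \<open>\<not> odd p\<close> by blast
    define q where "q = l - 1"
    have lq: "l = Suc q" using l False by (simp add: q_def)
    have q: "p = Suc (Suc (2 * q))" using l False by (simp add: q_def)
    define W where "W = (\<Sum>k\<le>2 * q. limit_moment c k * limit_moment c (2 * q - k))"
    have "limit_moment_at c t k * limit_moment_at c t (2 * q - k) = limit_moment c k * limit_moment c (2 * q - k) * t ^ q" if "k \<le> 2 * q" for k
    proof (cases "even k")
      case True
      then obtain l where "k = 2 * l" by auto
      then have "k div 2 + (2 * q - k) div 2 = q" using that by auto
      then show ?thesis by (simp add: limit_moment_at_def power_add[symmetric] mult_ac)
    qed (simp add: limit_moment_at_def limit_moment_odd)
    then have W: "(\<Sum>k<p - 1. limit_moment_at c t k * limit_moment_at c t (p - 2 - k)) = W * t ^ q"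
      unfolding sum_distrib_right q W_def by (intro sum.cong) auto
    define g where "g = limit_moment c (2 * q)"
    have "limit_moment_at c t (p - 2) = g * t ^ q" by (simp add: limit_moment_at_def q g_def)
    moreover have "limit_moment c p = c * W + real (Suc (2 * q)) * g" by (simp add: q W_def g_def)
    moreover have "real p = 2 * real (Suc q)" "real (p - 1) = real (Suc (2 * q))" by (simp_all add: q)
    ultimately have "moment_drift c 1 p (limit_moment_at c t) = limit_moment c p * (real (Suc q) * t ^ q)"
      unfolding moment_drift_def W by (simp add: algebra_simps del: of_nat_Suc)
    moreover have "((\<lambda>t. limit_moment_at c t p) has_real_derivative limit_moment c p * (real (Suc q) * t ^ q)) (at t within A)"
      using DERIV_cmult[OF DERIV_pow[of "Suc q" t A], of "limit_moment c p"]
      by (simp add: limit_moment_at_def l lq del: limit_moment.simps)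
    ultimately show ?thesis by simp
  qed
qed

lemma continuous_on_limit_moment_at: "continuous_on A (\<lambda>t. limit_moment_at c t p)"
  unfolding limit_moment_at_def by (intro continuous_intros)

lemma continuous_on_moment_drift:
  assumes "\<And>k. continuous_on A (\<lambda>t. m t k)"
  shows "continuous_on A (\<lambda>t. moment_drift c \<kappa> p (m t))"
  unfolding moment_drift_def by (intro continuous_intros assms)

lemma limit_moment_at_integral:
  assumes p: "p \<ge> 1" and t: "t \<ge> 0"
  shows "limit_moment_at c t p = (LINT s:{0..t}|lborel. moment_drift c 1 p (limit_moment_at c s))"
proof -
  have "((\<lambda>s. moment_drift c 1 p (limit_moment_at c s)) has_integral limit_moment_at c t p - limit_moment_at c 0 p) {0..t}"
    using t limit_moment_at_has_derivative
    by (intro fundamental_theorem_of_calculus) (auto simp: has_real_derivative_iff_has_vector_derivative[symmetric])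
  moreover have "limit_moment_at c 0 p = 0"
    using p by (cases "p = 1") (auto simp: limit_moment_at_def)
  moreover have "(LINT s:{0..t}|lborel. moment_drift c 1 p (limit_moment_at c s)) = integral {0..t} (\<lambda>s. moment_drift c 1 p (limit_moment_at c s))"
    by (intro set_borel_integral_eq_integral borel_integrable_atLeastAtMost' continuous_on_moment_drift continuous_on_limit_moment_at)
  ultimately show ?thesis by (simp add: integral_unique)
qed

lemma moment_drift_close:
  assumes c: "c \<ge> 0" and close: "\<And>k. k < p - 1 \<Longrightarrow> \<bar>m k - m' k\<bar> \<le> \<delta>" and bd: "\<And>k. k < p - 1 \<Longrightarrow> \<bar>m' k\<bar> \<le> B"
    and \<delta>: "0 \<le> \<delta>" "\<delta> \<le> 1" and B: "B \<ge> 0"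
  shows "\<bar>moment_drift c \<kappa> p m - moment_drift c 1 p m'\<bar> \<le> (c + 1) * (real p)\<^sup>2 * (2 * B + 1) * (\<delta> + \<bar>\<kappa> - 1\<bar>)"
proof (cases "p \<le> 1")
  case True
  then have "moment_drift c \<kappa> p m = 0" "moment_drift c 1 p m' = 0" by (auto simp: moment_drift_def le_Suc_eq)
  then show ?thesis using c B \<delta> by simp
next
  case False
  define L where "L = 2 * B + 1"
  define \<rho> where "\<rho> = \<delta> + \<bar>\<kappa> - 1\<bar>"
  have L: "L \<ge> 0" and \<rho>: "\<rho> \<ge> 0" "\<delta> \<le> \<rho>" using B \<delta> by (auto simp: L_def \<rho>_def)
  have m_bd: "\<bar>m k\<bar> \<le> B + 1" if "k < p - 1" for k
    using close[OF that] bd[OF that] \<delta> by linarith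
  have "\<bar>m k * m (p - 2 - k) - m' k * m' (p - 2 - k)\<bar> \<le> L * \<rho>" if k: "k < p - 1" for k
  proof -
    have k': "p - 2 - k < p - 1" using k by linarith
    have "m k * m (p - 2 - k) - m' k * m' (p - 2 - k) = (m k - m' k) * m (p - 2 - k) + m' k * (m (p - 2 - k) - m' (p - 2 - k))"
      by (simp add: algebra_simps)
    also have "\<bar>\<dots>\<bar> \<le> \<bar>m k - m' k\<bar> * \<bar>m (p - 2 - k)\<bar> + \<bar>m' k\<bar> * \<bar>m (p - 2 - k) - m' (p - 2 - k)\<bar>"
      by (intro order_trans[OF abs_triangle_ineq]) (simp add: abs_mult)
    also have "\<dots> \<le> \<delta> * (B + 1) + B * \<delta>"
      using close[OF k] close[OF k'] bd[OF k] m_bd[OF k'] \<delta> B by (intro add_mono mult_mono) auto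
    also have "\<dots> = L * \<delta>" by (simp add: L_def algebra_simps)
    also have "\<dots> \<le> L * \<rho>" using L \<rho> by (intro mult_left_mono)
    finally show ?thesis .
  qed
  then have "\<bar>\<Sum>k<p - 1. m k * m (p - 2 - k) - m' k * m' (p - 2 - k)\<bar> \<le> (\<Sum>k<p - 1. L * \<rho>)"
    by (intro order_trans[OF sum_abs] sum_mono) auto
  also have "\<dots> \<le> real p * (L * \<rho>)" using L \<rho> by (simp add: mult_right_mono)
  finally have 1: "\<bar>\<Sum>k<p - 1. m k * m (p - 2 - k) - m' k * m' (p - 2 - k)\<bar> \<le> real p * (L * \<rho>)" .
  have 2: "\<bar>\<kappa> * m (p - 2) - m' (p - 2)\<bar> \<le> L * \<rho>"
  proof -
    have k: "p - 2 < p - 1" using False by linarith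
    have "\<kappa> * m (p - 2) - m' (p - 2) = (\<kappa> - 1) * m (p - 2) + (m (p - 2) - m' (p - 2))" by (simp add: algebra_simps)
    also have "\<bar>\<dots>\<bar> \<le> \<bar>\<kappa> - 1\<bar> * \<bar>m (p - 2)\<bar> + \<bar>m (p - 2) - m' (p - 2)\<bar>"
      by (intro order_trans[OF abs_triangle_ineq]) (simp add: abs_mult)
    also have "\<dots> \<le> \<bar>\<kappa> - 1\<bar> * L + L * \<delta>"
    proof (intro add_mono mult_left_mono)
      show "\<bar>m (p - 2)\<bar> \<le> L" using m_bd[OF k] B by (simp add: L_def)
      have "1 * \<delta> \<le> L * \<delta>" using B \<delta> by (intro mult_right_mono) (auto simp: L_def)
      then show "\<bar>m (p - 2) - m' (p - 2)\<bar> \<le> L * \<delta>" using close[OF k] by simp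
    qed simp
    also have "\<dots> = L * \<rho>" by (simp add: \<rho>_def algebra_simps)
    finally show ?thesis .
  qed
  have "moment_drift c \<kappa> p m - moment_drift c 1 p m' =
     c * p / 2 * (\<Sum>k<p - 1. m k * m (p - 2 - k) - m' k * m' (p - 2 - k)) + p * real (p - 1) / 2 * (\<kappa> * m (p - 2) - m' (p - 2))"
    by (simp add: moment_drift_def sum_subtractf algebra_simps)
  also have "\<bar>\<dots>\<bar> \<le> c * p / 2 * \<bar>\<Sum>k<p - 1. m k * m (p - 2 - k) - m' k * m' (p - 2 - k)\<bar> + p * real (p - 1) / 2 * \<bar>\<kappa> * m (p - 2) - m' (p - 2)\<bar>"
    using c by (intro order_trans[OF abs_triangle_ineq]) (simp add: abs_mult)
  also have "\<dots> \<le> c * p / 2 * (real p * (L * \<rho>)) + p * real p / 2 * (L * \<rho>)"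
    using c 1 2 by (intro add_mono mult_mono mult_left_mono divide_right_mono) auto
  also have "\<dots> = (c + 1) / 2 * (real p)\<^sup>2 * L * \<rho>" by (simp add: power2_eq_square field_simps)
  also have "\<dots> \<le> (c + 1) * (real p)\<^sup>2 * L * \<rho>"
    using c L \<rho> by (intro mult_right_mono) auto
  finally show ?thesis by (simp add: L_def \<rho>_def)
qed

text \<open>
At the first time where \<open>S\<close> reaches \<open>K\<close>, the hypothesis \<open>step\<close> already says \<open>S t < K\<close>.
\<close>
lemma bootstrap_upper_bound:
  fixes S :: "real \<Rightarrow> real"
  assumes S: "continuous_on {0..T} S" and T: "0 \<le> T" and S0: "S 0 < K"
    and step: "\<And>t. t \<in> {0..T} \<Longrightarrow> (\<And>s. s \<in> {0..t} \<Longrightarrow> S s \<le> K) \<Longrightarrow> S t < K"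
    and t: "t \<in> {0..T}"
  shows "S t < K"
proof (rule ccontr)
  assume "\<not> S t < K"
  define E where "E = {0..T} \<inter> S -` {K..}"
  have "closed E" unfolding E_def by (rule continuous_closed_preimage[OF S]) auto
  then have "compact ({0..T} \<inter> E)" by (rule compact_Int_closed[OF compact_Icc])
  moreover have "{0..T} \<inter> E = E" by (auto simp: E_def)
  ultimately have "compact E" by (simp only:)
  moreover have "E \<noteq> {}" using t \<open>\<not> S t < K\<close> by (auto simp: E_def)
  ultimately have "\<exists>t0\<in>E. \<forall>s\<in>E. t0 \<le> s" by (rule compact_attains_inf)
  then obtain t0 where t0: "t0 \<in> E" "\<And>s. s \<in> E \<Longrightarrow> t0 \<le> s" by blast
  have in_T: "t0 \<in> {0..T}" and ge: "K \<le> S t0" using t0 by (auto simp: E_def)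
  have below: "S s < K" if "s \<in> {0..<t0}" for s
    using t0(2)[of s] that in_T by (force simp: E_def)
  have "S t0 \<le> K"
  proof (rule ccontr)
    assume "\<not> S t0 \<le> K"
    then obtain s where s: "0 \<le> s" "s \<le> t0" "S s = K"
      using IVT'[of S 0 K t0] S0 in_T continuous_on_subset[OF S, of "{0..t0}"] by auto
    then have "s \<in> E" using in_T by (auto simp: E_def)
    then have "s = t0" using t0(2) s by force
    then show False using s \<open>\<not> S t0 \<le> K\<close> by simp
  qed
  then have "S s \<le> K" if "s \<in> {0..t0}" for s
    using below[of s] that by (cases "s = t0") auto
  then have "S t0 < K" by (rule step[OF in_T])
  with ge show False by simp
qed

section \<open>Noise in the moments of Dyson's Brownian motion\<close>

lemma continuous_on_emp_moment:
  assumes "\<And>i. i \<in> {1..N} \<Longrightarrow> continuous_on A (y i)"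
  shows "continuous_on A (\<lambda>t. emp_moment N (\<lambda>i. y i t) p)"
  unfolding emp_moment_def divide_inverse using assms by (intro continuous_intros) auto

text \<open>
The symmetrised form of the drift needs distinct particles, so it replaces the original one only for
almost every time; under the integral this is enough.
\<close>
lemma ito_remainder_power_sum:
  fixes y :: "nat \<Rightarrow> real \<Rightarrow> real"
  assumes N: "N \<ge> 1" and t: "t \<ge> 0"
    and cont: "\<And>i. i \<in> {1..N} \<Longrightarrow> continuous_on {0..t} (y i)"
    and dist: "\<And>i j. i \<in> {1..N} \<Longrightarrow> j \<in> {1..N} \<Longrightarrow> i \<noteq> j \<Longrightarrow> AE s in lborel. 0 \<le> s \<longrightarrow> y i s \<noteq> y j s"
    and int: "\<And>i. i \<in> {1..N} \<Longrightarrow> set_integrable lborel {0..t} (\<lambda>s. c / N * (\<Sum>j\<in>{1..N} - {i}. 1 / (y i s - y j s)))"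
  shows "ito_remainder (\<lambda>x. x ^ p) (\<lambda>x. p * x ^ (p - 1)) (\<lambda>x. p * real (p - 1) * x ^ (p - 2)) N y
       (\<lambda>i s. c / N * (\<Sum>j\<in>{1..N} - {i}. 1 / (y i s - y j s))) t
    = emp_moment N (\<lambda>i. y i t) p - emp_moment N (\<lambda>i. y i 0) p
      - (LINT s:{0..t}|lborel. moment_drift c (1 - c / N) p (emp_moment N (\<lambda>i. y i s)))"
proof -
  define g where "g i s = p * y i s ^ (p - 1) * (c / N * (\<Sum>j\<in>{1..N} - {i}. 1 / (y i s - y j s))) + p * real (p - 1) * y i s ^ (p - 2) / 2" for i s
  have gi: "set_integrable lborel {0..t} (g i)" if i: "i \<in> {1..N}" for i
  proof -
    have cs: "continuous_on {0..t} (\<lambda>s. p * y i s ^ (p - 1))" "continuous_on {0..t} (\<lambda>s. p * real (p - 1) * y i s ^ (p - 2) / 2)"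
      using cont[OF i] by (auto intro!: continuous_intros)
    show ?thesis unfolding g_def
      by (rule set_integral_add(1)[OF set_integrable_continuous_mult[OF int[OF i] cs(1)] borel_integrable_atLeastAtMost'[OF cs(2)]])
  qed
  have "(\<Sum>i=1..N. LINT s:{0..t}|lborel. g i s) / N = (LINT s|lborel. (\<Sum>i=1..N. indicator {0..t} s *\<^sub>R g i s) / N)"
    using gi unfolding set_lebesgue_integral_def set_integrable_def
    by (subst integral_divide_zero, subst Bochner_Integration.integral_sum) auto
  also have "\<dots> = (LINT s|lborel. indicator {0..t} s *\<^sub>R moment_drift c (1 - c / N) p (emp_moment N (\<lambda>i. y i s)))"
  proof (rule integral_cong_AE)
    show "(\<lambda>s. (\<Sum>i=1..N. indicator {0..t} s *\<^sub>R g i s) / N) \<in> borel_measurable lborel"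
      using gi unfolding set_integrable_def
      by (intro borel_measurable_divide borel_measurable_sum borel_measurable_integrable borel_measurable_const)
    have "set_integrable lborel {0..t} (\<lambda>s. moment_drift c (1 - c / N) p (emp_moment N (\<lambda>i. y i s)))"
      by (intro borel_integrable_atLeastAtMost' continuous_on_moment_drift continuous_on_emp_moment cont)
    then show "(\<lambda>s. indicator {0..t} s *\<^sub>R moment_drift c (1 - c / N) p (emp_moment N (\<lambda>i. y i s))) \<in> borel_measurable lborel"
      unfolding set_integrable_def by (rule borel_measurable_integrable)
    have "AE s in lborel. \<forall>ij\<in>{1..N} \<times> {1..N}. fst ij \<noteq> snd ij \<longrightarrow> 0 \<le> s \<longrightarrow> y (fst ij) s \<noteq> y (snd ij) s"
      using dist by (intro AE_finite_allI) auto
    then show "AE s in lborel. (\<Sum>i=1..N. indicator {0..t} s *\<^sub>R g i s) / N = indicator {0..t} s *\<^sub>R moment_drift c (1 - c / N) p (emp_moment N (\<lambda>i. y i s))"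
    proof eventually_elim
      case (elim s)
      show ?case
      proof (cases "s \<in> {0..t}")
        case True
        then have "inj_on (\<lambda>i. y i s) {1..N}"
          using elim by (force simp: inj_on_def)
        then show ?thesis using generator_power_sum[OF N, of "\<lambda>i. y i s" p c] True by (simp add: g_def)
      qed simp
    qed
  qed
  finally have *: "(\<Sum>i=1..N. LINT s:{0..t}|lborel. g i s) / N = (LINT s:{0..t}|lborel. moment_drift c (1 - c / N) p (emp_moment N (\<lambda>i. y i s)))"
    unfolding set_lebesgue_integral_def .
  show ?thesis
    unfolding ito_remainder_def g_def[symmetric] sum_subtractf diff_divide_distrib * by (simp add: emp_moment_def)
qed

lemma power_le_small_multiple:
  fixes x \<delta> :: real
  assumes p: "1 \<le> p" "p \<le> 2 * q" and \<delta>: "\<delta> > 0"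
  shows "x ^ (2 * p - 2) \<le> \<delta> * x ^ (4 * q) + max 1 (1 / \<delta>) ^ (p - 1)"
proof -
  define z where "z = x\<^sup>2"
  define L where "L = max 1 (1 / \<delta>)"
  have z: "z \<ge> 0" and L: "L \<ge> 1" "1 \<le> \<delta> * L" using \<delta> by (auto simp: z_def L_def max_def field_simps)
  have "2 * p - 2 = 2 * (p - 1)" "4 * q = 2 * (2 * q)" using p by auto
  then have e: "x ^ (2 * p - 2) = z ^ (p - 1)" "x ^ (4 * q) = z ^ (2 * q)" unfolding z_def by (metis power_mult)+
  show ?thesis
  proof (cases "z \<le> L")
    case True
    then have "z ^ (p - 1) \<le> L ^ (p - 1)" using z by (intro power_mono)
    moreover have "0 \<le> \<delta> * z ^ (2 * q)" using z \<delta> by simp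
    ultimately show ?thesis unfolding e L_def[symmetric] by linarith
  next
    case False
    have "\<delta> * L \<le> \<delta> * z" using False \<delta> by (intro mult_left_mono) auto
    then have "z ^ (p - 1) * 1 \<le> z ^ (p - 1) * (\<delta> * z)"
      using z L by (intro mult_left_mono) auto
    also have "\<dots> = \<delta> * z ^ p" using p by (cases p) auto
    also have "\<dots> \<le> \<delta> * z ^ (2 * q)" using p L False \<delta> by (intro mult_left_mono power_increasing) auto
    finally have "z ^ (p - 1) \<le> \<delta> * z ^ (2 * q)" by simp
    moreover have "0 \<le> L ^ (p - 1)" using L by simp
    ultimately show ?thesis unfolding e L_def[symmetric] by linarith
  qed
qed

lemma sum_squares_le_square_sum:
  fixes a :: "'i \<Rightarrow> real"
  assumes "finite I" "\<And>i. i \<in> I \<Longrightarrow> a i \<ge> 0"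
  shows "(\<Sum>i\<in>I. (a i)\<^sup>2) \<le> (\<Sum>i\<in>I. a i)\<^sup>2"
proof -
  have "(\<Sum>i\<in>I. (a i)\<^sup>2) \<le> (\<Sum>i\<in>I. a i * (\<Sum>j\<in>I. a j))"
    unfolding power2_eq_square using assms by (intro sum_mono mult_left_mono member_le_sum) auto
  then show ?thesis by (simp add: power2_eq_square sum_distrib_right)
qed

text \<open>
A bound on the moment of order \<open>2 * q\<close> controls sums of powers up to \<open>4 * q\<close>, at the price of a
factor \<open>N\<close>, since the sum of squares is at most the square of the sum. As \<open>2 * p - 2\<close> is strictly smaller than
\<open>4 * q\<close>, this price can be multiplied by an arbitrarily small \<open>\<delta>\<close>.
\<close>
lemma truncation_square_sum_bound:
  fixes y :: "nat \<Rightarrow> real"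
  assumes N: "N \<ge> 1" and p: "1 \<le> p" "p \<le> 2 * q" and \<delta>: "\<delta> > 0" and y: "emp_moment N y (2 * q) \<le> K"
  shows "(\<Sum>i=1..N. (p * y i ^ (p - 1))\<^sup>2) \<le> ((real p)\<^sup>2 * (\<delta> * K\<^sup>2 + max 1 (1 / \<delta>) ^ (p - 1) / N)) * (real N)\<^sup>2"
proof -
  define C where "C = max 1 (1 / \<delta>) ^ (p - 1)"
  have s: "(\<Sum>i=1..N. y i ^ (2 * q)) \<le> N * K" using y N by (simp add: emp_moment_def divide_le_eq mult.commute)
  have s0: "0 \<le> (\<Sum>i=1..N. y i ^ (2 * q))" by (intro sum_nonneg) (simp add: power_mult)
  have "(\<Sum>i=1..N. y i ^ (4 * q)) = (\<Sum>i=1..N. (y i ^ (2 * q))\<^sup>2)" by (simp add: power_mult[symmetric] mult.commute)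
  also have "\<dots> \<le> (\<Sum>i=1..N. y i ^ (2 * q))\<^sup>2" by (rule sum_squares_le_square_sum) (auto simp: power_mult)
  also have "\<dots> \<le> (N * K)\<^sup>2" using s s0 by (intro power_mono)
  finally have 4: "(\<Sum>i=1..N. y i ^ (4 * q)) \<le> (N * K)\<^sup>2" .
  have "(\<Sum>i=1..N. (p * y i ^ (p - 1))\<^sup>2) = (real p)\<^sup>2 * (\<Sum>i=1..N. y i ^ (2 * p - 2))"
    by (simp add: power_mult_distrib sum_distrib_left power_mult[symmetric] right_diff_distrib' mult.commute)
  also have "\<dots> \<le> (real p)\<^sup>2 * (\<Sum>i=1..N. \<delta> * y i ^ (4 * q) + C)"
    unfolding C_def by (intro mult_left_mono sum_mono power_le_small_multiple p \<delta>) simp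
  also have "\<dots> = (real p)\<^sup>2 * (\<delta> * (\<Sum>i=1..N. y i ^ (4 * q)) + N * C)"
    by (simp add: sum.distrib sum_distrib_left)
  also have "\<dots> \<le> (real p)\<^sup>2 * (\<delta> * (N * K)\<^sup>2 + N * C)"
    using 4 \<delta> by (intro mult_left_mono add_right_mono) auto
  also have "\<dots> = ((real p)\<^sup>2 * (\<delta> * K\<^sup>2 + C / N)) * (real N)\<^sup>2"
    using N by (simp add: power2_eq_square field_simps)
  finally show ?thesis by (simp add: C_def)
qed

lemma truncation_pointwise_bound:
  fixes y :: "nat \<Rightarrow> real"
  assumes N: "N \<ge> 1" and q: "q \<ge> 1" and y: "emp_moment N y (2 * q) \<le> K" and i: "i \<in> {1..N}"
  shows "\<bar>y i\<bar> \<le> 1 + N * K"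
proof -
  have "y i ^ (2 * q) \<le> (\<Sum>i=1..N. y i ^ (2 * q))"
    using i by (intro member_le_sum) (auto simp: power_mult)
  also have "\<dots> \<le> N * K" using y N by (simp add: emp_moment_def divide_le_eq mult.commute)
  finally have 1: "\<bar>y i\<bar> ^ (2 * q) \<le> N * K" by (simp add: power_mult)
  have 0: "0 \<le> \<bar>y i\<bar> ^ (2 * q)" by simp
  show ?thesis
  proof (cases "\<bar>y i\<bar> \<le> 1")
    case False
    then have "\<bar>y i\<bar> ^ 1 \<le> \<bar>y i\<bar> ^ (2 * q)" using q by (intro power_increasing) auto
    then show ?thesis using 1 by simp
  qed (use 0 1 in linarith)
qed

lemma dyson_moment_tail:
  assumes dyson: "dyson_brownian_motion M (2 * c / real N) N b lam" and N: "N \<ge> 1" and T: "T > 0"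
    and p: "1 \<le> p" "p \<le> 2 * q" and \<delta>: "\<delta> > 0" and \<epsilon>: "\<epsilon> > 0" and \<eta>: "\<eta> > 0"
  shows "\<exists>B\<in>sets M. measure M B \<le> 8 * ((real p)\<^sup>2 * (\<delta> * K\<^sup>2 + max 1 (1 / \<delta>) ^ (p - 1) / N)) * T / \<epsilon>\<^sup>2 + \<eta> \<and>
    (\<forall>\<omega>\<in>space M - B. \<forall>t\<in>{0..T}. (\<forall>s\<in>{0..t}. emp_moment N (\<lambda>i. lam i s \<omega>) (2 * q) \<le> K) \<longrightarrow>
       \<bar>emp_moment N (\<lambda>i. lam i t \<omega>) p
         - (LINT s:{0..t}|lborel. moment_drift c (1 - c / N) p (emp_moment N (\<lambda>i. lam i s \<omega>)))\<bar> \<le> \<epsilon>)"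
proof -
  interpret prob_space M using dyson by (simp add: dyson_brownian_motion_def)
  define a where "a i s \<omega> = c / N * (\<Sum>j\<in>{1..N} - {i}. 1 / (lam i s \<omega> - lam j s \<omega>))" for i s \<omega>
  define regular where "regular \<omega> \<longleftrightarrow> (\<forall>i\<in>{1..N}. \<forall>j\<in>{1..N}. i \<noteq> j \<longrightarrow> (AE s in lborel. 0 \<le> s \<longrightarrow> lam i s \<omega> \<noteq> lam j s \<omega>) \<and>
           (\<forall>t\<ge>0. set_integrable lborel {0..t} (\<lambda>s. 1 / (lam i s \<omega> - lam j s \<omega>))))" for \<omega>
  have c_eq: "2 * c / real N / 2 = c / N" by simp
  have b: "independent_brownian_motions M N b" and
    adapted: "\<And>i t. i \<in> {1..N} \<Longrightarrow> 0 \<le> t \<Longrightarrow> lam i t \<in> borel_measurable (augmented_filtration M N b t)" and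
    cont: "\<And>i \<omega>. i \<in> {1..N} \<Longrightarrow> \<omega> \<in> space M \<Longrightarrow> continuous_on {0..} (\<lambda>t. lam i t \<omega>)" and
    sol: "AE \<omega> in M.
        (\<forall>i\<in>{1..N}. lam i 0 \<omega> = 0) \<and>
        (\<forall>t>0. \<forall>i\<in>{1..N}. \<forall>j\<in>{1..N}. i \<le> j \<longrightarrow> lam i t \<omega> \<le> lam j t \<omega>) \<and>
        regular \<omega> \<and>
        (\<forall>i\<in>{1..N}. \<forall>t\<ge>0. lam i t \<omega> = b i t \<omega> + (LINT s:{0..t}|lborel. a i s \<omega>))"
    using dyson unfolding dyson_brownian_motion_def c_eq a_def regular_def by blast+
  have a_int: "set_integrable lborel {0..t} (\<lambda>s. a i s \<omega>)"
    if "regular \<omega>"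
      "i \<in> {1..N}" "0 \<le> t" for i \<omega> t
  proof -
    have "integrable lborel (\<lambda>s. \<Sum>j\<in>{1..N} - {i}. indicator {0..t} s *\<^sub>R (1 / (lam i s \<omega> - lam j s \<omega>)))"
      using that unfolding set_integrable_def regular_def by (intro Bochner_Integration.integrable_sum) auto
    then have "set_integrable lborel {0..t} (\<lambda>s. \<Sum>j\<in>{1..N} - {i}. 1 / (lam i s \<omega> - lam j s \<omega>))"
      by (simp add: set_integrable_def sum_distrib_left)
    then show ?thesis unfolding a_def by (rule set_integrable_mult_right) 
  qed
  have q: "q \<ge> 1" using p by linarith
  define V where "V = (real p)\<^sup>2 * (\<delta> * K\<^sup>2 + max 1 (1 / \<delta>) ^ (p - 1) / N)"
  define P where "P y \<longleftrightarrow> emp_moment N y (2 * q) \<le> K" for y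
  \<comment> \<open>a single particle is bounded by \<open>N * K\<close> or by \<open>1\<close>; the bounds \<open>L\<close> and \<open>G\<close> may depend on \<open>N\<close>, as they only affect the discretisation\<close>
  define L where "L = 1 + N * \<bar>K\<bar>"
  define Z where "Z \<omega> = ito_remainder (\<lambda>x. x ^ p) (\<lambda>x. p * x ^ (p - 1)) (\<lambda>x. p * real (p - 1) * x ^ (p - 2)) N (\<lambda>i t. lam i t \<omega>) (\<lambda>i t. a i t \<omega>)" for \<omega>
  define G where "G = (real p)\<^sup>2 * L ^ p"
  have L: "L \<ge> 1" by (simp add: L_def)
  have yL: "\<bar>y i\<bar> \<le> L" if "P y" "i \<in> {1..N}" for y i
  proof -
    have "\<bar>y i\<bar> \<le> 1 + N * K" using that truncation_pointwise_bound[OF N q] by (simp add: P_def)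
    also have "\<dots> \<le> L" unfolding L_def by (intro add_left_mono mult_left_mono) auto
    finally show ?thesis .
  qed
  have pow_L: "\<bar>z\<bar> ^ n \<le> L ^ p" if "\<bar>z\<bar> \<le> L" "n \<le> p" for z n
    using power_mono[OF that(1), of n] power_increasing[OF that(2) L] by simp
  have pp: "real p \<le> (real p)\<^sup>2" "real p * real (p - 1) \<le> (real p)\<^sup>2"
    using p by (auto simp: power2_eq_square)
  have "\<exists>B\<in>events. prob B \<le> 8 * V * T / \<epsilon>\<^sup>2 + \<eta> \<and>
    (\<forall>\<omega>\<in>space M - B. \<forall>t\<in>{0..T}. (\<forall>s\<in>{0..t}. P (\<lambda>i. lam i s \<omega>)) \<longrightarrow>
       \<bar>Z \<omega> t\<bar> \<le> \<epsilon>)"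
    unfolding Z_def
  proof (rule ito_remainder_tail[where G=G and x=lam, OF b N T adapted])
    show "AE \<omega> in M. \<forall>i\<in>{1..N}. continuous_on {0..T} (\<lambda>t. lam i t \<omega>) \<and>
        set_integrable lborel {0..T} (\<lambda>s. a i s \<omega>) \<and>
        (\<forall>t\<in>{0..T}. lam i t \<omega> = b i t \<omega> + (LINT s:{0..t}|lborel. a i s \<omega>))"
      using sol AE_space
    proof eventually_elim
      case (elim \<omega>)
      show ?case
      proof (intro ballI conjI)
        fix i assume i: "i \<in> {1..N}"
        show "continuous_on {0..T} (\<lambda>t. lam i t \<omega>)"
          by (rule continuous_on_subset[OF cont[OF i elim(2)]]) auto
        show "set_integrable lborel {0..T} (\<lambda>s. a i s \<omega>)"
          using elim(1) T i by (intro a_int) auto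
        show "lam i t \<omega> = b i t \<omega> + (LINT s:{0..t}|lborel. a i s \<omega>)" if "t \<in> {0..T}" for t
          using elim(1) i that by (elim conjE) (drule bspec[OF _ i], auto)
      qed
    qed
    show "((\<lambda>x. x ^ p) has_real_derivative p * x ^ (p - 1)) (at x)" for x :: real
      using DERIV_pow[of p x UNIV] by simp
    show "((\<lambda>x. p * x ^ (p - 1)) has_real_derivative p * real (p - 1) * x ^ (p - 2)) (at x)" for x :: real
      using DERIV_cmult[OF DERIV_pow[of "p - 1" x UNIV], of "real p"] by (simp add: mult.assoc numeral_2_eq_2)
    show "continuous_on UNIV (\<lambda>x::real. p * real (p - 1) * x ^ (p - 2))" by (intro continuous_intros)
    show "{\<omega> \<in> space M. P (\<lambda>i. lam i t \<omega>)} \<in> sets (augmented_filtration M N b t)" if "0 \<le> t" for t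
    proof -
      have "(\<lambda>\<omega>. emp_moment N (\<lambda>i. lam i t \<omega>) (2 * q)) \<in> borel_measurable (augmented_filtration M N b t)"
        unfolding emp_moment_def using adapted[OF _ that]
        by (intro borel_measurable_divide borel_measurable_sum borel_measurable_power) auto
      then have "{\<omega> \<in> space (augmented_filtration M N b t). emp_moment N (\<lambda>i. lam i t \<omega>) (2 * q) \<le> K} \<in> sets (augmented_filtration M N b t)"
        by measurable
      then show ?thesis by (simp only: P_def space_augmented_filtration)
    qed
    show "\<bar>real p * y i ^ (p - 1)\<bar> \<le> G" if "P y" "i \<in> {1..N}" for y :: "nat \<Rightarrow> real" and i
      using pow_L[OF yL[OF that], of "p - 1"] pp L unfolding abs_mult power_abs[symmetric] G_def by (intro mult_mono) auto
    show "\<bar>real p * real (p - 1) * y i ^ (p - 2)\<bar> \<le> G" if "P y" "i \<in> {1..N}" for y :: "nat \<Rightarrow> real" and i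
      using pow_L[OF yL[OF that], of "p - 2"] pp L unfolding abs_mult[of "real p * real (p - 1)"] power_abs[symmetric] G_def by (intro mult_mono) auto
    show "(\<Sum>i=1..N. (p * y i ^ (p - 1))\<^sup>2) \<le> V * (real N)\<^sup>2" if "P y" for y :: "nat \<Rightarrow> real"
      unfolding V_def by (rule truncation_square_sum_bound[OF N p \<delta> that[unfolded P_def]])
    show "0 \<le> V" "0 \<le> G" using \<delta> L by (auto simp: V_def G_def)
  qed (use \<epsilon> \<eta> in auto)
  then obtain B where B: "B \<in> events" "prob B \<le> 8 * V * T / \<epsilon>\<^sup>2 + \<eta>" and
    bd: "\<forall>\<omega>\<in>space M - B. \<forall>t\<in>{0..T}. (\<forall>s\<in>{0..t}. P (\<lambda>i. lam i s \<omega>)) \<longrightarrow>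
       \<bar>Z \<omega> t\<bar> \<le> \<epsilon>"
    by (elim bexE conjE) (rule that)
  from sol have sol': "AE \<omega> in M. (\<forall>i\<in>{1..N}. lam i 0 \<omega> = 0) \<and>
        regular \<omega>"
    by eventually_elim (elim conjE, intro conjI)
  obtain B' where good: "\<And>\<omega>. \<omega> \<in> space M - B' \<Longrightarrow> (\<forall>i\<in>{1..N}. lam i 0 \<omega> = 0) \<and>
        regular \<omega>"
    and B': "B' \<in> null_sets M"
    by (rule AE_E3[OF sol']) (rule that)
  show ?thesis
  proof (intro bexI[of _ "B \<union> B'"] conjI ballI impI)
    show "B \<union> B' \<in> events" using B B' by auto
    have "prob (B \<union> B') = prob B" using B(1) B' by (rule measure_Un_null_set)
    then show "prob (B \<union> B') \<le> 8 * ((real p)\<^sup>2 * (\<delta> * K\<^sup>2 + max 1 (1 / \<delta>) ^ (p - 1) / N)) * T / \<epsilon>\<^sup>2 + \<eta>"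
      using B by (simp add: V_def)
    fix \<omega> t assume \<omega>: "\<omega> \<in> space M - (B \<union> B')" and t: "t \<in> {0..T}"
      and trunc: "\<forall>s\<in>{0..t}. emp_moment N (\<lambda>i. lam i s \<omega>) (2 * q) \<le> K"
    have g: "\<forall>i\<in>{1..N}. lam i 0 \<omega> = 0"
      "regular \<omega>"
    proof -
      have "\<omega> \<in> space M - B'" using \<omega> by simp
      from good[OF this] show "\<forall>i\<in>{1..N}. lam i 0 \<omega> = 0"
        "regular \<omega>"
        by (rule conjunct1, rule conjunct2)
    qed
    have "Z \<omega> t
      = emp_moment N (\<lambda>i. lam i t \<omega>) p - emp_moment N (\<lambda>i. lam i 0 \<omega>) p
      - (LINT s:{0..t}|lborel. moment_drift c (1 - c / N) p (emp_moment N (\<lambda>i. lam i s \<omega>)))"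
      unfolding Z_def a_def
    proof (rule ito_remainder_power_sum[OF N])
      show "continuous_on {0..t} (\<lambda>t. lam i t \<omega>)" if "i \<in> {1..N}" for i
        using cont[OF that, of \<omega>] \<omega> by (auto intro: continuous_on_subset)
      show "set_integrable lborel {0..t} (\<lambda>s. c / N * (\<Sum>j\<in>{1..N} - {i}. 1 / (lam i s \<omega> - lam j s \<omega>)))" if "i \<in> {1..N}" for i
        using a_int[OF g(2) that, of t] t by (simp add: a_def)
      show "AE s in lborel. 0 \<le> s \<longrightarrow> lam i s \<omega> \<noteq> lam j s \<omega>" if "i \<in> {1..N}" "j \<in> {1..N}" "i \<noteq> j" for i j
        using g(2) that unfolding regular_def by blast
    qed (use t in auto)
    moreover have "emp_moment N (\<lambda>i. lam i 0 \<omega>) p = 0"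
      using g(1) p by (simp add: emp_moment_def)
    ultimately show "\<bar>emp_moment N (\<lambda>i. lam i t \<omega>) p
         - (LINT s:{0..t}|lborel. moment_drift c (1 - c / N) p (emp_moment N (\<lambda>i. lam i s \<omega>)))\<bar> \<le> \<epsilon>"
      using bd[rule_format, of \<omega> t] \<omega> t trunc by (simp add: P_def)
  qed
qed

section \<open>Convergence of all moments\<close>

text \<open>
Measurable exceptional sets are part of the definition because the properties below refer to all
times at once, and their failure need not be a measurable event.
\<close>
definition with_high_probability :: "(nat \<Rightarrow> 'a measure) \<Rightarrow> (nat \<Rightarrow> 'a \<Rightarrow> bool) \<Rightarrow> bool" where
  "with_high_probability M P \<longleftrightarrow>
     (\<forall>\<eta>>0. \<forall>\<^sub>F N in sequentially.
        \<exists>B\<in>sets (M N). measure (M N) B \<le> \<eta> \<and> (\<forall>\<omega>\<in>space (M N) - B. P N \<omega>))"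

lemma with_high_probability_mono:
  assumes P: "with_high_probability M P"
    and PQ: "\<forall>\<^sub>F N in sequentially. \<forall>\<omega>\<in>space (M N). P N \<omega> \<longrightarrow> Q N \<omega>"
  shows "with_high_probability M Q"
  unfolding with_high_probability_def
proof (intro allI impI)
  fix \<eta> :: real assume "\<eta> > 0"
  then have "\<forall>\<^sub>F N in sequentially. \<exists>B\<in>sets (M N). measure (M N) B \<le> \<eta> \<and> (\<forall>\<omega>\<in>space (M N) - B. P N \<omega>)"
    using P by (simp add: with_high_probability_def)
  with PQ show "\<forall>\<^sub>F N in sequentially. \<exists>B\<in>sets (M N). measure (M N) B \<le> \<eta> \<and> (\<forall>\<omega>\<in>space (M N) - B. Q N \<omega>)"
    by eventually_elim blast
qed

lemma with_high_probability_conj: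
  assumes P: "with_high_probability M P" and Q: "with_high_probability M Q"
  shows "with_high_probability M (\<lambda>N \<omega>. P N \<omega> \<and> Q N \<omega>)"
  unfolding with_high_probability_def
proof (intro allI impI)
  fix \<eta> :: real assume "\<eta> > 0"
  then have "\<eta> / 2 > 0" by simp
  then have "\<forall>\<^sub>F N in sequentially. \<exists>B\<in>sets (M N). measure (M N) B \<le> \<eta> / 2 \<and> (\<forall>\<omega>\<in>space (M N) - B. P N \<omega>)"
    "\<forall>\<^sub>F N in sequentially. \<exists>B\<in>sets (M N). measure (M N) B \<le> \<eta> / 2 \<and> (\<forall>\<omega>\<in>space (M N) - B. Q N \<omega>)"
    using P Q unfolding with_high_probability_def by blast+
  then show "\<forall>\<^sub>F N in sequentially. \<exists>B\<in>sets (M N). measure (M N) B \<le> \<eta> \<and> (\<forall>\<omega>\<in>space (M N) - B. P N \<omega> \<and> Q N \<omega>)"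
  proof eventually_elim
    case (elim N)
    then obtain A B where A: "A \<in> sets (M N)" "measure (M N) A \<le> \<eta> / 2" "\<forall>\<omega>\<in>space (M N) - A. P N \<omega>"
      and B: "B \<in> sets (M N)" "measure (M N) B \<le> \<eta> / 2" "\<forall>\<omega>\<in>space (M N) - B. Q N \<omega>" by blast
    have "measure (M N) (A \<union> B) \<le> measure (M N) A + measure (M N) B" using A B by (intro measure_Un_le)
    then have "measure (M N) (A \<union> B) \<le> \<eta>" using A B by linarith
    then show ?case using A B by (intro bexI[of _ "A \<union> B"]) auto
  qed
qed

lemma with_high_probability_True: "with_high_probability M (\<lambda>N \<omega>. True)"
  unfolding with_high_probability_def by (auto intro!: always_eventually bexI[of _ "{}"])

lemma with_high_probability_all_less:
  fixes n :: nat
  assumes "\<And>k. k < n \<Longrightarrow> with_high_probability M (P k)"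
  shows "with_high_probability M (\<lambda>N \<omega>. \<forall>k<n. P k N \<omega>)"
  using assms
proof (induction n)
  case 0
  show ?case using with_high_probability_True by simp
next
  case (Suc n)
  then have "with_high_probability M (\<lambda>N \<omega>. (\<forall>k<n. P k N \<omega>) \<and> P n N \<omega>)"
    by (intro with_high_probability_conj) auto
  then show ?case
    by (rule with_high_probability_mono) (auto intro!: always_eventually simp: less_Suc_eq)
qed

locale dyson_sequence =
  fixes c T :: real and M :: "nat \<Rightarrow> 'a measure" and b lam :: "nat \<Rightarrow> nat \<Rightarrow> real \<Rightarrow> 'a \<Rightarrow> real"
  assumes c: "c > 0" and T: "T > 0"
    and dyson: "\<And>N. N \<ge> 1 \<Longrightarrow> dyson_brownian_motion (M N) (2 * c / real N) N (b N) (lam N)"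
begin

definition sample_moment :: "nat \<Rightarrow> 'a \<Rightarrow> real \<Rightarrow> nat \<Rightarrow> real" where
  "sample_moment N \<omega> t = emp_moment N (\<lambda>i. lam N i t \<omega>)"

definition moment_converges :: "nat \<Rightarrow> bool" where
  "moment_converges p \<longleftrightarrow>
     (\<forall>\<epsilon>>0. with_high_probability M (\<lambda>N \<omega>. \<forall>t\<in>{0..T}. \<bar>sample_moment N \<omega> t p - limit_moment_at c t p\<bar> \<le> \<epsilon>))"

lemma continuous_sample_moment:
  assumes "N \<ge> 1" "\<omega> \<in> space (M N)"
  shows "continuous_on {0..} (\<lambda>t. sample_moment N \<omega> t p)"
  unfolding sample_moment_def using dyson[OF assms(1)] assms(2)
  by (intro continuous_on_emp_moment) (auto simp: dyson_brownian_motion_def)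

lemma truncated_noise_small:
  assumes p: "1 \<le> p" "p \<le> 2 * q" and \<epsilon>: "\<epsilon> > 0"
  shows "with_high_probability M (\<lambda>N \<omega>. \<forall>t\<in>{0..T}. (\<forall>s\<in>{0..t}. sample_moment N \<omega> s (2 * q) \<le> K) \<longrightarrow>
    \<bar>sample_moment N \<omega> t p - (LINT s:{0..t}|lborel. moment_drift c (1 - c / N) p (sample_moment N \<omega> s))\<bar> \<le> \<epsilon>)"
  unfolding with_high_probability_def
proof (intro allI impI)
  fix \<eta> :: real assume \<eta>: "\<eta> > 0"
  define A where "A = 8 * (real p)\<^sup>2 * T / \<epsilon>\<^sup>2"
  have A: "A > 0" using p T \<epsilon> by (simp add: A_def)
  \<comment> \<open>the part of the bracket that does not vanish with \<open>N\<close> is proportional to \<open>\<delta> * K\<^sup>2\<close>; the summand \<open>1\<close> allows for \<open>K = 0\<close>\<close>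
  define \<delta> where "\<delta> = \<eta> / (3 * A * (K\<^sup>2 + 1))"
  have "K\<^sup>2 + 1 > 0" by (simp add: add_nonneg_pos)
  then have \<delta>: "\<delta> > 0" using A \<eta> by (simp add: \<delta>_def)
  have "A * \<delta> * K\<^sup>2 = \<eta> / 3 * (K\<^sup>2 / (K\<^sup>2 + 1))" using A \<open>K\<^sup>2 + 1 > 0\<close> by (simp add: \<delta>_def)
  also have "\<dots> \<le> \<eta> / 3 * 1" using \<eta> \<open>K\<^sup>2 + 1 > 0\<close> by (intro mult_left_mono) auto
  finally have 1: "A * \<delta> * K\<^sup>2 \<le> \<eta> / 3" by simp
  define C where "C = max 1 (1 / \<delta>) ^ (p - 1)"
  have "\<forall>\<^sub>F N in sequentially. A * C / real N < \<eta> / 3"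
    using order_tendstoD(2)[OF lim_const_over_n, of "\<eta> / 3" "A * C"] \<eta> by simp
  moreover have "\<forall>\<^sub>F N in sequentially. N \<ge> (1::nat)" by (rule eventually_ge_at_top)
  ultimately show "\<forall>\<^sub>F N in sequentially. \<exists>B\<in>sets (M N). measure (M N) B \<le> \<eta> \<and>
     (\<forall>\<omega>\<in>space (M N) - B. \<forall>t\<in>{0..T}. (\<forall>s\<in>{0..t}. sample_moment N \<omega> s (2 * q) \<le> K) \<longrightarrow>
    \<bar>sample_moment N \<omega> t p - (LINT s:{0..t}|lborel. moment_drift c (1 - c / N) p (sample_moment N \<omega> s))\<bar> \<le> \<epsilon>)"
  proof eventually_elim
    case (elim N)
    obtain B where B: "B \<in> sets (M N)"
      "measure (M N) B \<le> 8 * ((real p)\<^sup>2 * (\<delta> * K\<^sup>2 + C / N)) * T / \<epsilon>\<^sup>2 + \<eta> / 3"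
      "\<forall>\<omega>\<in>space (M N) - B. \<forall>t\<in>{0..T}. (\<forall>s\<in>{0..t}. sample_moment N \<omega> s (2 * q) \<le> K) \<longrightarrow>
    \<bar>sample_moment N \<omega> t p - (LINT s:{0..t}|lborel. moment_drift c (1 - c / N) p (sample_moment N \<omega> s))\<bar> \<le> \<epsilon>"
      using dyson_moment_tail[OF dyson[OF elim(2)] elim(2) T p \<delta> \<epsilon>, of "\<eta> / 3" K] \<eta>
      unfolding sample_moment_def C_def by auto
    have "8 * ((real p)\<^sup>2 * (\<delta> * K\<^sup>2 + C / N)) * T / \<epsilon>\<^sup>2 = A * \<delta> * K\<^sup>2 + A * C / N"
      by (simp add: A_def ring_distribs add_divide_distrib mult_ac)
    then have "measure (M N) B \<le> \<eta>" using B(2) 1 elim(1) by linarith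
    then show ?case using B by blast
  qed
qed

lemma limit_moment_at_bounded: "\<exists>B\<ge>0. \<forall>k<n. \<forall>t\<in>{0..T}. \<bar>limit_moment_at c t k\<bar> \<le> B"
proof -
  define B where "B = (\<Sum>k<n. \<bar>limit_moment c k\<bar> * (1 + T) ^ (k div 2))"
  have "\<bar>limit_moment_at c t k\<bar> \<le> B" if "k < n" "t \<in> {0..T}" for k t
  proof -
    have "\<bar>limit_moment_at c t k\<bar> = \<bar>limit_moment c k\<bar> * t ^ (k div 2)"
      using that by (simp add: limit_moment_at_def abs_mult)
    also have "\<dots> \<le> \<bar>limit_moment c k\<bar> * (1 + T) ^ (k div 2)"
      using that by (intro mult_left_mono power_mono) auto
    also have "\<dots> \<le> B" unfolding B_def
      using that T by (intro member_le_sum) auto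
    finally show ?thesis .
  qed
  moreover have "B \<ge> 0" using T by (auto simp: B_def intro!: sum_nonneg)
  ultimately show ?thesis by blast
qed

text \<open>
The drift of order \<open>p\<close> only contains moments that are already known to converge, so by the integrated
hierarchies for the particles and for the limit, their difference is noise plus a small integral.
\<close>
lemma truncated_moment_converges:
  assumes p: "1 \<le> p" "p \<le> 2 * q" and lower: "\<And>k. k < p - 1 \<Longrightarrow> moment_converges k" and \<epsilon>: "\<epsilon> > 0"
  shows "with_high_probability M (\<lambda>N \<omega>. \<forall>t\<in>{0..T}. (\<forall>s\<in>{0..t}. sample_moment N \<omega> s (2 * q) \<le> K) \<longrightarrow>
    \<bar>sample_moment N \<omega> t p - limit_moment_at c t p\<bar> \<le> \<epsilon>)"
proof -
  obtain B where B: "B \<ge> 0" "\<forall>k<p - 1. \<forall>t\<in>{0..T}. \<bar>limit_moment_at c t k\<bar> \<le> B"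
    using limit_moment_at_bounded[of "p - 1"] by blast
  define C where "C = (c + 1) * (real p)\<^sup>2 * (2 * B + 1)"
  have C: "C > 0" using c p B by (auto simp: C_def)
  \<comment> \<open>the drifts will differ by at most \<open>C * (\<delta> + c / N)\<close>, and \<open>c / N\<close> is eventually below \<open>\<delta>\<close>\<close>
  define \<delta> where "\<delta> = min 1 (\<epsilon> / (4 * C * T))"
  have \<delta>: "\<delta> > 0" "\<delta> \<le> 1" using C T \<epsilon> by (auto simp: \<delta>_def)
  have "4 * C * T * \<delta> \<le> 4 * C * T * (\<epsilon> / (4 * C * T))"
    using C T unfolding \<delta>_def by (intro mult_left_mono) auto
  then have \<delta>': "C * (2 * \<delta>) * T \<le> \<epsilon> / 2" using C T by (simp add: mult_ac)
  have whp1: "with_high_probability M (\<lambda>N \<omega>. \<forall>k<p - 1. \<forall>t\<in>{0..T}. \<bar>sample_moment N \<omega> t k - limit_moment_at c t k\<bar> \<le> \<delta>)"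
    using lower \<delta>(1) unfolding moment_converges_def by (intro with_high_probability_all_less) auto
  have whp2: "with_high_probability M (\<lambda>N \<omega>. \<forall>t\<in>{0..T}. (\<forall>s\<in>{0..t}. sample_moment N \<omega> s (2 * q) \<le> K) \<longrightarrow>
    \<bar>sample_moment N \<omega> t p - (LINT s:{0..t}|lborel. moment_drift c (1 - c / N) p (sample_moment N \<omega> s))\<bar> \<le> \<epsilon> / 2)"
    using p \<epsilon> by (intro truncated_noise_small) auto
  show ?thesis
  proof (rule with_high_probability_mono[OF with_high_probability_conj[OF whp1 whp2]])
    have "\<forall>\<^sub>F N in sequentially. c / real N < \<delta>"
      using order_tendstoD(2)[OF lim_const_over_n \<delta>(1)] by simp
    moreover have "\<forall>\<^sub>F N in sequentially. N \<ge> (1::nat)" by (rule eventually_ge_at_top)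
    ultimately show "\<forall>\<^sub>F N in sequentially. \<forall>\<omega>\<in>space (M N).
      (\<forall>k<p - 1. \<forall>t\<in>{0..T}. \<bar>sample_moment N \<omega> t k - limit_moment_at c t k\<bar> \<le> \<delta>) \<and>
      (\<forall>t\<in>{0..T}. (\<forall>s\<in>{0..t}. sample_moment N \<omega> s (2 * q) \<le> K) \<longrightarrow>
        \<bar>sample_moment N \<omega> t p - (LINT s:{0..t}|lborel. moment_drift c (1 - c / N) p (sample_moment N \<omega> s))\<bar> \<le> \<epsilon> / 2) \<longrightarrow>
      (\<forall>t\<in>{0..T}. (\<forall>s\<in>{0..t}. sample_moment N \<omega> s (2 * q) \<le> K) \<longrightarrow> \<bar>sample_moment N \<omega> t p - limit_moment_at c t p\<bar> \<le> \<epsilon>)"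
    proof eventually_elim
      case (elim N)
      show ?case
      proof (intro ballI impI, elim conjE)
        fix \<omega> t
        assume \<omega>: "\<omega> \<in> space (M N)" and t: "t \<in> {0..T}" and trunc: "\<forall>s\<in>{0..t}. sample_moment N \<omega> s (2 * q) \<le> K"
          and close: "\<forall>k<p - 1. \<forall>t\<in>{0..T}. \<bar>sample_moment N \<omega> t k - limit_moment_at c t k\<bar> \<le> \<delta>"
          and noise: "\<forall>t\<in>{0..T}. (\<forall>s\<in>{0..t}. sample_moment N \<omega> s (2 * q) \<le> K) \<longrightarrow>
        \<bar>sample_moment N \<omega> t p - (LINT s:{0..t}|lborel. moment_drift c (1 - c / N) p (sample_moment N \<omega> s))\<bar> \<le> \<epsilon> / 2"
        define D where "D s = moment_drift c (1 - c / N) p (sample_moment N \<omega> s)" for s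
        define D' where "D' s = moment_drift c 1 p (limit_moment_at c s)" for s
        have i: "set_integrable lborel {0..t} D" "set_integrable lborel {0..t} D'"
          unfolding D_def D'_def
          by (auto intro!: borel_integrable_atLeastAtMost' continuous_on_moment_drift continuous_on_limit_moment_at
              continuous_on_subset[OF continuous_sample_moment[OF elim(2) \<omega>]])
        have diff: "\<bar>D s - D' s\<bar> \<le> C * (2 * \<delta>)" if s: "s \<in> {0..t}" for s
        proof -
          have sT: "s \<in> {0..T}" using s t by auto
          have "\<bar>D s - D' s\<bar> \<le> (c + 1) * (real p)\<^sup>2 * (2 * B + 1) * (\<delta> + \<bar>(1 - c / N) - 1\<bar>)"
            unfolding D_def D'_def
            by (rule moment_drift_close) (use c close B \<delta> sT in auto)
          also have "\<dots> = C * (\<delta> + c / N)" using c elim(2) by (simp add: C_def)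
          also have "\<dots> \<le> C * (2 * \<delta>)" using C elim(1) by (intro mult_left_mono) auto
          finally show ?thesis .
        qed
        have "\<bar>LINT s:{0..t}|lborel. D s - D' s\<bar> \<le> (LINT s:{0..t}|lborel. C * (2 * \<delta>))"
          using i diff by (intro set_integral_abs_bound set_integral_diff) (auto intro!: borel_integrable_atLeastAtMost')
        also have "\<dots> = C * (2 * \<delta>) * t" using t by (simp add: set_lebesgue_integral_def)
        also have "\<dots> \<le> C * (2 * \<delta>) * T" using t C \<delta> by (intro mult_left_mono) auto
        also have "\<dots> \<le> \<epsilon> / 2" by (rule \<delta>')
        finally have "\<bar>(LINT s:{0..t}|lborel. D s) - (LINT s:{0..t}|lborel. D' s)\<bar> \<le> \<epsilon> / 2"
          using i by (simp add: set_integral_diff)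
        moreover have "(LINT s:{0..t}|lborel. D' s) = limit_moment_at c t p"
          unfolding D'_def using limit_moment_at_integral[OF p(1), of t c] t by simp
        moreover have "\<bar>sample_moment N \<omega> t p - (LINT s:{0..t}|lborel. D s)\<bar> \<le> \<epsilon> / 2"
          unfolding D_def using noise t trunc by blast
        ultimately show "\<bar>sample_moment N \<omega> t p - limit_moment_at c t p\<bar> \<le> \<epsilon>" by linarith
      qed
    qed
  qed
qed

lemma starts_at_zero: "with_high_probability M (\<lambda>N \<omega>. \<forall>i\<in>{1..N}. lam N i 0 \<omega> = 0)"
  unfolding with_high_probability_def
proof (intro allI impI)
  fix \<eta> :: real assume \<eta>: "\<eta> > 0"
  have "\<forall>\<^sub>F N in sequentially. N \<ge> (1::nat)" by (rule eventually_ge_at_top)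
  then show "\<forall>\<^sub>F N in sequentially. \<exists>B\<in>sets (M N). measure (M N) B \<le> \<eta> \<and> (\<forall>\<omega>\<in>space (M N) - B. \<forall>i\<in>{1..N}. lam N i 0 \<omega> = 0)"
  proof eventually_elim
    case (elim N)
    have "AE \<omega> in M N. \<forall>i\<in>{1..N}. lam N i 0 \<omega> = 0"
    proof -
      from dyson[OF elim] have "AE \<omega> in M N. (\<forall>i\<in>{1..N}. lam N i 0 \<omega> = 0) \<and> 
        (\<forall>t>0. \<forall>i\<in>{1..N}. \<forall>j\<in>{1..N}. i \<le> j \<longrightarrow> lam N i t \<omega> \<le> lam N j t \<omega>) \<and>
        (\<forall>i\<in>{1..N}. \<forall>j\<in>{1..N}. i \<noteq> j \<longrightarrow>
           (AE s in lborel. 0 \<le> s \<longrightarrow> lam N i s \<omega> \<noteq> lam N j s \<omega>) \<and>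
           (\<forall>t\<ge>0. set_integrable lborel {0..t} (\<lambda>s. 1 / (lam N i s \<omega> - lam N j s \<omega>)))) \<and>
        (\<forall>i\<in>{1..N}. \<forall>t\<ge>0.
           lam N i t \<omega> = b N i t \<omega> +
             (LINT s:{0..t}|lborel. (2 * c / real N) / 2 * (\<Sum>j\<in>{1..N} - {i}. 1 / (lam N i s \<omega> - lam N j s \<omega>))))"
        unfolding dyson_brownian_motion_def by (elim conjE)
      then show ?thesis by eventually_elim (elim conjE)
    qed
    then obtain Z where Z: "\<And>\<omega>. \<omega> \<in> space (M N) - Z \<Longrightarrow> \<forall>i\<in>{1..N}. lam N i 0 \<omega> = 0" "Z \<in> null_sets (M N)"
      by (rule AE_E3) (rule that)
    then have "measure (M N) Z \<le> \<eta>" using \<eta> by (simp add: null_sets_def measure_def)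
    then show ?case using Z by (intro bexI[of _ Z]) auto
  qed
qed

text \<open>
With \<open>p = 2 * q\<close> the truncated quantity is the one that converges. As long as it stays below
\<open>B + 1\<close> it is within \<open>1 / 2\<close> of a function bounded by \<open>B\<close>, so it never reaches \<open>B + 1\<close>.
\<close>
lemma even_moment_converges:
  assumes q: "q \<ge> 1" and lower: "\<And>k. k < 2 * q - 1 \<Longrightarrow> moment_converges k"
  shows "moment_converges (2 * q)"
  unfolding moment_converges_def
proof (intro allI impI)
  fix \<epsilon> :: real assume \<epsilon>: "\<epsilon> > 0"
  obtain B where B: "B \<ge> 0" "\<forall>k<Suc (2 * q). \<forall>t\<in>{0..T}. \<bar>limit_moment_at c t k\<bar> \<le> B"
    using limit_moment_at_bounded[of "Suc (2 * q)"] by blast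
  have whp: "with_high_probability M (\<lambda>N \<omega>. \<forall>t\<in>{0..T}. (\<forall>s\<in>{0..t}. sample_moment N \<omega> s (2 * q) \<le> B + 1) \<longrightarrow>
    \<bar>sample_moment N \<omega> t (2 * q) - limit_moment_at c t (2 * q)\<bar> \<le> min \<epsilon> (1 / 2))"
    using q lower \<epsilon> by (intro truncated_moment_converges) auto
  show "with_high_probability M (\<lambda>N \<omega>. \<forall>t\<in>{0..T}. \<bar>sample_moment N \<omega> t (2 * q) - limit_moment_at c t (2 * q)\<bar> \<le> \<epsilon>)"
  proof (rule with_high_probability_mono[OF with_high_probability_conj[OF whp starts_at_zero]])
    have "\<forall>\<^sub>F N in sequentially. N \<ge> (1::nat)" by (rule eventually_ge_at_top)
    then show "\<forall>\<^sub>F N in sequentially. \<forall>\<omega>\<in>space (M N).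
      (\<forall>t\<in>{0..T}. (\<forall>s\<in>{0..t}. sample_moment N \<omega> s (2 * q) \<le> B + 1) \<longrightarrow>
        \<bar>sample_moment N \<omega> t (2 * q) - limit_moment_at c t (2 * q)\<bar> \<le> min \<epsilon> (1 / 2)) \<and> (\<forall>i\<in>{1..N}. lam N i 0 \<omega> = 0) \<longrightarrow>
      (\<forall>t\<in>{0..T}. \<bar>sample_moment N \<omega> t (2 * q) - limit_moment_at c t (2 * q)\<bar> \<le> \<epsilon>)"
    proof eventually_elim
      case (elim N)
      show ?case
      proof (intro ballI impI, elim conjE)
        fix \<omega> t assume \<omega>: "\<omega> \<in> space (M N)" and t: "t \<in> {0..T}" and zero: "\<forall>i\<in>{1..N}. lam N i 0 \<omega> = 0"
          and close: "\<forall>t\<in>{0..T}. (\<forall>s\<in>{0..t}. sample_moment N \<omega> s (2 * q) \<le> B + 1) \<longrightarrow>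
              \<bar>sample_moment N \<omega> t (2 * q) - limit_moment_at c t (2 * q)\<bar> \<le> min \<epsilon> (1 / 2)"
        have below: "sample_moment N \<omega> s (2 * q) < B + 1" if "s \<in> {0..T}" for s
        proof (rule bootstrap_upper_bound[OF _ less_imp_le[OF T] _ _ that])
          show "continuous_on {0..T} (\<lambda>t. sample_moment N \<omega> t (2 * q))"
            by (rule continuous_on_subset[OF continuous_sample_moment[OF elim \<omega>]]) auto
          have "sample_moment N \<omega> 0 (2 * q) = 0" using zero q by (simp add: sample_moment_def emp_moment_def)
          then show "sample_moment N \<omega> 0 (2 * q) < B + 1" using B by simp
          show "sample_moment N \<omega> r (2 * q) < B + 1" if r: "r \<in> {0..T}" and "\<And>s. s \<in> {0..r} \<Longrightarrow> sample_moment N \<omega> s (2 * q) \<le> B + 1" for r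
          proof -
            have "\<bar>sample_moment N \<omega> r (2 * q) - limit_moment_at c r (2 * q)\<bar> \<le> min \<epsilon> (1 / 2)" using close that by blast
            moreover have "\<bar>limit_moment_at c r (2 * q)\<bar> \<le> B" using B(2) r by blast
            ultimately show ?thesis by linarith
          qed
        qed
        then have "\<forall>s\<in>{0..t}. sample_moment N \<omega> s (2 * q) \<le> B + 1" using t by (auto intro: less_imp_le)
        then have "\<bar>sample_moment N \<omega> t (2 * q) - limit_moment_at c t (2 * q)\<bar> \<le> min \<epsilon> (1 / 2)" using close t by blast
        then show "\<bar>sample_moment N \<omega> t (2 * q) - limit_moment_at c t (2 * q)\<bar> \<le> \<epsilon>" by simp
      qed
    qed
  qed
qed

text \<open>
An odd moment does not bound the sizes of the particles, so the next even moment is used for the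
truncation. It does not depend on the odd one, because its drift only contains orders up to
\<open>2 * q - 2\<close>.
\<close>
lemma odd_moment_converges:
  assumes q: "q \<ge> 1" and lower: "\<And>k. k < 2 * q - 1 \<Longrightarrow> moment_converges k" and even: "moment_converges (2 * q)"
  shows "moment_converges (2 * q - 1)"
  unfolding moment_converges_def
proof (intro allI impI)
  fix \<epsilon> :: real assume \<epsilon>: "\<epsilon> > 0"
  obtain B where B: "B \<ge> 0" "\<forall>k<Suc (2 * q). \<forall>t\<in>{0..T}. \<bar>limit_moment_at c t k\<bar> \<le> B"
    using limit_moment_at_bounded[of "Suc (2 * q)"] by blast
  have whp1: "with_high_probability M (\<lambda>N \<omega>. \<forall>t\<in>{0..T}. (\<forall>s\<in>{0..t}. sample_moment N \<omega> s (2 * q) \<le> B + 1) \<longrightarrow>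
    \<bar>sample_moment N \<omega> t (2 * q - 1) - limit_moment_at c t (2 * q - 1)\<bar> \<le> \<epsilon>)"
    using q lower \<epsilon> by (intro truncated_moment_converges) auto
  have whp2: "with_high_probability M (\<lambda>N \<omega>. \<forall>t\<in>{0..T}. \<bar>sample_moment N \<omega> t (2 * q) - limit_moment_at c t (2 * q)\<bar> \<le> 1)"
    using even unfolding moment_converges_def by auto
  show "with_high_probability M (\<lambda>N \<omega>. \<forall>t\<in>{0..T}. \<bar>sample_moment N \<omega> t (2 * q - 1) - limit_moment_at c t (2 * q - 1)\<bar> \<le> \<epsilon>)"
  proof (rule with_high_probability_mono[OF with_high_probability_conj[OF whp1 whp2]], intro always_eventually allI ballI impI, elim conjE)
    fix N \<omega> t assume t: "t \<in> {0..T}"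
      and 1: "\<forall>t\<in>{0..T}. (\<forall>s\<in>{0..t}. sample_moment N \<omega> s (2 * q) \<le> B + 1) \<longrightarrow>
        \<bar>sample_moment N \<omega> t (2 * q - 1) - limit_moment_at c t (2 * q - 1)\<bar> \<le> \<epsilon>"
      and 2: "\<forall>t\<in>{0..T}. \<bar>sample_moment N \<omega> t (2 * q) - limit_moment_at c t (2 * q)\<bar> \<le> 1"
    have "sample_moment N \<omega> s (2 * q) \<le> B + 1" if "s \<in> {0..t}" for s
    proof -
      have s: "s \<in> {0..T}" using that t by auto
      have "\<bar>sample_moment N \<omega> s (2 * q) - limit_moment_at c s (2 * q)\<bar> \<le> 1" using 2 s by blast
      moreover have "\<bar>limit_moment_at c s (2 * q)\<bar> \<le> B" using B(2) s by blast
      ultimately show ?thesis by linarith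
    qed
    then show "\<bar>sample_moment N \<omega> t (2 * q - 1) - limit_moment_at c t (2 * q - 1)\<bar> \<le> \<epsilon>" using 1 t by blast
  qed
qed

lemma zeroth_moment_converges: "moment_converges 0"
  unfolding moment_converges_def
proof (intro allI impI)
  fix \<epsilon> :: real assume "\<epsilon> > 0"
  show "with_high_probability M (\<lambda>N \<omega>. \<forall>t\<in>{0..T}. \<bar>sample_moment N \<omega> t 0 - limit_moment_at c t 0\<bar> \<le> \<epsilon>)"
  proof (rule with_high_probability_mono[OF with_high_probability_True])
    have "\<forall>\<^sub>F N in sequentially. N \<ge> (1::nat)" by (rule eventually_ge_at_top)
    then show "\<forall>\<^sub>F N in sequentially. \<forall>\<omega>\<in>space (M N). True \<longrightarrow> (\<forall>t\<in>{0..T}. \<bar>sample_moment N \<omega> t 0 - limit_moment_at c t 0\<bar> \<le> \<epsilon>)"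
      by eventually_elim (use \<open>\<epsilon> > 0\<close> in \<open>simp add: sample_moment_def emp_moment_def limit_moment_at_def\<close>)
  qed
qed

lemma all_moments_converge: "moment_converges p"
proof -
  have "\<forall>k<2 * q + 1. moment_converges k" for q
  proof (induction q)
    case 0
    then show ?case using zeroth_moment_converges by simp
  next
    case (Suc q)
    have lower: "moment_converges k" if "k < 2 * Suc q - 1" for k using Suc that by simp
    have even: "moment_converges (2 * Suc q)" by (rule even_moment_converges) (use lower in auto)
    have odd: "moment_converges (2 * Suc q - 1)" by (rule odd_moment_converges) (use lower even in auto)
    show ?case
    proof (intro allI impI)
      fix k assume "k < 2 * Suc q + 1"
      then consider "k < 2 * Suc q - 1" | "k = 2 * Suc q - 1" | "k = 2 * Suc q" by linarith
      then show "moment_converges k" using lower even odd by cases auto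
    qed
  qed
  from this[of p] show ?thesis by simp
qed

end

section \<open>A measure with prescribed limiting moments\<close>

lemma abs_power_truncation_error:
  fixes x L :: real
  assumes "L > 0"
  shows "\<bar>x ^ p - max (- L) (min L (x ^ p))\<bar> \<le> x ^ (2 * p) / L"
proof -
  define z where "z = x ^ p"
  have z2: "x ^ (2 * p) = z\<^sup>2" unfolding z_def by (simp add: power_mult[symmetric] mult.commute)
  have "\<bar>z - max (- L) (min L z)\<bar> \<le> z\<^sup>2 / L"
  proof (cases "\<bar>z\<bar> \<le> L")
    case True
    then have "max (- L) (min L z) = z" by (simp add: abs_le_iff max_def min_def)
    then show ?thesis using assms by simp
  next
    case False
    have "\<bar>z - max (- L) (min L z)\<bar> \<le> \<bar>z\<bar>" using assms by (auto simp: max_def min_def abs_if)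
    also have "\<dots> = \<bar>z\<bar> * 1" by simp
    also have "\<dots> \<le> \<bar>z\<bar> * (\<bar>z\<bar> / L)" using False assms by (intro mult_left_mono) auto
    also have "\<dots> = z\<^sup>2 / L" by (simp add: power2_eq_square abs_mult[symmetric])
    finally show ?thesis .
  qed
  then show ?thesis by (simp add: z2 z_def)
qed

lemma (in real_distribution) borel_measurable_continuous:
  fixes g :: "real \<Rightarrow> real"
  assumes "continuous_on UNIV g"
  shows "g \<in> borel_measurable M"
  using borel_measurable_continuous_onI[OF assms] by (subst measurable_cong_sets[OF events_eq_borel refl])

text \<open>
Second moments give tightness, and Helly's theorem a weak limit along a subsequence. Cutting \<open>x ^ p\<close>
off at level \<open>L\<close> costs at most \<open>\<integral>x. x ^ (2 * p) / L\<close>, uniformly along the sequence, so the moments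
pass to the limit.
\<close>
lemma moment_limit_exists:
  fixes \<nu> :: "nat \<Rightarrow> real measure" and m :: "nat \<Rightarrow> real"
  assumes \<nu>: "\<And>n. real_distribution (\<nu> n)" and int: "\<And>n p. integrable (\<nu> n) (\<lambda>x. x ^ p)"
    and lim: "\<And>p. (\<lambda>n. \<integral>x. x ^ p \<partial>\<nu> n) \<longlonglongrightarrow> m p"
  shows "\<exists>\<mu>. real_distribution \<mu> \<and> (\<forall>p. integrable \<mu> (\<lambda>x. x ^ p) \<and> (\<integral>x. x ^ p \<partial>\<mu>) = m p)"
proof -
  have bdd: "\<exists>C>0. \<forall>n. (\<integral>x. x ^ p \<partial>\<nu> n) \<le> C" for p
    using Bseq_def convergent_imp_Bseq[OF convergentI[OF lim[of p]]] by (metis abs_le_D1 real_norm_def)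
  have tight: "tight \<nu>"
    unfolding tight_def
  proof (intro conjI allI impI \<nu>)
    fix \<epsilon> :: real assume \<epsilon>: "\<epsilon> > 0"
    obtain C where C: "C > 0" "\<And>n. (\<integral>x. x ^ 2 \<partial>\<nu> n) \<le> C" using bdd[of 2] by blast
    define R where "R = sqrt (2 * C / \<epsilon>)"
    have R: "R > 0" "R\<^sup>2 = 2 * C / \<epsilon>" using C \<epsilon> by (auto simp: R_def)
    have "measure (\<nu> n) {-R<..R} > 1 - \<epsilon>" for n
    proof -
      interpret real_distribution "\<nu> n" by (rule \<nu>)
      have "prob {x \<in> space (\<nu> n). x ^ 2 \<ge> R\<^sup>2} \<le> (\<integral>x. x ^ 2 \<partial>\<nu> n) / R\<^sup>2"
        using int R(1) by (intro integral_Markov_inequality_measure[where A="{}"]) auto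
      also have "\<dots> \<le> C / R\<^sup>2" by (intro divide_right_mono C(2) zero_le_power2)
      also have "\<dots> = \<epsilon> / 2" using C \<epsilon> by (simp add: R)
      finally have p: "prob {x \<in> space (\<nu> n). x ^ 2 \<ge> R\<^sup>2} \<le> \<epsilon> / 2" .
      have "1 - prob {-R<..R} = prob (space (\<nu> n) - {-R<..R})" by (intro prob_compl[symmetric]) auto
      also have "\<dots> \<le> prob {x \<in> space (\<nu> n). x ^ 2 \<ge> R\<^sup>2}"
      proof (rule finite_measure_mono)
        show "space (\<nu> n) - {-R<..R} \<subseteq> {x \<in> space (\<nu> n). x ^ 2 \<ge> R\<^sup>2}"
          using R(1) by (auto simp: abs_le_square_iff[symmetric])
      qed simp
      finally show ?thesis using p \<epsilon> by linarith
    qed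
    then show "\<exists>a b. a < b \<and> (\<forall>n. 1 - \<epsilon> < measure (\<nu> n) {a<..b})" using R(1) by (intro exI[of _ "-R"] exI[of _ R]) auto
  qed
  obtain r \<mu> where r: "strict_mono r" and \<mu>: "real_distribution \<mu>" and wc: "weak_conv_m (\<nu> \<circ> id \<circ> r) \<mu>"
    using tight_imp_convergent_subsubsequence[OF tight strict_mono_id] by blast
  interpret \<mu>: real_distribution \<mu> by (rule \<mu>)
  have wc_int: "(\<lambda>n. \<integral>x. g x \<partial>\<nu> (r n)) \<longlonglongrightarrow> (\<integral>x. g x \<partial>\<mu>)"
    if "\<And>x. isCont g x" "\<And>x. \<bar>g x\<bar> \<le> B" for g :: "real \<Rightarrow> real" and B
    using weak_conv_imp_integral_bdd_continuous_conv[of "\<nu> \<circ> id \<circ> r" \<mu> g B] \<nu> \<mu> wc that by (simp add: o_def)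
  have bounded_int: "integrable \<mu> g" if "continuous_on UNIV g" "\<And>x. \<bar>g x\<bar> \<le> B" for g :: "real \<Rightarrow> real" and B
    using that by (intro \<mu>.integrable_const_bound[of _ B] \<mu>.borel_measurable_continuous) auto
  have even_int: "integrable \<mu> (\<lambda>x. x ^ (2 * p))" for p
  proof (rule integrableI_bounded)
    obtain C where C: "C > 0" "\<And>n. (\<integral>x. x ^ (2 * p) \<partial>\<nu> n) \<le> C" using bdd by blast
    define h where "h k x = min (real k) (x ^ (2 * p))" for k and x :: real
    have h: "continuous_on UNIV (h k)" "0 \<le> h k x" "h k x \<le> k" "h k x \<le> x ^ (2 * p)" for k x
      by (auto simp: h_def power_mult intro!: continuous_intros)
    have h_abs: "\<bar>h k x\<bar> \<le> real k" for k x using h(2,3)[of k x] by simp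
    have h_le: "(\<integral>x. h k x \<partial>\<mu>) \<le> C" for k
    proof (rule LIMSEQ_le_const2)
      show "(\<lambda>n. \<integral>x. h k x \<partial>\<nu> (r n)) \<longlonglongrightarrow> (\<integral>x. h k x \<partial>\<mu>)"
      proof (rule wc_int[of "h k" "real k"])
        show "isCont (h k) x" for x using h(1) by (simp add: continuous_on_eq_continuous_at)
      qed (rule h_abs)
      show "\<exists>n0. \<forall>n\<ge>n0. (\<integral>x. h k x \<partial>\<nu> (r n)) \<le> C"
      proof (intro exI allI impI)
        fix n
        interpret nu: real_distribution "\<nu> (r n)" by (rule \<nu>)
        have "integrable (\<nu> (r n)) (h k)"
          using h(1) h_abs by (intro nu.integrable_const_bound[of _ "real k"] nu.borel_measurable_continuous) auto
        then have "(\<integral>x. h k x \<partial>\<nu> (r n)) \<le> (\<integral>x. x ^ (2 * p) \<partial>\<nu> (r n))"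
          using int h by (intro integral_mono) auto
        then show "(\<integral>x. h k x \<partial>\<nu> (r n)) \<le> C" using C(2)[of "r n"] by linarith
      qed
    qed
    have "(\<lambda>k. \<integral>\<^sup>+x. ennreal (h k x) \<partial>\<mu>) \<longlonglongrightarrow> (\<integral>\<^sup>+x. ennreal (x ^ (2 * p)) \<partial>\<mu>)"
    proof (rule nn_integral_LIMSEQ)
      show "incseq (\<lambda>k x. ennreal (h k x))"
        by (auto simp: incseq_def le_fun_def h_def intro!: ennreal_leI)
      show "(\<lambda>x. ennreal (h k x)) \<in> borel_measurable \<mu>" for k
        using \<mu>.borel_measurable_continuous[OF h(1)] by measurable
      show "(\<lambda>k. ennreal (h k x)) \<longlonglongrightarrow> ennreal (x ^ (2 * p))" for x
      proof (rule tendsto_eventually)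
        show "\<forall>\<^sub>F k in sequentially. ennreal (h k x) = ennreal (x ^ (2 * p))"
          using eventually_ge_at_top[of "nat \<lceil>x ^ (2 * p)\<rceil>"]
        proof eventually_elim
          case (elim k)
          then have "x ^ (2 * p) \<le> real k" by linarith
          then show ?case by (simp add: h_def min_def)
        qed
      qed
    qed
    moreover have "(\<integral>\<^sup>+x. ennreal (h k x) \<partial>\<mu>) \<le> ennreal C" for k
    proof -
      have "integrable \<mu> (h k)" by (rule bounded_int[of "h k" "real k", OF h(1) h_abs])
      then have "(\<integral>\<^sup>+x. ennreal (h k x) \<partial>\<mu>) = ennreal (\<integral>x. h k x \<partial>\<mu>)" using h by (intro nn_integral_eq_integral) auto
      then show ?thesis using h_le[of k] by (simp add: ennreal_leI)
    qed
    ultimately have "(\<integral>\<^sup>+x. ennreal (x ^ (2 * p)) \<partial>\<mu>) \<le> ennreal C" by (intro LIMSEQ_le_const2) auto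
    then show "(\<integral>\<^sup>+x. ennreal (norm (x ^ (2 * p))) \<partial>\<mu>) < \<infinity>"
      by (simp add: power_mult le_less_trans)
  qed simp
  have all_int: "integrable \<mu> (\<lambda>x. x ^ p)" for p
  proof (rule Bochner_Integration.integrable_bound[of _ "\<lambda>x. 1 + x ^ (2 * p)"])
    show "integrable \<mu> (\<lambda>x. 1 + x ^ (2 * p))" using even_int by simp
    show "AE x in \<mu>. norm (x ^ p) \<le> norm (1 + x ^ (2 * p))"
    proof (rule AE_I2)
      fix x :: real
      have "0 \<le> (\<bar>x ^ p\<bar> - 1)\<^sup>2" by simp
      then have "2 * \<bar>x ^ p\<bar> \<le> 1 + (x ^ p)\<^sup>2" by (simp add: power2_eq_square algebra_simps)
      also have "(x ^ p)\<^sup>2 = x ^ (2 * p)" by (simp add: power_mult[symmetric] mult.commute)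
      finally show "norm (x ^ p) \<le> norm (1 + x ^ (2 * p))" by (simp add: abs_if split: if_splits)
    qed
  qed simp
  have "(\<integral>x. x ^ p \<partial>\<mu>) = m p" for p
  proof (rule ccontr)
    assume ne: "(\<integral>x. x ^ p \<partial>\<mu>) \<noteq> m p"
    define d where "d = \<bar>(\<integral>x. x ^ p \<partial>\<mu>) - m p\<bar>"
    have d: "d > 0" using ne by (simp add: d_def)
    obtain C0 where C0: "C0 > 0" "\<And>n. (\<integral>x. x ^ (2 * p) \<partial>\<nu> n) \<le> C0" using bdd by blast
    define C where "C = max C0 (\<integral>x. x ^ (2 * p) \<partial>\<mu>)"
    define L where "L = 4 * C / d"
    have C: "C > 0" using C0 by (auto simp: C_def)
    then have L: "L > 0" "C / L = d / 4" using d by (auto simp: L_def)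
    define g where "g x = max (- L) (min L (x ^ p))" for x :: real
    have g: "continuous_on UNIV g" "\<And>x. \<bar>g x\<bar> \<le> L" using L by (auto simp: g_def intro!: continuous_intros)
    have err: "\<bar>(\<integral>x. x ^ p \<partial>\<rho>) - (\<integral>x. g x \<partial>\<rho>)\<bar> \<le> d / 4"
      if \<rho>: "real_distribution \<rho>" "\<And>p. integrable \<rho> (\<lambda>x. x ^ p)" "(\<integral>x. x ^ (2 * p) \<partial>\<rho>) \<le> C" for \<rho> :: "real measure"
    proof -
      interpret rho: real_distribution \<rho> by (rule \<rho>(1))
      have gi: "integrable \<rho> g"
        using g by (intro rho.integrable_const_bound[of _ L] rho.borel_measurable_continuous) auto
      have "\<bar>(\<integral>x. x ^ p \<partial>\<rho>) - (\<integral>x. g x \<partial>\<rho>)\<bar> = \<bar>\<integral>x. x ^ p - g x \<partial>\<rho>\<bar>"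
        using \<rho>(2) gi by simp
      also have "\<dots> \<le> (\<integral>x. \<bar>x ^ p - g x\<bar> \<partial>\<rho>)" by (rule integral_abs_bound)
      also have "\<dots> \<le> (\<integral>x. x ^ (2 * p) / L \<partial>\<rho>)"
        using \<rho>(2) gi abs_power_truncation_error[OF L(1)] unfolding g_def by (intro integral_mono) auto
      also have "\<dots> \<le> C / L" using \<rho>(3) L by (simp add: divide_right_mono)
      finally show ?thesis using L by simp
    qed
    have lim1: "(\<lambda>n. (\<integral>x. x ^ p \<partial>\<nu> (r n)) - (\<integral>x. g x \<partial>\<nu> (r n))) \<longlonglongrightarrow> m p - (\<integral>x. g x \<partial>\<mu>)"
      using LIMSEQ_subseq_LIMSEQ[OF lim r] wc_int[of g L] g
      by (intro tendsto_diff) (auto simp: o_def continuous_on_eq_continuous_at)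
    have "\<bar>m p - (\<integral>x. g x \<partial>\<mu>)\<bar> \<le> d / 4"
    proof (rule LIMSEQ_le_const2[OF tendsto_rabs[OF lim1]])
      show "\<exists>n0. \<forall>n\<ge>n0. \<bar>(\<integral>x. x ^ p \<partial>\<nu> (r n)) - (\<integral>x. g x \<partial>\<nu> (r n))\<bar> \<le> d / 4"
        using C0(2) by (intro exI allI impI err \<nu> int) (auto simp: C_def max_def intro: order_trans)
    qed
    moreover have "\<bar>(\<integral>x. x ^ p \<partial>\<mu>) - (\<integral>x. g x \<partial>\<mu>)\<bar> \<le> d / 4"
      by (rule err[OF \<mu> all_int]) (simp add: C_def)
    moreover have "d \<le> \<bar>m p - (\<integral>x. g x \<partial>\<mu>)\<bar> + \<bar>(\<integral>x. x ^ p \<partial>\<mu>) - (\<integral>x. g x \<partial>\<mu>)\<bar>"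
      unfolding d_def by linarith
    ultimately show False using d by linarith
  qed
  then show ?thesis using \<mu> all_int by blast
qed

section \<open>Polynomial test functions\<close>

lemma poly2_eq_sum: "poly2 f t x = (\<Sum>k\<le>degree f. poly (coeff f k) t * x ^ k)"
  by (simp add: poly2_def poly_altdef[of f] poly_sum poly_mult poly_power)

lemma poly2_dx_eq_sum:
  fixes x :: real
  shows "poly2 (dx f) t x = (\<Sum>k\<le>degree f. poly (coeff f k) t * (k * x ^ (k - 1)))"
proof (rule DERIV_unique[OF has_derivative_poly2_x])
  show "((\<lambda>x. poly2 f t x) has_real_derivative (\<Sum>k\<le>degree f. poly (coeff f k) t * (k * x ^ (k - 1)))) (at x)"
    unfolding poly2_eq_sum by (intro DERIV_sum DERIV_cmult) (use DERIV_pow[of _ x UNIV] in simp)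
qed

lemma poly2_dxdx_eq_sum:
  fixes x :: real
  shows "poly2 (dx (dx f)) t x = (\<Sum>k\<le>degree f. poly (coeff f k) t * (k * real (k - 1) * x ^ (k - 2)))"
proof (rule DERIV_unique[OF has_derivative_poly2_x])
  have "((\<lambda>x. real k * x ^ (k - 1)) has_real_derivative k * real (k - 1) * x ^ (k - 2)) (at x)" for k
    using DERIV_cmult[OF DERIV_pow[of "k - 1" x UNIV], of "real k"] by (simp add: mult.assoc numeral_2_eq_2)
  moreover have "poly2 (dx f) t = (\<lambda>x::real. \<Sum>k\<le>degree f. poly (coeff f k) t * (k * x ^ (k - 1)))"
    by (rule ext) (rule poly2_dx_eq_sum)
  ultimately show "((\<lambda>x. poly2 (dx f) t x) has_real_derivative (\<Sum>k\<le>degree f. poly (coeff f k) t * (k * real (k - 1) * x ^ (k - 2)))) (at x)"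
    by (simp only:) (intro DERIV_sum DERIV_cmult)
qed

lemma poly2_dt_eq_sum: "poly2 (dt f) t x = (\<Sum>k\<le>degree f. poly (pderiv (coeff f k)) t * x ^ k)"
proof (rule DERIV_unique[OF has_derivative_poly2_t])
  show "((\<lambda>t. poly2 f t x) has_real_derivative (\<Sum>k\<le>degree f. poly (pderiv (coeff f k)) t * x ^ k)) (at t)"
    unfolding poly2_eq_sum by (intro DERIV_sum DERIV_cmult_right poly_DERIV)
qed

lemma diff_quotient_eq_sum:
  fixes x y :: real
  shows "diff_quotient f t x y = (\<Sum>k\<le>degree f. poly (coeff f k) t * (k * (\<Sum>j<k - 1. x ^ j * y ^ (k - 2 - j))))"
proof (cases "x = y")
  case True
  have "(\<Sum>j<k - 1. y ^ j * y ^ (k - 2 - j)) = real (k - 1) * y ^ (k - 2)" for k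
  proof -
    have "(\<Sum>j<k - 1. y ^ j * y ^ (k - 2 - j)) = (\<Sum>j<k - 1. y ^ (k - 2))"
      by (intro sum.cong refl) (simp add: power_add[symmetric])
    then show ?thesis by simp
  qed
  then show ?thesis using True by (simp add: diff_quotient_def poly2_dxdx_eq_sum mult.assoc)
next
  case False
  have quot: "(k * x ^ (k - 1) - k * y ^ (k - 1)) / (x - y) = k * (\<Sum>j<k - 1. x ^ j * y ^ (k - 2 - j))" for k :: nat
  proof -
    have "x ^ (k - 1) - y ^ (k - 1) = (x - y) * (\<Sum>j<k - 1. y ^ (k - 1 - Suc j) * x ^ j)"
      by (rule power_diff_sumr2)
    also have "(\<Sum>j<k - 1. y ^ (k - 1 - Suc j) * x ^ j) = (\<Sum>j<k - 1. x ^ j * y ^ (k - 2 - j))"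
      by (intro sum.cong refl) (simp add: mult.commute numeral_2_eq_2)
    finally show ?thesis using False by (simp add: right_diff_distrib[symmetric] mult.left_commute)
  qed
  have "poly (coeff f k) t * (k * (\<Sum>j<k - 1. x ^ j * y ^ (k - 2 - j)))
     = (poly (coeff f k) t * (k * x ^ (k - 1)) - poly (coeff f k) t * (k * y ^ (k - 1))) / (x - y)" for k
    unfolding quot[symmetric] by (simp only: right_diff_distrib times_divide_eq_right)
  then show ?thesis
    using False by (simp add: diff_quotient_def poly2_dx_eq_sum sum_subtractf[symmetric] sum_divide_distrib)
qed

lemma poly2_constant_coefficients: "poly2 (map_poly (\<lambda>a. [:a:]) p) t x = poly p x"
  by (induction p) (auto simp: map_poly_pCons)

lemma integral_sum_powers:
  fixes a :: "'i \<Rightarrow> real"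
  assumes "\<And>p. integrable \<mu> (\<lambda>x::real. x ^ p)"
  shows "(\<integral>x. (\<Sum>i\<in>I. a i * x ^ e i) \<partial>\<mu>) = (\<Sum>i\<in>I. a i * (\<integral>x. x ^ e i \<partial>\<mu>))"
    and "integrable \<mu> (\<lambda>x. \<Sum>i\<in>I. a i * x ^ e i)"
  using assms by (simp_all add: Bochner_Integration.integral_sum)

lemma integral_poly2:
  assumes "\<And>p. integrable \<mu> (\<lambda>x::real. x ^ p)"
  shows "(\<integral>x. poly2 f t x \<partial>\<mu>) = (\<Sum>k\<le>degree f. poly (coeff f k) t * (\<integral>x. x ^ k \<partial>\<mu>))"
  unfolding poly2_eq_sum by (rule integral_sum_powers[OF assms])

text \<open>
This reads the right-hand side of the evolution equation as the moment hierarchy: the double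
integral of the difference quotient of the derivative of \<open>x ^ k\<close> is the quadratic part of the drift.
\<close>
lemma integral_generator_poly2:
  assumes int: "\<And>p. integrable \<mu> (\<lambda>x::real. x ^ p)"
  defines "m \<equiv> \<lambda>p. \<integral>x. x ^ p \<partial>\<mu>"
  shows "c / 2 * (\<integral>y. (\<integral>x. diff_quotient f t x y \<partial>\<mu>) \<partial>\<mu>) + (\<integral>x. 1 / 2 * poly2 (dx (dx f)) t x + poly2 (dt f) t x \<partial>\<mu>)
    = (\<Sum>k\<le>degree f. poly (pderiv (coeff f k)) t * m k + poly (coeff f k) t * moment_drift c 1 k m)"
proof -
  define a where "a k = poly (coeff f k) t" for k
  have 1: "(\<integral>x. diff_quotient f t x y \<partial>\<mu>) = (\<Sum>k\<le>degree f. \<Sum>j<k - 1. (a k * k * m j) * y ^ (k - 2 - j))" for y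
  proof -
    have "diff_quotient f t x y = (\<Sum>k\<le>degree f. \<Sum>j<k - 1. (a k * k * y ^ (k - 2 - j)) * x ^ j)" for x
      by (simp add: diff_quotient_eq_sum a_def sum_distrib_left mult_ac)
    then have "(\<integral>x. diff_quotient f t x y \<partial>\<mu>) = (\<Sum>k\<le>degree f. \<integral>x. (\<Sum>j<k - 1. (a k * k * y ^ (k - 2 - j)) * x ^ j) \<partial>\<mu>)"
      by (simp only:) (rule Bochner_Integration.integral_sum, rule integral_sum_powers(2)[OF int])
    also have "\<dots> = (\<Sum>k\<le>degree f. \<Sum>j<k - 1. (a k * k * m j) * y ^ (k - 2 - j))"
      unfolding integral_sum_powers(1)[OF int] m_def by (simp add: mult_ac)
    finally show ?thesis .
  qed
  have 2: "(\<integral>y. (\<integral>x. diff_quotient f t x y \<partial>\<mu>) \<partial>\<mu>) = (\<Sum>k\<le>degree f. a k * k * (\<Sum>j<k - 1. m j * m (k - 2 - j)))"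
  proof -
    have "(\<integral>y. (\<integral>x. diff_quotient f t x y \<partial>\<mu>) \<partial>\<mu>) = (\<Sum>k\<le>degree f. \<integral>y. (\<Sum>j<k - 1. (a k * k * m j) * y ^ (k - 2 - j)) \<partial>\<mu>)"
      unfolding 1 by (rule Bochner_Integration.integral_sum) (rule integral_sum_powers(2)[OF int])
    also have "\<dots> = (\<Sum>k\<le>degree f. a k * k * (\<Sum>j<k - 1. m j * m (k - 2 - j)))"
      unfolding integral_sum_powers(1)[OF int] m_def by (simp add: sum_distrib_left mult_ac)
    finally show ?thesis .
  qed
  have 3: "(\<integral>x. 1 / 2 * poly2 (dx (dx f)) t x + poly2 (dt f) t x \<partial>\<mu>)
     = (\<Sum>k\<le>degree f. a k * (k * real (k - 1)) / 2 * m (k - 2)) + (\<Sum>k\<le>degree f. poly (pderiv (coeff f k)) t * m k)"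
  proof -
    have "1 / 2 * poly2 (dx (dx f)) t x + poly2 (dt f) t x
       = (\<Sum>k\<le>degree f. (a k * (k * real (k - 1)) / 2) * x ^ (k - 2)) + (\<Sum>k\<le>degree f. poly (pderiv (coeff f k)) t * x ^ k)" for x
      by (simp add: poly2_dxdx_eq_sum poly2_dt_eq_sum a_def sum_divide_distrib mult_ac)
    then have "(\<integral>x. 1 / 2 * poly2 (dx (dx f)) t x + poly2 (dt f) t x \<partial>\<mu>)
       = (\<integral>x. (\<Sum>k\<le>degree f. (a k * (k * real (k - 1)) / 2) * x ^ (k - 2)) \<partial>\<mu>)
         + (\<integral>x. (\<Sum>k\<le>degree f. poly (pderiv (coeff f k)) t * x ^ k) \<partial>\<mu>)"
      by (simp only:) (rule Bochner_Integration.integral_add; rule integral_sum_powers(2)[OF int])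
    then show ?thesis unfolding integral_sum_powers(1)[OF int] m_def .
  qed
  show ?thesis
    unfolding 2 3 moment_drift_def a_def[symmetric]
    by (simp add: sum.distrib sum_distrib_left algebra_simps)
qed

lemma empirical_measure_real_distribution:
  assumes "N \<ge> 1"
  shows "real_distribution (empirical_measure N x)"
proof -
  interpret prob_space "uniform_count_measure {1..N}"
    using assms by (intro prob_space_uniform_count_measure) auto
  show ?thesis unfolding empirical_measure_def
    by (intro real_distribution.intro prob_space_distr real_distribution_axioms.intro)
       (auto simp: uniform_count_measure_def measurable_point_measure_eq1)
qed

lemma integrable_empirical_measure:
  assumes [measurable]: "g \<in> borel_measurable borel"
  shows "integrable (empirical_measure N x) (g :: real \<Rightarrow> real)"
  unfolding empirical_measure_def
  by (subst integrable_distr_eq)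
     (auto simp: uniform_count_measure_def measurable_point_measure_eq1 integrable_point_measure_finite)

lemma emp_moment_eq_integral:
  assumes "N \<ge> 1"
  shows "(\<integral>y. y ^ p \<partial>empirical_measure N x) = emp_moment N x p"
  using integral_empirical_measure[OF assms, of "\<lambda>y. y ^ p"] by (simp add: emp_moment_def)

context dyson_sequence
begin

text \<open>
An event of positive probability is not empty. So for every \<open>r\<close> there is a single configuration at
time \<open>T\<close> whose first \<open>r\<close> moments are within \<open>1 / (r + 1)\<close> of the limits.
\<close>
lemma limit_law_exists:
  "\<exists>\<nu>. real_distribution \<nu> \<and> (\<forall>p. integrable \<nu> (\<lambda>x. x ^ p) \<and> (\<integral>x. x ^ p \<partial>\<nu>) = limit_moment_at c T p)"
proof -
  have "\<exists>N \<omega>. N \<ge> 1 \<and> (\<forall>p<r. \<bar>sample_moment N \<omega> T p - limit_moment_at c T p\<bar> \<le> 1 / real (Suc r))" for r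
  proof -
    have "with_high_probability M (\<lambda>N \<omega>. \<forall>p<r. \<forall>t\<in>{0..T}. \<bar>sample_moment N \<omega> t p - limit_moment_at c t p\<bar> \<le> 1 / real (Suc r))"
      using all_moments_converge unfolding moment_converges_def by (intro with_high_probability_all_less) auto
    moreover have "(1/2::real) > 0" by simp
    ultimately have "\<forall>\<^sub>F N in sequentially. \<exists>B\<in>sets (M N). measure (M N) B \<le> 1 / 2 \<and>
        (\<forall>\<omega>\<in>space (M N) - B. \<forall>p<r. \<forall>t\<in>{0..T}. \<bar>sample_moment N \<omega> t p - limit_moment_at c t p\<bar> \<le> 1 / real (Suc r))"
      unfolding with_high_probability_def by blast
    then have "\<forall>\<^sub>F N in sequentially. N \<ge> 1 \<and> (\<exists>B\<in>sets (M N). measure (M N) B \<le> 1 / 2 \<and>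
        (\<forall>\<omega>\<in>space (M N) - B. \<forall>p<r. \<forall>t\<in>{0..T}. \<bar>sample_moment N \<omega> t p - limit_moment_at c t p\<bar> \<le> 1 / real (Suc r)))"
      by (intro eventually_conj eventually_ge_at_top)
    from eventually_happens'[OF sequentially_bot this] obtain N B where N: "N \<ge> 1" and B: "B \<in> sets (M N)" "measure (M N) B \<le> 1 / 2"
      "\<forall>\<omega>\<in>space (M N) - B. \<forall>p<r. \<forall>t\<in>{0..T}. \<bar>sample_moment N \<omega> t p - limit_moment_at c t p\<bar> \<le> 1 / real (Suc r)"
      by (elim exE conjE bexE) (rule that)
    interpret prob_space "M N" using dyson[OF N] by (simp add: dyson_brownian_motion_def)
    have "B \<noteq> space (M N)" using B(2) prob_space by auto
    then obtain \<omega> where \<omega>: "\<omega> \<in> space (M N) - B" using sets.sets_into_space[OF B(1)] by blast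
    have "T \<in> {0..T}" using T by simp
    then show ?thesis using B(3) \<omega> N by blast
  qed
  then obtain N \<omega> where N: "\<And>r. N r \<ge> (1::nat)"
    and close: "\<And>r p. p < r \<Longrightarrow> \<bar>sample_moment (N r) (\<omega> r) T p - limit_moment_at c T p\<bar> \<le> 1 / real (Suc r)" by metis
  define \<nu> where "\<nu> r = empirical_measure (N r) (\<lambda>i. lam (N r) i T (\<omega> r))" for r
  show ?thesis
  proof (rule moment_limit_exists)
    show "real_distribution (\<nu> r)" for r unfolding \<nu>_def by (rule empirical_measure_real_distribution[OF N])
    show "integrable (\<nu> r) (\<lambda>x. x ^ p)" for r p unfolding \<nu>_def by (rule integrable_empirical_measure) simp
    show "(\<lambda>r. \<integral>x. x ^ p \<partial>\<nu> r) \<longlonglongrightarrow> limit_moment_at c T p" for p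
    proof (rule LIM_zero_cancel, rule Lim_null_comparison)
      show "\<forall>\<^sub>F r in sequentially. norm ((\<integral>x. x ^ p \<partial>\<nu> r) - limit_moment_at c T p) \<le> 1 / real (Suc r)"
        using eventually_gt_at_top[of p] 
      proof eventually_elim
        case (elim r)
        then show ?case using close[OF elim] by (simp add: \<nu>_def emp_moment_eq_integral[OF N] sample_moment_def)
      qed
      show "(\<lambda>r. 1 / real (Suc r)) \<longlonglongrightarrow> 0" by (rule LIMSEQ_Suc[OF lim_const_over_n])
    qed
  qed
qed

text \<open>
The limiting moments scale like \<open>t ^ (p / 2)\<close>, so one law and its dilations are enough.
\<close>
lemma limit_process_exists:
  "\<exists>\<mu>. \<forall>t\<in>{0..T}. real_distribution (\<mu> t) \<and>
     (\<forall>p. integrable (\<mu> t) (\<lambda>x. x ^ p) \<and> (\<integral>x. x ^ p \<partial>\<mu> t) = limit_moment_at c t p)"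
proof -
  obtain \<nu> where \<nu>: "real_distribution \<nu>" and int: "\<And>p. integrable \<nu> (\<lambda>x. x ^ p)"
    and mom: "\<And>p. (\<integral>x. x ^ p \<partial>\<nu>) = limit_moment_at c T p" using limit_law_exists by blast
  interpret \<nu>: real_distribution \<nu> by (rule \<nu>)
  define \<mu> where "\<mu> t = distr \<nu> borel (\<lambda>x. sqrt (t / T) * x)" for t
  have [measurable]: "(\<lambda>x. sqrt (t / T) * x) \<in> borel_measurable \<nu>" for t
    by (intro \<nu>.borel_measurable_continuous continuous_intros)
  have "real_distribution (\<mu> t)" for t unfolding \<mu>_def by (rule \<nu>.real_distribution_distr) measurable
  moreover have "integrable (\<mu> t) (\<lambda>x. x ^ p)" for t p
    unfolding \<mu>_def using int by (subst integrable_distr_eq) (auto simp: power_mult_distrib)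
  moreover have "(\<integral>x. x ^ p \<partial>\<mu> t) = limit_moment_at c t p" if t: "t \<in> {0..T}" for t p
  proof -
    have "(\<integral>x. x ^ p \<partial>\<mu> t) = sqrt (t / T) ^ p * limit_moment_at c T p"
      unfolding \<mu>_def by (subst integral_distr) (auto simp: power_mult_distrib mom)
    also have "\<dots> = limit_moment_at c t p"
    proof (cases "even p")
      case True
      then obtain q where q: "p = 2 * q" by auto
      have "sqrt (t / T) ^ p = (t / T) ^ q" using t T unfolding q power_mult by simp
      then show ?thesis using T by (simp add: limit_moment_at_def q power_divide)
    qed (simp add: limit_moment_at_def limit_moment_odd)
    finally show ?thesis .
  qed
  ultimately show ?thesis by blast
qed

lemma integral_poly2_empirical:
  assumes "N \<ge> 1"
  shows "(\<integral>x. poly2 f t x \<partial>empirical_measure N (\<lambda>i. lam N i t \<omega>)) = (\<Sum>k\<le>degree f. poly (coeff f k) t * sample_moment N \<omega> t k)"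
  unfolding sample_moment_def emp_moment_eq_integral[OF assms, symmetric]
  by (rule integral_poly2) (intro integrable_empirical_measure borel_measurable_power measurable_ident_sets refl)

lemma random_element_poly2:
  assumes N: "N \<ge> 1"
  shows "random_element_C T (M N) (\<lambda>\<omega> t. \<integral>x. poly2 f t x \<partial>empirical_measure N (\<lambda>i. lam N i t \<omega>))"
  unfolding random_element_C_def integral_poly2_empirical[OF N]
proof (intro conjI ballI)
  fix \<omega> assume \<omega>: "\<omega> \<in> space (M N)"
  show "continuous_on {0..T} (\<lambda>t. \<Sum>k\<le>degree f. poly (coeff f k) t * sample_moment N \<omega> t k)"
    by (intro continuous_intros continuous_on_subset[OF continuous_sample_moment[OF N \<omega>]]) auto
next
  fix t assume t: "t \<in> {0..T}"
  have b: "independent_brownian_motions (M N) N (b N)" using dyson[OF N] by (simp add: dyson_brownian_motion_def)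
  have "lam N i t \<in> borel_measurable (M N)" if "i \<in> {1..N}" for i
    using dyson[OF N] that t
    by (intro measurable_from_subalg[OF subalgebra_augmented_filtration[OF b, of t]]) (auto simp: dyson_brownian_motion_def)
  then show "(\<lambda>\<omega>. \<Sum>k\<le>degree f. poly (coeff f k) t * sample_moment N \<omega> t k) \<in> borel_measurable (M N)"
    unfolding sample_moment_def emp_moment_def
    by (intro borel_measurable_sum borel_measurable_times borel_measurable_divide borel_measurable_power borel_measurable_const) auto
qed

lemma poly2_converges:
  assumes \<mu>: "\<And>t p. t \<in> {0..T} \<Longrightarrow> integrable (\<mu> t) (\<lambda>x. x ^ p)"
    "\<And>t p. t \<in> {0..T} \<Longrightarrow> (\<integral>x. x ^ p \<partial>\<mu> t) = limit_moment_at c t p"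
  shows "converges_in_probability_C T M
         (\<lambda>N \<omega> t. \<integral>x. poly2 f t x \<partial>empirical_measure N (\<lambda>i. lam N i t \<omega>))
         (\<lambda>t. \<integral>x. poly2 f t x \<partial>\<mu> t)"
proof -
  define X where "X N \<omega> t = (\<integral>x. poly2 f t x \<partial>empirical_measure N (\<lambda>i. lam N i t \<omega>))" for N \<omega> t
  define x where "x t = (\<integral>x. poly2 f t x \<partial>\<mu> t)" for t
  have x: "x t = (\<Sum>k\<le>degree f. poly (coeff f k) t * limit_moment_at c t k)" if "t \<in> {0..T}" for t
    unfolding x_def using integral_poly2[of "\<mu> t" f t] \<mu> that by simp
  have x_cont: "continuous_on {0..T} x"
    by (subst continuous_on_cong[OF refl x]) (auto intro!: continuous_intros continuous_on_limit_moment_at)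
  have "(\<lambda>N. measure (M N) {\<omega> \<in> space (M N). sup_norm T (\<lambda>t. X N \<omega> t - x t) \<ge> \<epsilon>}) \<longlonglongrightarrow> 0"
    if \<epsilon>: "\<epsilon> > 0" for \<epsilon>
  proof -
    have "continuous_on {0..T} (\<lambda>t. \<Sum>k\<le>degree f. \<bar>poly (coeff f k) t\<bar>)" by (intro continuous_intros)
    from compact_imp_bounded[OF compact_continuous_image[OF this compact_Icc]]
    obtain D where D: "\<And>t. t \<in> {0..T} \<Longrightarrow> \<bar>\<Sum>k\<le>degree f. \<bar>poly (coeff f k) t\<bar>\<bar> \<le> D"
      unfolding bounded_iff real_norm_def by blast
    then have "D \<ge> 0" using T by (meson abs_ge_zero atLeastAtMost_iff less_imp_le order_refl order_trans)
    define E where "E = D + 1"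
    define \<delta> where "\<delta> = \<epsilon> / 2 / E"
    have \<delta>: "\<delta> > 0" "D * \<delta> < \<epsilon>"
    proof -
      have E: "E > 0" "D \<le> E" using \<open>D \<ge> 0\<close> by (simp_all add: E_def)
      show "\<delta> > 0" using \<epsilon> E by (simp add: \<delta>_def)
      then have "D * \<delta> \<le> E * \<delta>" using E by (simp add: mult_right_mono)
      also have "\<dots> = \<epsilon> / 2" using E by (simp add: \<delta>_def)
      finally show "D * \<delta> < \<epsilon>" using \<epsilon> by simp
    qed
    have whp: "with_high_probability M (\<lambda>N \<omega>. \<forall>k<Suc (degree f). \<forall>t\<in>{0..T}. \<bar>sample_moment N \<omega> t k - limit_moment_at c t k\<bar> \<le> \<delta>)"
      using all_moments_converge \<delta>(1) unfolding moment_converges_def by (intro with_high_probability_all_less) auto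
    show ?thesis
    proof (rule tendstoI)
      fix \<eta> :: real assume \<eta>: "\<eta> > 0"
      then have "\<eta> / 2 > 0" by simp
      then have "\<forall>\<^sub>F N in sequentially. \<exists>B\<in>sets (M N). measure (M N) B \<le> \<eta> / 2 \<and>
         (\<forall>\<omega>\<in>space (M N) - B. \<forall>k<Suc (degree f). \<forall>t\<in>{0..T}. \<bar>sample_moment N \<omega> t k - limit_moment_at c t k\<bar> \<le> \<delta>)"
        using whp unfolding with_high_probability_def by blast
      moreover have "\<forall>\<^sub>F N in sequentially. N \<ge> (1::nat)" by (rule eventually_ge_at_top)
      ultimately show "\<forall>\<^sub>F N in sequentially. dist (measure (M N) {\<omega> \<in> space (M N). sup_norm T (\<lambda>t. X N \<omega> t - x t) \<ge> \<epsilon>}) 0 < \<eta>"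
      proof eventually_elim
        case (elim N)
        then obtain B where B: "B \<in> sets (M N)" "measure (M N) B \<le> \<eta> / 2"
          "\<forall>\<omega>\<in>space (M N) - B. \<forall>k<Suc (degree f). \<forall>t\<in>{0..T}. \<bar>sample_moment N \<omega> t k - limit_moment_at c t k\<bar> \<le> \<delta>" by blast
        interpret prob_space "M N" using dyson[OF elim(2)] by (simp add: dyson_brownian_motion_def)
        have "{\<omega> \<in> space (M N). sup_norm T (\<lambda>t. X N \<omega> t - x t) \<ge> \<epsilon>} \<subseteq> B"
        proof (rule subsetI, rule ccontr)
          fix \<omega> assume \<omega>: "\<omega> \<in> {\<omega> \<in> space (M N). sup_norm T (\<lambda>t. X N \<omega> t - x t) \<ge> \<epsilon>}" "\<omega> \<notin> B"
          have "\<bar>X N \<omega> t - x t\<bar> \<le> D * \<delta>" if t: "t \<in> {0..T}" for t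
          proof -
            have "X N \<omega> t - x t = (\<Sum>k\<le>degree f. poly (coeff f k) t * (sample_moment N \<omega> t k - limit_moment_at c t k))"
              unfolding X_def integral_poly2_empirical[OF elim(2)] x[OF t] by (simp add: sum_subtractf right_diff_distrib)
            also have "\<bar>\<dots>\<bar> \<le> (\<Sum>k\<le>degree f. \<bar>poly (coeff f k) t\<bar> * \<delta>)"
            proof (intro order_trans[OF sum_abs] sum_mono)
              fix k assume "k \<in> {..degree f}"
              then have "\<bar>sample_moment N \<omega> t k - limit_moment_at c t k\<bar> \<le> \<delta>" using B(3) \<omega> t by auto
              then show "\<bar>poly (coeff f k) t * (sample_moment N \<omega> t k - limit_moment_at c t k)\<bar> \<le> \<bar>poly (coeff f k) t\<bar> * \<delta>"
                unfolding abs_mult by (intro mult_left_mono) auto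
            qed
            also have "\<dots> = (\<Sum>k\<le>degree f. \<bar>poly (coeff f k) t\<bar>) * \<delta>" by (simp add: sum_distrib_right)
            also have "\<dots> \<le> D * \<delta>" using D[OF t] \<delta>(1) by (intro mult_right_mono) auto
            finally show ?thesis .
          qed
          then have "sup_norm T (\<lambda>t. X N \<omega> t - x t) \<le> D * \<delta>"
            unfolding sup_norm_def using T by (intro cSUP_least) auto
          then show False using \<omega> \<delta>(2) by auto
        qed
        then have "measure (M N) {\<omega> \<in> space (M N). sup_norm T (\<lambda>t. X N \<omega> t - x t) \<ge> \<epsilon>} \<le> measure (M N) B"
          using B(1) by (rule finite_measure_mono)
        then show ?case using B(2) \<eta> by simp
      qed
    qed
  qed
  then show ?thesis
    using random_element_poly2 x_cont unfolding converges_in_probability_C_def X_def x_def by blast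
qed

end

theorem theorem2p1:
  fixes c T :: real
    and M :: "nat \<Rightarrow> 'a measure"
    and b lam :: "nat \<Rightarrow> nat \<Rightarrow> real \<Rightarrow> 'a \<Rightarrow> real"
  assumes "c > 0" and "T > 0"
    and "\<And>N. N \<ge> 1 \<Longrightarrow> dyson_brownian_motion (M N) (2 * c / real N) N (b N) (lam N)"
  shows "\<exists>\<mu> :: real \<Rightarrow> real measure.
    (\<forall>t\<in>{0..T}. prob_space (\<mu> t) \<and> sets (\<mu> t) = sets borel \<and>
       (\<forall>p :: real poly. integrable (\<mu> t) (poly p))) \<and>
    (\<forall>p :: real poly.
       converges_in_probability_C T M
         (\<lambda>N \<omega> t. \<integral>x. poly p x \<partial>empirical_measure N (\<lambda>i. lam N i t \<omega>))
         (\<lambda>t. \<integral>x. poly p x \<partial>\<mu> t)) \<and>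
    (\<forall>f :: real poly poly.
       converges_in_probability_C T M
         (\<lambda>N \<omega> t. \<integral>x. poly2 f t x \<partial>empirical_measure N (\<lambda>i. lam N i t \<omega>))
         (\<lambda>t. \<integral>x. poly2 f t x \<partial>\<mu> t)) \<and>
    (\<forall>f :: real poly poly. \<forall>t\<in>{0..T}.
       ((\<lambda>s. \<integral>x. poly2 f s x \<partial>\<mu> s) has_real_derivative
          (c / 2 * (\<integral>y. (\<integral>x. diff_quotient f t x y \<partial>\<mu> t) \<partial>\<mu> t)
           + (\<integral>x. 1 / 2 * poly2 (dx (dx f)) t x + poly2 (dt f) t x \<partial>\<mu> t)))
         (at t within {0..T}))"
proof -
  interpret dyson_sequence c T M b lam using assms by unfold_locales
  obtain \<mu> where dist: "\<And>t. t \<in> {0..T} \<Longrightarrow> real_distribution (\<mu> t)"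
    and int: "\<And>t p. t \<in> {0..T} \<Longrightarrow> integrable (\<mu> t) (\<lambda>x. x ^ p)"
    and mom: "\<And>t p. t \<in> {0..T} \<Longrightarrow> (\<integral>x. x ^ p \<partial>\<mu> t) = limit_moment_at c t p"
    using limit_process_exists by blast
  show ?thesis
  proof (intro exI[of _ \<mu>] conjI ballI allI)
    fix t assume t: "t \<in> {0..T}"
    show "prob_space (\<mu> t)" using dist[OF t] by (simp add: real_distribution_def)
    show "sets (\<mu> t) = sets borel" using dist[OF t] by (rule real_distribution.events_eq_borel)
    show "integrable (\<mu> t) (poly p)" for p
      using integral_sum_powers(2)[OF int[OF t], where I="{..degree p}" and a="coeff p" and e="\<lambda>k. k"] by (simp add: poly_altdef[abs_def])
  next
    fix f :: "real poly poly"
    show "converges_in_probability_C T M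
         (\<lambda>N \<omega> t. \<integral>x. poly2 f t x \<partial>empirical_measure N (\<lambda>i. lam N i t \<omega>))
         (\<lambda>t. \<integral>x. poly2 f t x \<partial>\<mu> t)"
      using int mom by (rule poly2_converges)
  next
    fix p :: "real poly"
    have "converges_in_probability_C T M
         (\<lambda>N \<omega> t. \<integral>x. poly2 (map_poly (\<lambda>a. [:a:]) p) t x \<partial>empirical_measure N (\<lambda>i. lam N i t \<omega>))
         (\<lambda>t. \<integral>x. poly2 (map_poly (\<lambda>a. [:a:]) p) t x \<partial>\<mu> t)"
      using int mom by (rule poly2_converges)
    then show "converges_in_probability_C T M
         (\<lambda>N \<omega> t. \<integral>x. poly p x \<partial>empirical_measure N (\<lambda>i. lam N i t \<omega>))
         (\<lambda>t. \<integral>x. poly p x \<partial>\<mu> t)"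
      by (simp only: poly2_constant_coefficients)
  next
    fix f :: "real poly poly" and t assume t: "t \<in> {0..T}"
    have D: "((\<lambda>s. \<Sum>k\<le>degree f. poly (coeff f k) s * limit_moment_at c s k) has_real_derivative
       (\<Sum>k\<le>degree f. poly (pderiv (coeff f k)) t * limit_moment_at c t k + poly (coeff f k) t * moment_drift c 1 k (limit_moment_at c t)))
       (at t within {0..T})"
    proof (rule DERIV_sum)
      fix k
      show "((\<lambda>s. poly (coeff f k) s * limit_moment_at c s k) has_real_derivative
         poly (pderiv (coeff f k)) t * limit_moment_at c t k + poly (coeff f k) t * moment_drift c 1 k (limit_moment_at c t))
         (at t within {0..T})"
        using DERIV_mult[OF has_field_derivative_at_within[OF poly_DERIV] limit_moment_at_has_derivative]
        by (rule DERIV_cong) simp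
    qed
    have eq: "(\<Sum>k\<le>degree f. poly (coeff f k) s * limit_moment_at c s k) = (\<integral>x. poly2 f s x \<partial>\<mu> s)" if "s \<in> {0..T}" for s
      using integral_poly2[OF int[OF that]] mom[OF that] by simp
    have "((\<lambda>s. \<integral>x. poly2 f s x \<partial>\<mu> s) has_real_derivative
       (\<Sum>k\<le>degree f. poly (pderiv (coeff f k)) t * limit_moment_at c t k + poly (coeff f k) t * moment_drift c 1 k (limit_moment_at c t)))
       (at t within {0..T})"
      by (rule has_field_derivative_transform_within[OF D zero_less_one t]) (rule eq)
    then show "((\<lambda>s. \<integral>x. poly2 f s x \<partial>\<mu> s) has_real_derivative
          (c / 2 * (\<integral>y. (\<integral>x. diff_quotient f t x y \<partial>\<mu> t) \<partial>\<mu> t)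
           + (\<integral>x. 1 / 2 * poly2 (dx (dx f)) t x + poly2 (dt f) t x \<partial>\<mu> t)))
         (at t within {0..T})"
      unfolding integral_generator_poly2[OF int[OF t]] mom[OF t] .
  qed
qed

end
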